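(* Let $F\colon\Sigma_k\times\mathbb S^1\to\Sigma_k\times\mathbb S^1$ be a transitive step skew-product map whose fiber maps are $C^1$ diffeomorphisms of $\mathbb S^1$. Then for every $\mu\in\mathscr M$ with $\chi(\mu)<0$ there exists $\widetilde\mu\in\mathscr M$ satisfying $\chi(\widetilde\mu)\ge0$ and $h(\widetilde\mu)=h(\mu)$. If $\mu$ is ergodic, then $\widetilde\mu$ can be chosen ergodic.
   Context: Let $k\ge 2$, let $\Sigma_k=\{0,\dots,k-1\}^{\mathbb Z}$ with the left shift $\sigma$, and $\mathbb S^1=\mathbb R/\mathbb Z$. Given $C^1$ diffeomorphisms $f_0,\dots,f_{k-1}$ of $\mathbb S^1$ (the fiber maps), the associated step skew-product is $F(\xi,x)=(\sigma(\xi),f_{\xi_0}(x))$. $F$ is transitive if for all nonempty open $U,V\subset\Sigma_k\times\mathbb S^1$ there is $n\ge1$ with $F^n(U)\cap V\neq\emptyset$. $\mathscr M$ is the set of $F$-invariant Borel probability measures, $h(\mu)$ is the metric entropy, and for $\mu\in\mathscr M$ the fiber Lyapunov exponent is $\chi(\mu)=\int\log|(f_{\xi_0})'(x)|\,d\mu(\xi,x)$. *)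

theory Defs
  imports "HOL-Probability.Probability"
begin

definition circle_rel :: "real \<Rightarrow> real \<Rightarrow> bool" where
  "circle_rel s t \<longleftrightarrow> s - t \<in> \<int>"

lemma equivp_circle_rel: "equivp circle_rel"
proof (rule equivpI)
  show "reflp circle_rel"
    by (simp add: reflp_def circle_rel_def)
  show "symp circle_rel"
    unfolding symp_def circle_rel_def by (metis Ints_minus minus_diff_eq)
  show "transp circle_rel"
    unfolding transp_def circle_rel_def by (metis Ints_add diff_add_cancel add_diff_eq)
qed

quotient_type circle = real / circle_rel
  by (rule equivp_circle_rel)

definition circle_of :: "real \<Rightarrow> circle" where
  "circle_of = abs_circle"

lemma circle_of_eq_iff: "circle_of s = circle_of t \<longleftrightarrow> s - t \<in> \<int>"
  unfolding circle_of_def by (simp add: circle.abs_eq_iff circle_rel_def)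

lemma surj_circle_of: "surj circle_of"
  unfolding circle_of_def surj_def
  by (metis Quotient3_abs_rep Quotient3_circle)

instantiation circle :: topological_space
begin

definition open_circle :: "circle set \<Rightarrow> bool" where
  "open_circle U \<longleftrightarrow> open (circle_of -` U)"

instance
proof
  show "open (UNIV :: circle set)"
    by (simp add: open_circle_def)
  show "open (S \<inter> T)" if "open S" "open T" for S T :: "circle set"
    using that by (simp add: open_circle_def open_Int)
  show "open (\<Union>K)" if "\<forall>S\<in>K. open S" for K :: "circle set set"
    using that by (simp add: open_circle_def vimage_Union open_UN)
qed

end

text \<open>
  The covering map \<^const>\<open>circle_of\<close> provides the charts of \<open>\<real>/\<int>\<close>: the derivative of a circle map
  is the derivative of a local lift to \<open>\<real>\<close>. Differentiability of the lift \<open>g\<close> at \<open>t\<close> makes it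
  continuous there, so its germ at \<open>t\<close> is unique up to an integer constant.
\<close>

definition has_circle_deriv :: "(circle \<Rightarrow> circle) \<Rightarrow> real \<Rightarrow> circle \<Rightarrow> bool" where
  "has_circle_deriv f D p \<longleftrightarrow>
     (\<exists>t g. circle_of t = p \<and> (\<forall>\<^sub>F s in nhds t. f (circle_of s) = circle_of (g s)) \<and>
            (g has_real_derivative D) (at t))"

definition circle_deriv :: "(circle \<Rightarrow> circle) \<Rightarrow> circle \<Rightarrow> real" where
  "circle_deriv f p = (THE D. has_circle_deriv f D p)"

lemma has_circle_deriv_unique:
  assumes "has_circle_deriv f D p" "has_circle_deriv f E p"
  shows "D = E"
proof -
  obtain t g where t: "circle_of t = p"
    and g: "\<forall>\<^sub>F s in nhds t. f (circle_of s) = circle_of (g s)"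
    and D: "(g has_real_derivative D) (at t)"
    using assms(1) unfolding has_circle_deriv_def by blast
  obtain u h where u: "circle_of u = p"
    and h: "\<forall>\<^sub>F s in nhds u. f (circle_of s) = circle_of (h s)"
    and E: "(h has_real_derivative E) (at u)"
    using assms(2) unfolding has_circle_deriv_def by blast
  define m where "m = u - t"
  have m: "m \<in> \<int>"
    using t u by (metis circle_of_eq_iff m_def)
  define h' where "h' s = h (s + m)" for s
  have E': "(h' has_real_derivative E) (at t)"
    using E DERIV_shift[of h E t m] by (simp add: h'_def[abs_def] m_def)
  have "filterlim (\<lambda>s. s + m) (nhds u) (nhds t)"
    unfolding m_def by (rule tendsto_eq_intros filterlim_ident | simp)+
  then have "\<forall>\<^sub>F s in nhds t. f (circle_of (s + m)) = circle_of (h (s + m))"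
    using h by (rule eventually_compose_filterlim[rotated])
  moreover have "circle_of (s + m) = circle_of s" for s
    using m by (simp add: circle_of_eq_iff)
  ultimately have h': "\<forall>\<^sub>F s in nhds t. f (circle_of s) = circle_of (h' s)"
    by (simp add: h'_def)
  define d where "d s = g s - h' s" for s
  have dZ: "\<forall>\<^sub>F s in nhds t. d s \<in> \<int>"
    using g h' by eventually_elim (simp add: d_def flip: circle_of_eq_iff)
  have dD: "(d has_real_derivative D - E) (at t)"
    unfolding d_def by (intro DERIV_diff D E')
  then have "isCont d t"
    by (rule DERIV_isCont)
  then have "filterlim d (nhds (d t)) (nhds t)"
    by (simp add: isCont_def tendsto_nhds_iff)
  then have "\<forall>\<^sub>F s in nhds t. dist (d s) (d t) < 1"
    by (rule tendstoD) simp
  with dZ have "\<forall>\<^sub>F s in nhds t. d s = d t"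
  proof eventually_elim
    case (elim s)
    have "d t \<in> \<int>"
      using eventually_nhds_x_imp_x[OF dZ] .
    with elim have "d s - d t \<in> \<int>" "\<bar>d s - d t\<bar> < 1"
      by (auto simp: dist_real_def)
    then have "d s - d t = 0"
      using Ints_nonzero_abs_less1 by blast
    then show ?case by simp
  qed
  then have "(d has_real_derivative 0) (at t)"
    by (subst DERIV_cong_ev[OF refl _ refl, where g = "\<lambda>_. d t"]) auto
  with dD have "D - E = 0"
    by (rule DERIV_unique)
  then show ?thesis by simp
qed

lemma circle_deriv_eqI: "has_circle_deriv f D p \<Longrightarrow> circle_deriv f p = D"
  unfolding circle_deriv_def by (blast intro: the_equality has_circle_deriv_unique)

definition circle_C1 :: "(circle \<Rightarrow> circle) \<Rightarrow> bool" where
  "circle_C1 f \<longleftrightarrow> (\<forall>p. \<exists>D. has_circle_deriv f D p) \<and> continuous_on UNIV (circle_deriv f)"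

definition circle_C1_diffeo :: "(circle \<Rightarrow> circle) \<Rightarrow> bool" where
  "circle_C1_diffeo f \<longleftrightarrow> bij f \<and> circle_C1 f \<and> circle_C1 (inv f)"

text \<open>
  \<open>\<Sigma>\<^sub>k\<close> is a subspace of the type \<^typ>\<open>int \<Rightarrow> nat\<close>, whose library topology is the product of
  discrete topologies. Maps are total on the ambient type; all dynamical notions below are
  relative to the invariant subset \<open>\<Sigma>\<^sub>k \<times> \<real>/\<int>\<close>.
\<close>

definition shift_space :: "nat \<Rightarrow> (int \<Rightarrow> nat) set" where
  "shift_space k = {\<xi>. \<forall>i. \<xi> i < k}"

definition left_shift :: "(int \<Rightarrow> nat) \<Rightarrow> (int \<Rightarrow> nat)" where
  "left_shift \<xi> = (\<lambda>i. \<xi> (i + 1))"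

definition skew_space :: "nat \<Rightarrow> ((int \<Rightarrow> nat) \<times> circle) set" where
  "skew_space k = shift_space k \<times> UNIV"

definition skew_product ::
  "(nat \<Rightarrow> circle \<Rightarrow> circle) \<Rightarrow> (int \<Rightarrow> nat) \<times> circle \<Rightarrow> (int \<Rightarrow> nat) \<times> circle" where
  "skew_product f = (\<lambda>(\<xi>, x). (left_shift \<xi>, f (\<xi> 0) x))"

definition transitive_on :: "'a::topological_space set \<Rightarrow> ('a \<Rightarrow> 'a) \<Rightarrow> bool" where
  "transitive_on X T \<longleftrightarrow>
     (\<forall>U V. openin (top_of_set X) U \<and> openin (top_of_set X) V \<and> U \<noteq> {} \<and> V \<noteq> {} \<longrightarrow>
        (\<exists>n\<ge>1. (T ^^ n) ` U \<inter> V \<noteq> {}))"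

definition invariant_prob_measures ::
  "'a::topological_space set \<Rightarrow> ('a \<Rightarrow> 'a) \<Rightarrow> 'a measure set" where
  "invariant_prob_measures X T =
     {M. sets M = sets (restrict_space borel X) \<and> prob_space M \<and>
         T \<in> M \<rightarrow>\<^sub>M M \<and> distr M M T = M}"

definition ergodic :: "('a \<Rightarrow> 'a) \<Rightarrow> 'a measure \<Rightarrow> bool" where
  "ergodic T M \<longleftrightarrow>
     (\<forall>A\<in>sets M. T -` A \<inter> space M = A \<longrightarrow> measure M A = 0 \<or> measure M A = 1)"

definition finite_measurable_partition :: "'a measure \<Rightarrow> 'a set set \<Rightarrow> bool" where
  "finite_measurable_partition M P \<longleftrightarrow> finite P \<and> P \<subseteq> sets M \<and> partition_on (space M) P"

text \<open>Null atoms contribute \<open>0\<close>, since \<open>0 * ln 0 = 0\<close>.\<close>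

definition partition_entropy :: "'a measure \<Rightarrow> 'a set set \<Rightarrow> real" where
  "partition_entropy M P = - (\<Sum>A\<in>P. measure M A * ln (measure M A))"

text \<open>The join of \<open>T\<^sup>-\<^sup>i P\<close> for \<open>i < n\<close>, that is, the set of its nonempty atoms.\<close>

definition iterated_join :: "('a \<Rightarrow> 'a) \<Rightarrow> 'a measure \<Rightarrow> 'a set set \<Rightarrow> nat \<Rightarrow> 'a set set" where
  "iterated_join T M P n =
     {space M \<inter> (\<Inter>i<n. (T ^^ i) -` A i) | A. \<forall>i<n. A i \<in> P} - {{}}"

definition entropy_wrt_partition :: "('a \<Rightarrow> 'a) \<Rightarrow> 'a measure \<Rightarrow> 'a set set \<Rightarrow> real" where
  "entropy_wrt_partition T M P =
     lim (\<lambda>n. partition_entropy M (iterated_join T M P n) / real n)"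

definition metric_entropy :: "('a \<Rightarrow> 'a) \<Rightarrow> 'a measure \<Rightarrow> ereal" where
  "metric_entropy T M =
     (SUP P \<in> Collect (finite_measurable_partition M). ereal (entropy_wrt_partition T M P))"

definition fiber_exponent ::
  "(nat \<Rightarrow> circle \<Rightarrow> circle) \<Rightarrow> ((int \<Rightarrow> nat) \<times> circle) measure \<Rightarrow> real" where
  "fiber_exponent f M = (\<integral>(\<xi>, x). ln \<bar>circle_deriv (f (\<xi> 0)) x\<bar> \<partial>M)"

end

theory Submission
  imports Defs
begin

text \<open>
  Write \<open>\<nu>\<close> for the projection of \<open>\<mu>\<close> to \<open>\<Sigma>\<^sub>k\<close>. The measure that is sought is found among the lifts of
  \<open>\<nu>\<close>, the invariant probability measures that project to \<open>\<nu>\<close>. Three facts carry the proof.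

  A lift with nonnegative exponent exists (\<open>exists_nonneg_lift\<close>). A differentiable map of the circle
  onto itself has a point where its derivative has modulus at least 1, since otherwise it would
  strictly decrease distances (\<open>exists_noncontracting_point\<close>). Apply this to the \<open>n\<close>-th fiber iterate
  over \<open>\<xi>\<close>, which depends on finitely many symbols only. This gives a measure on a graph over the base
  for which the first \<open>n\<close> steps of the orbit are not contracting, and a weak limit of its orbit
  averages is a lift with nonnegative exponent. Weak compactness (\<open>skew_measures_seq_compact\<close>) is
  obtained by coding \<open>\<Sigma>\<^sub>k \<times> \<real>/\<int>\<close> by a Cantor set of reals and Helly selection.

  All lifts have the same entropy (\<open>metric_entropy_lift_eq\<close>), namely that of \<open>\<nu>\<close>. The fiber maps are
  homeomorphisms of the circle, so the number of fiber itineraries of length \<open>n\<close> with respect to a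
  partition into arcs grows linearly in \<open>n\<close> (\<open>card_level_itineraries\<close>), and products of cylinders and
  arcs approximate all partitions (\<open>entropy_wrt_partition_le\<close>).

  If \<open>\<mu>\<close> is ergodic, so is \<open>\<nu>\<close>, and extreme points of the set of lifts are ergodic
  (\<open>uniform_measure_lift\<close>). An extreme point with nonnegative exponent is found by maximising the
  exponent, and then a strictly convex functional on the set of maximisers (\<open>exists_extremal_lift\<close>).
\<close>

section \<open>The circle as a compact metric space\<close>

text \<open>
  The distance of two points of \<open>\<real>/\<int>\<close> is the distance of the difference of two representatives
  to the nearest integer. It induces the quotient topology.
\<close>

instantiation circle :: metric_space
begin

definition dist_circle :: "circle \<Rightarrow> circle \<Rightarrow> real" where
  "dist_circle x y =
     \<bar>(rep_circle x - rep_circle y) - of_int (round (rep_circle x - rep_circle y))\<bar>"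

definition uniformity_circle :: "(circle \<times> circle) filter" where
  "uniformity_circle = (INF e\<in>{0 <..}. principal {(x, y). dist x y < e})"

lemma circle_of_rep_circle: "circle_of (rep_circle x) = x"
  unfolding circle_of_def by (rule Quotient3_abs_rep[OF Quotient3_circle])

lemma dist_circle_of: "dist (circle_of s) (circle_of t) = \<bar>(s - t) - of_int (round (s - t))\<bar>"
proof -
  let ?s = "rep_circle (circle_of s)" and ?t = "rep_circle (circle_of t)"
  obtain m n :: int where m: "?s - s = of_int m" and n: "?t - t = of_int n"
    using circle_of_eq_iff circle_of_rep_circle by (metis Ints_cases)
  have "?s - ?t = (s - t) + of_int (m - n)"
    using m n by simp
  moreover have "round ((s - t) + of_int (m - n)) = round (s - t) + (m - n)"
    unfolding round_def by (metis add.commute add.left_commute floor_add_int)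
  ultimately show ?thesis
    by (simp add: dist_circle_def)
qed

lemma dist_circle_of_le: "dist (circle_of s) (circle_of t) \<le> \<bar>s - t - of_int n\<bar>"
  unfolding dist_circle_of by (rule round_diff_minimal)

lemma dist_circle_of_obtain:
  obtains n :: int where "dist (circle_of s) (circle_of t) = \<bar>s - t - of_int n\<bar>"
  unfolding dist_circle_of by blast

lemma circle_of_add_int: "circle_of (t + of_int n) = circle_of t"
  by (simp add: circle_of_eq_iff)

instance
proof
  show "uniformity = (INF e\<in>{0 <..}. principal {(x, y :: circle). dist x y < e})"
    by (rule uniformity_circle_def)
next
  fix U :: "circle set"
  have ev: "eventually P (uniformity :: (circle \<times> circle) filter)
      \<longleftrightarrow> (\<exists>e>0. \<forall>x y. dist x y < e \<longrightarrow> P (x, y))" for P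
    unfolding uniformity_circle_def
    by (subst eventually_INF_base)
       (auto simp: eventually_principal subset_eq intro: bexI[of _ "min _ _"])
  show "open U \<longleftrightarrow> (\<forall>x\<in>U. \<forall>\<^sub>F (x', y) in uniformity. x' = x \<longrightarrow> y \<in> U)"
    unfolding ev
  proof
    assume U: "open U"
    show "\<forall>x\<in>U. \<exists>e>0. \<forall>x' y. dist x' y < e \<longrightarrow> (case (x', y) of (x', y) \<Rightarrow> x' = x \<longrightarrow> y \<in> U)"
    proof
      fix x assume "x \<in> U"
      then have "rep_circle x \<in> circle_of -` U"
        by (simp add: circle_of_rep_circle)
      then obtain e where e: "e > 0" "\<And>s. dist s (rep_circle x) < e \<Longrightarrow> circle_of s \<in> U"
        using U unfolding open_circle_def open_dist by auto
      have "y \<in> U" if y: "dist x y < e" for y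
      proof -
        obtain n :: int where "dist (circle_of (rep_circle x)) (circle_of (rep_circle y))
            = \<bar>rep_circle x - rep_circle y - of_int n\<bar>"
          by (rule dist_circle_of_obtain)
        then have "dist (rep_circle y + of_int n) (rep_circle x) < e"
          using y by (simp add: circle_of_rep_circle dist_real_def)
        then have "circle_of (rep_circle y + of_int n) \<in> U"
          by (rule e)
        then show "y \<in> U"
          by (simp add: circle_of_add_int circle_of_rep_circle)
      qed
      with e(1) show "\<exists>e>0. \<forall>x' y. dist x' y < e \<longrightarrow> (case (x', y) of (x', y) \<Rightarrow> x' = x \<longrightarrow> y \<in> U)"
        by auto
    qed
  next
    assume U: "\<forall>x\<in>U. \<exists>e>0. \<forall>x' y. dist x' y < e \<longrightarrow> (case (x', y) of (x', y) \<Rightarrow> x' = x \<longrightarrow> y \<in> U)"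
    show "open U"
      unfolding open_circle_def open_dist
    proof (intro ballI)
      fix t assume "t \<in> circle_of -` U"
      then obtain e where e: "e > 0" "\<And>y. dist (circle_of t) y < e \<Longrightarrow> y \<in> U"
        using U by fastforce
      have "circle_of s \<in> U" if "dist s t < e" for s
      proof (rule e)
        show "dist (circle_of t) (circle_of s) < e"
          using dist_circle_of_le[of t s 0] that by (simp add: dist_real_def)
      qed
      with e(1) show "\<exists>e>0. \<forall>y. dist y t < e \<longrightarrow> y \<in> circle_of -` U"
        by auto
    qed
  qed
next
  fix x y :: circle
  show "dist x y = 0 \<longleftrightarrow> x = y"
  proof
    assume "dist x y = 0"
    then have "rep_circle x - rep_circle y = of_int (round (rep_circle x - rep_circle y))"
      by (simp add: dist_circle_def)
    then have "rep_circle x - rep_circle y \<in> \<int>"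
      by (metis Ints_of_int)
    then show "x = y"
      by (metis circle_of_eq_iff circle_of_rep_circle)
  qed (simp add: dist_circle_def)
next
  fix x y z :: circle
  let ?x = "rep_circle x" and ?y = "rep_circle y" and ?z = "rep_circle z"
  obtain m :: int where m: "dist (circle_of ?x) (circle_of ?z) = \<bar>?x - ?z - of_int m\<bar>"
    by (rule dist_circle_of_obtain)
  obtain n :: int where n: "dist (circle_of ?y) (circle_of ?z) = \<bar>?y - ?z - of_int n\<bar>"
    by (rule dist_circle_of_obtain)
  have "dist (circle_of ?x) (circle_of ?y) \<le> \<bar>?x - ?y - of_int (m - n)\<bar>"
    by (rule dist_circle_of_le)
  also have "\<dots> \<le> \<bar>?x - ?z - of_int m\<bar> + \<bar>?y - ?z - of_int n\<bar>"
    by simp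
  finally show "dist x y \<le> dist x z + dist y z"
    using m n by (simp add: circle_of_rep_circle)
qed

end

lemma dist_circle_of_le_abs: "dist (circle_of s) (circle_of t) \<le> \<bar>s - t\<bar>"
  using dist_circle_of_le[of s t 0] by simp

lemma continuous_on_circle_of: "continuous_on S circle_of"
  by (rule continuous_on_subset[where s = UNIV])
    (simp_all add: continuous_on_open_vimage open_circle_def)

lemma open_circle_of_image:
  assumes "open W"
  shows "open (circle_of ` W)"
proof -
  have "circle_of -` (circle_of ` W) = (\<Union>n::int. (\<lambda>t. t + of_int n) ` W)"
  proof (intro equalityI subsetI)
    fix t assume "t \<in> circle_of -` (circle_of ` W)"
    then obtain s where "s \<in> W" "circle_of t = circle_of s"
      by auto
    then obtain n :: int where "t - s = of_int n"
      by (metis circle_of_eq_iff Ints_cases)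
    then have "t = s + of_int n"
      by simp
    with \<open>s \<in> W\<close> show "t \<in> (\<Union>n::int. (\<lambda>t. t + of_int n) ` W)"
      by blast
  qed (auto simp: circle_of_add_int)
  moreover have "open ((\<lambda>t. t + of_int n) ` W)" for n :: int
    using open_translation[OF assms, of "of_int n"] by (simp add: add.commute)
  ultimately show ?thesis
    unfolding open_circle_def by auto
qed

instance circle :: second_countable_topology
proof
  obtain B :: "real set set" where B: "countable B" "topological_basis B"
    using ex_countable_basis by blast
  let ?C = "(`) circle_of ` B"
  have "topological_basis ?C"
  proof (rule topological_basisI)
    show "open C" if "C \<in> ?C" for C
      using that B(2) topological_basis_open open_circle_of_image by blast
  next
    fix U :: "circle set" and x assume U: "open U" "x \<in> U"
    obtain t where t: "circle_of t = x"
      using surj_circle_of by (metis surjD)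
    have "open (circle_of -` U)"
      using U(1) by (simp add: open_circle_def)
    then obtain W where "W \<in> B" "t \<in> W" "W \<subseteq> circle_of -` U"
      using topological_basisE[OF B(2)] t U(2) by (metis vimage_eq)
    then show "\<exists>C\<in>?C. x \<in> C \<and> C \<subseteq> U"
      using t by (intro bexI[of _ "circle_of ` W"]) auto
  qed
  then have "open = generate_topology ?C"
    by (rule topological_basis_imp_subbasis)
  with B(1) show "\<exists>B::circle set set. countable B \<and> open = generate_topology B"
    by blast
qed

text \<open>
  The representative in \<open>[0,1)\<close> of a point of the circle; a Borel section of the covering map.
\<close>

definition circle_coord :: "circle \<Rightarrow> real" where
  "circle_coord x = frac (rep_circle x)"

lemma circle_of_coord [simp]: "circle_of (circle_coord x) = x"
proof -
  have "circle_of (circle_coord x) = circle_of (circle_coord x + of_int \<lfloor>rep_circle x\<rfloor>)"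
    by (simp only: circle_of_add_int)
  also have "\<dots> = x"
    by (simp add: circle_coord_def frac_def circle_of_rep_circle)
  finally show ?thesis .
qed

lemma circle_coord_nonneg [simp]: "0 \<le> circle_coord x"
  and circle_coord_less_1 [simp]: "circle_coord x < 1"
  by (simp_all add: circle_coord_def frac_lt_1)

lemma circle_coord_of: "0 \<le> t \<Longrightarrow> t < 1 \<Longrightarrow> circle_coord (circle_of t) = t"
proof -
  assume t: "0 \<le> t" "t < 1"
  have "circle_coord (circle_of t) - t \<in> \<int>"
    by (simp flip: circle_of_eq_iff)
  moreover have "\<bar>circle_coord (circle_of t) - t\<bar> < 1"
    using t circle_coord_nonneg[of "circle_of t"] circle_coord_less_1[of "circle_of t"]
    by linarith
  ultimately show ?thesis
    using Ints_nonzero_abs_less1 by (metis eq_iff_diff_eq_0)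
qed

lemma compact_circle: "compact (UNIV :: circle set)"
proof -
  have "compact (circle_of ` {0..1})"
    by (intro compact_continuous_image continuous_on_circle_of) simp
  moreover have "circle_of ` {0..1} = UNIV"
  proof -
    have "x \<in> circle_of ` {0..1}" for x
      using circle_of_coord[of x] circle_coord_nonneg[of x] circle_coord_less_1[of x]
      by (metis atLeastAtMost_iff image_eqI less_eq_real_def)
    then show ?thesis by auto
  qed
  ultimately show ?thesis by simp
qed

lemma borel_measurable_circle_coord [measurable]: "circle_coord \<in> borel_measurable borel"
proof (rule borel_measurableI_le)
  fix a :: real
  consider "a < 0" | "0 \<le> a" "a < 1" | "1 \<le> a" by linarith
  then show "{x \<in> space borel. circle_coord x \<le> a} \<in> sets borel"
  proof cases
    case 1
    then have "{x \<in> space borel. circle_coord x \<le> a} = {}"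
      using circle_coord_nonneg order.trans by (metis (no_types, lifting) empty_Collect_eq not_le)
    then show ?thesis by simp
  next
    case 2
    have "{x \<in> space borel. circle_coord x \<le> a} = circle_of ` {0..a}"
    proof (intro equalityI subsetI)
      fix x assume "x \<in> {x \<in> space borel. circle_coord x \<le> a}"
      then show "x \<in> circle_of ` {0..a}"
        by (intro image_eqI[of _ _ "circle_coord x"]) auto
    next
      fix x assume "x \<in> circle_of ` {0..a}"
      then show "x \<in> {x \<in> space borel. circle_coord x \<le> a}"
        using 2 by (auto simp: circle_coord_of)
    qed
    moreover have "compact (circle_of ` {0..a})"
      by (intro compact_continuous_image continuous_on_circle_of) simp
    ultimately show ?thesis
      by (simp add: borel_closed compact_imp_closed)
  next
    case 3
    have "circle_coord x \<le> a" for x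
      using circle_coord_less_1[of x] 3 by linarith
    then have "{x \<in> space borel. circle_coord x \<le> a} = UNIV"
      by simp
    then show ?thesis by simp
  qed
qed

section \<open>Derivatives of circle maps\<close>

text \<open>
  The local lift in the definition of the derivative can be taken at any given representative.
\<close>

lemma has_circle_deriv_at:
  assumes "has_circle_deriv f D (circle_of t)"
  obtains g where "\<forall>\<^sub>F s in nhds t. f (circle_of s) = circle_of (g s)"
    "(g has_real_derivative D) (at t)"
proof -
  obtain u h where u: "circle_of u = circle_of t"
    and h: "\<forall>\<^sub>F s in nhds u. f (circle_of s) = circle_of (h s)"
    and D: "(h has_real_derivative D) (at u)"
    using assms unfolding has_circle_deriv_def by blast
  define m where "m = u - t"
  have m: "m \<in> \<int>"
    using u by (simp add: circle_of_eq_iff m_def)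
  have D': "((\<lambda>s. h (s + m)) has_real_derivative D) (at t)"
    using D DERIV_shift[of h D t m] by (simp add: m_def)
  have "filterlim (\<lambda>s. s + m) (nhds u) (nhds t)"
    unfolding m_def by (rule tendsto_eq_intros filterlim_ident | simp)+
  then have "\<forall>\<^sub>F s in nhds t. f (circle_of (s + m)) = circle_of (h (s + m))"
    using h by (rule eventually_compose_filterlim[rotated])
  moreover have "circle_of (s + m) = circle_of s" for s
    using m by (simp add: circle_of_eq_iff)
  ultimately show ?thesis
    using D' that[of "\<lambda>s. h (s + m)"] by simp
qed

lemma has_circle_deriv_isCont:
  assumes "has_circle_deriv f D p"
  shows "isCont f p"
proof -
  define t where "t = circle_coord p"
  have p: "p = circle_of t" by (simp add: t_def)
  obtain g where g: "\<forall>\<^sub>F s in nhds t. f (circle_of s) = circle_of (g s)"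
    and D: "(g has_real_derivative D) (at t)"
    using assms unfolding p by (rule has_circle_deriv_at)
  have "f p = circle_of (g t)"
    using eventually_nhds_x_imp_x[OF g] p by simp
  have contg: "filterlim g (nhds (g t)) (nhds t)"
    using DERIV_isCont[OF D] by (simp add: isCont_def tendsto_nhds_iff)
  have "filterlim f (nhds (f p)) (nhds p)"
  proof (subst filterlim_iff, intro allI impI)
    fix P assume "eventually P (nhds (f p))"
    then obtain U where U: "open U" "f p \<in> U" "\<forall>y\<in>U. P y"
      by (auto simp: eventually_nhds)
    have "open (circle_of -` U)" "g t \<in> circle_of -` U"
      using U \<open>f p = circle_of (g t)\<close> by (auto simp: open_circle_def)
    then have "\<forall>\<^sub>F s in nhds t. g s \<in> circle_of -` U"
      by (rule eventually_compose_filterlim[OF eventually_nhds_in_open contg])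
    with g have "\<forall>\<^sub>F s in nhds t. f (circle_of s) \<in> U"
      by eventually_elim simp
    then obtain W where W: "open W" "t \<in> W" "\<forall>s\<in>W. f (circle_of s) \<in> U"
      by (auto simp: eventually_nhds)
    then have "open (circle_of ` W)" "p \<in> circle_of ` W"
      using open_circle_of_image p by auto
    then show "\<forall>\<^sub>F x in nhds p. P (f x)"
      unfolding eventually_nhds using W U by (intro exI[of _ "circle_of ` W"]) auto
  qed
  then show ?thesis
    by (simp add: isCont_def tendsto_nhds_iff)
qed

lemma has_circle_deriv_compose:
  assumes f: "has_circle_deriv f D p" and h: "has_circle_deriv h E (f p)"
  shows "has_circle_deriv (h \<circ> f) (E * D) p"
proof -
  define t where "t = circle_coord p"
  have p: "p = circle_of t" by (simp add: t_def)
  obtain g where g: "\<forall>\<^sub>F s in nhds t. f (circle_of s) = circle_of (g s)"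
    and D: "(g has_real_derivative D) (at t)"
    using f unfolding p by (rule has_circle_deriv_at)
  have fp: "f p = circle_of (g t)"
    using eventually_nhds_x_imp_x[OF g] p by simp
  obtain j where j: "\<forall>\<^sub>F s in nhds (g t). h (circle_of s) = circle_of (j s)"
    and E: "(j has_real_derivative E) (at (g t))"
    using h unfolding fp by (rule has_circle_deriv_at)
  have "filterlim g (nhds (g t)) (nhds t)"
    using DERIV_isCont[OF D] by (simp add: isCont_def tendsto_nhds_iff)
  then have "\<forall>\<^sub>F s in nhds t. h (circle_of (g s)) = circle_of (j (g s))"
    using j by (rule eventually_compose_filterlim[rotated])
  with g have "\<forall>\<^sub>F s in nhds t. (h \<circ> f) (circle_of s) = circle_of ((j \<circ> g) s)"
    by eventually_elim simp
  moreover have "(j \<circ> g has_real_derivative E * D) (at t)"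
    using DERIV_chain[OF E D] .
  ultimately show ?thesis
    unfolding has_circle_deriv_def p by blast
qed

lemma has_circle_deriv_id: "has_circle_deriv id 1 p"
  unfolding has_circle_deriv_def
proof (intro exI conjI)
  show "circle_of (circle_coord p) = p" by simp
  show "\<forall>\<^sub>F s in nhds (circle_coord p). id (circle_of s) = circle_of (id s)" by simp
  show "(id has_real_derivative 1) (at (circle_coord p))"
    unfolding id_def by (rule DERIV_ident)
qed

lemma circle_C1_has_deriv: "circle_C1 f \<Longrightarrow> has_circle_deriv f (circle_deriv f p) p"
  unfolding circle_C1_def using circle_deriv_eqI by metis

lemma circle_C1_diffeo_deriv_nonzero:
  assumes "circle_C1_diffeo f"
  shows "circle_deriv f p \<noteq> 0"
proof
  assume 0: "circle_deriv f p = 0"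
  have "has_circle_deriv f (circle_deriv f p) p"
    "has_circle_deriv (inv f) (circle_deriv (inv f) (f p)) (f p)"
    using assms by (auto simp: circle_C1_diffeo_def circle_C1_has_deriv)
  then have "has_circle_deriv (inv f \<circ> f) 0 p"
    using has_circle_deriv_compose 0 by fastforce
  moreover have "inv f \<circ> f = id"
    using assms by (simp add: circle_C1_diffeo_def bij_is_inj)
  ultimately have "has_circle_deriv id 0 p"
    by simp
  then have "(0::real) = 1"
    by (rule has_circle_deriv_unique) (rule has_circle_deriv_id)
  then show False by simp
qed

lemma circle_C1_diffeo_continuous: "circle_C1_diffeo f \<Longrightarrow> continuous_on UNIV f"
  using has_circle_deriv_isCont circle_C1_has_deriv
  by (metis circle_C1_diffeo_def continuous_at_imp_continuous_on)

text \<open>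
  A differentiable map with derivative of modulus less than 1 everywhere strictly shortens arcs,
  hence strictly decreases every positive distance. It then cannot be onto, because the circle
  contains two points at distance \<open>1/2\<close>, which is the largest possible distance.
  This is the only place where the geometry of the circle enters the estimate of the exponent.
\<close>

lemma exists_noncontracting_point:
  assumes surj: "surj q" and D: "\<And>p. has_circle_deriv q (D p) p"
  shows "\<exists>p. \<bar>D p\<bar> \<ge> 1"
proof (rule ccontr)
  assume "\<not> ?thesis"
  then have D1: "\<bar>D p\<bar> < 1" for p
    by (meson not_le)
  define Q where "Q = q \<circ> circle_of"
  have near: "\<exists>d>0. \<forall>s. s \<noteq> t \<and> \<bar>s - t\<bar> < d \<longrightarrow> dist (Q s) (Q t) < \<bar>s - t\<bar>" for t
  proof -
    obtain g where g: "\<forall>\<^sub>F s in nhds t. q (circle_of s) = circle_of (g s)"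
      and g': "(g has_real_derivative D (circle_of t)) (at t)"
      by (rule has_circle_deriv_at[OF D])
    have "((\<lambda>s. \<bar>(g s - g t) / (s - t)\<bar>) \<longlongrightarrow> \<bar>D (circle_of t)\<bar>) (at t)"
      using g' by (intro tendsto_rabs) (simp add: has_field_derivative_iff)
    then have "\<forall>\<^sub>F s in at t. \<bar>(g s - g t) / (s - t)\<bar> < 1"
      using D1 by (rule order_tendstoD)
    then have "\<forall>\<^sub>F s in nhds t. s \<noteq> t \<longrightarrow> \<bar>(g s - g t) / (s - t)\<bar> < 1"
      by (simp add: eventually_at_filter)
    with g have "\<forall>\<^sub>F s in nhds t. s \<noteq> t \<longrightarrow> dist (Q s) (Q t) < \<bar>s - t\<bar>"
    proof eventually_elim
      case (elim s)
      show ?case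
      proof
        assume "s \<noteq> t"
        have "dist (Q s) (Q t) = dist (circle_of (g s)) (circle_of (g t))"
          using elim eventually_nhds_x_imp_x[OF g] by (simp add: Q_def)
        also have "\<dots> \<le> \<bar>g s - g t\<bar>"
          by (rule dist_circle_of_le_abs)
        also have "\<dots> < \<bar>s - t\<bar>"
          using elim \<open>s \<noteq> t\<close> by (simp add: divide_simps abs_divide split: if_splits)
        finally show "dist (Q s) (Q t) < \<bar>s - t\<bar>" .
      qed
    qed
    then show ?thesis
      by (auto simp: eventually_nhds_metric dist_real_def)
  qed
  have contract: "dist (Q a) (Q b) < b - a" if "a < b" for a b
  proof -
    have "a \<le> b" using that by simp
    \<comment> \<open>Bisection: the strict local estimate is additive over adjacent intervals.\<close>
    then have "a < b \<longrightarrow> dist (Q a) (Q b) < b - a"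
    proof (induction rule: Bolzano)
      case (trans a b c)
      have "dist (Q a) (Q c) \<le> dist (Q a) (Q b) + dist (Q b) (Q c)"
        by (rule dist_triangle)
      then show ?case
        using trans by (cases "a = b"; cases "b = c") auto
    next
      case (local x)
      obtain d where d: "d > 0" "\<And>s. s \<noteq> x \<Longrightarrow> \<bar>s - x\<bar> < d \<Longrightarrow> dist (Q s) (Q x) < \<bar>s - x\<bar>"
        using near by blast
      have "a < b \<longrightarrow> dist (Q a) (Q b) < b - a" if "a \<le> x" "x \<le> b" "b - a < d" for a b
      proof
        assume "a < b"
        have "dist (Q a) (Q b) \<le> dist (Q a) (Q x) + dist (Q b) (Q x)"
          by (rule dist_triangle2)
        then show "dist (Q a) (Q b) < b - a"
          using d(2)[of a] d(2)[of b] that \<open>a < b\<close> by (cases "a = x"; cases "b = x") auto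
      qed
      with d(1) show ?case by blast
    qed
    with that show ?thesis by blast
  qed
  obtain x y where x: "q x = circle_of 0" and y: "q y = circle_of (1/2)"
    using surj by (metis surjD)
  define a where "a = circle_coord x"
  obtain n :: int where n: "dist (circle_of a) (circle_of (circle_coord y))
      = \<bar>a - circle_coord y - of_int n\<bar>"
    by (rule dist_circle_of_obtain)
  \<comment> \<open>The representatives of the two preimages are chosen to realise their circle distance.\<close>
  define b where "b = circle_coord y + of_int n"
  have Qa: "Q a = circle_of 0" and Qb: "Q b = circle_of (1/2)"
    by (simp_all add: Q_def a_def b_def circle_of_add_int x y)
  have half: "dist (circle_of s) (circle_of t) \<le> 1/2" for s t
    unfolding dist_circle_of using of_int_round_abs_le[of "s - t"] by linarith
  have "\<bar>a - b\<bar> \<le> 1/2"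
    using half[of a "circle_coord y"] n by (simp add: b_def algebra_simps)
  moreover have "dist (Q a) (Q b) = 1/2"
    unfolding Qa Qb dist_circle_of by (simp add: round_def)
  moreover have "dist (Q a) (Q b) < \<bar>a - b\<bar>"
    using contract[of a b] contract[of b a] calculation(2)
    by (cases a b rule: linorder_cases) (auto simp: dist_commute)
  ultimately show False by linarith
qed

section \<open>Weak convergence on Cantor-coded spaces\<close>

text \<open>
  Continuous functions increasing to the indicator of an open set \<open>U\<close>. The case distinction is
  needed because the distance to the empty complement of \<open>UNIV\<close> is \<open>0\<close> by convention.
\<close>

definition bump :: "'a::metric_space set \<Rightarrow> nat \<Rightarrow> 'a \<Rightarrow> real" where
  "bump U N x = (if U = UNIV then 1 else min 1 (real N * infdist x (- U)))"

lemma continuous_on_bump: "continuous_on S (bump U N)"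
  unfolding bump_def by (cases "U = UNIV") (auto intro!: continuous_intros)

lemma bump_nonneg: "0 \<le> bump U N x" and bump_le_1: "bump U N x \<le> 1"
  unfolding bump_def by (auto simp: infdist_nonneg)

lemma bump_tendsto:
  assumes "open U"
  shows "(\<lambda>N. bump U N x) \<longlonglongrightarrow> indicator U x"
proof (cases "U = UNIV")
  case False
  show ?thesis
  proof (cases "x \<in> U")
    case True
    have pos: "infdist x (- U) > 0"
      using assms False True by (intro infdist_pos_not_in_closed) auto
    obtain N0 :: nat where N0: "1 / infdist x (- U) < real N0"
      using reals_Archimedean2 by blast
    have "\<forall>\<^sub>F N in sequentially. bump U N x = 1"
      using eventually_ge_at_top[of N0]
    proof eventually_elim
      case (elim N)
      have "1 \<le> real N0 * infdist x (- U)"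
        using N0 pos by (simp add: field_simps)
      also have "\<dots> \<le> real N * infdist x (- U)"
        using elim pos by (intro mult_right_mono) auto
      finally show ?case
        using False by (simp add: bump_def)
    qed
    then show ?thesis
      using True by (simp add: tendsto_eventually)
  qed (simp add: bump_def False)
qed (simp add: bump_def)

lemma borel_measurable_restrictI:
  "sets M = sets (restrict_space borel \<Omega>) \<Longrightarrow> continuous_on \<Omega> \<phi> \<Longrightarrow> \<phi> \<in> borel_measurable M"
  using borel_measurable_continuous_on_restrict measurable_cong_sets by blast

lemma space_of_sets_restrict_borel:
  "sets M = sets (restrict_space borel \<Omega>) \<Longrightarrow> space M = \<Omega>"
  by (metis sets_eq_imp_space_eq space_restrict_space space_borel Int_UNIV_right)

lemma measure_eqI_bump:
  fixes M M' :: "'a::metric_space measure"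
  assumes \<G>: "\<And>U. U \<in> \<G> \<Longrightarrow> open U" "Int_stable \<G>" "UNIV \<in> \<G>" "borel = sigma UNIV \<G>"
    and \<Omega>: "\<Omega> \<in> sets borel"
    and M: "prob_space M" "sets M = sets (restrict_space borel \<Omega>)"
    and M': "prob_space M'" "sets M' = sets (restrict_space borel \<Omega>)"
    and eq: "\<And>U N. U \<in> \<G> \<Longrightarrow> (\<integral>x. bump U N x \<partial>M) = (\<integral>x. bump U N x \<partial>M')"
  shows "M = M'"
proof -
  have lim: "(\<lambda>N. \<integral>x. bump U N x \<partial>K) \<longlonglongrightarrow> measure K (\<Omega> \<inter> U)"
    if K: "prob_space K" "sets K = sets (restrict_space borel \<Omega>)" and U: "open U"
    for K :: "'a measure" and U
  proof -
    interpret prob_space K by fact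
    have sp: "space K = \<Omega>" using K(2) by (rule space_of_sets_restrict_borel)
    have inK: "\<Omega> \<inter> U \<in> sets K"
      using K(2) U by (auto simp: sets_restrict_space)
    have ind: "indicator U \<in> borel_measurable K"
    proof -
      have "indicator (\<Omega> \<inter> U) \<in> borel_measurable K" using inK by simp
      then show ?thesis
        by (subst measurable_cong[where g = "indicator (\<Omega> \<inter> U)"]) (auto simp: sp indicator_def)
    qed
    have "(\<lambda>N. \<integral>x. bump U N x \<partial>K) \<longlonglongrightarrow> (\<integral>x. indicator U x \<partial>K)"
    proof (rule integral_dominated_convergence[where w = "\<lambda>_. 1"])
      show "indicator U \<in> borel_measurable K" by fact
      show "\<And>i. bump U i \<in> borel_measurable K"
        using K(2) continuous_on_bump by (rule borel_measurable_restrictI)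
      show "AE x in K. (\<lambda>i. bump U i x) \<longlonglongrightarrow> indicator U x"
        using bump_tendsto[OF U] by simp
      show "\<And>i. AE x in K. norm (bump U i x) \<le> 1"
        by (simp add: bump_nonneg bump_le_1)
    qed simp
    also have "(\<integral>x. indicator U x \<partial>K) = (\<integral>x. indicator (\<Omega> \<inter> U) x \<partial>K)"
      by (rule Bochner_Integration.integral_cong) (auto simp: sp indicator_def)
    also have "\<dots> = measure K (\<Omega> \<inter> U)"
      by (simp add: sp Int_commute Int_left_commute)
    finally show ?thesis .
  qed
  interpret M: prob_space M by fact
  interpret M': prob_space M' by fact
  let ?E = "(\<inter>) \<Omega> ` \<G>"
  have gen: "sets (restrict_space borel \<Omega>) = sigma_sets \<Omega> ?E"
  proof -
    have b: "sets borel = sigma_sets UNIV \<G>" by (simp add: \<G>(4))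
    have "sets (restrict_space borel \<Omega>) = (\<inter>) \<Omega> ` sigma_sets UNIV \<G>"
      by (simp add: sets_restrict_space b)
    also have "\<dots> = sigma_sets \<Omega> ?E"
      using \<Omega> b by (intro sigma_sets_Int) auto
    finally show ?thesis .
  qed
  show ?thesis
  proof (rule measure_eqI_generator_eq[where A = "\<lambda>_. \<Omega>" and \<Omega> = \<Omega> and E = ?E])
    show "Int_stable ?E"
    proof (rule Int_stableI)
      fix a b assume "a \<in> ?E" "b \<in> ?E"
      then obtain U V where "U \<in> \<G>" "V \<in> \<G>" "a = \<Omega> \<inter> U" "b = \<Omega> \<inter> V" by auto
      moreover from this have "U \<inter> V \<in> \<G>" using \<G>(2) by (simp add: Int_stable_def)
      ultimately show "a \<inter> b \<in> ?E" by (intro image_eqI[of _ _ "U \<inter> V"]) auto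
    qed
    show "emeasure M X = emeasure M' X" if "X \<in> ?E" for X
    proof -
      obtain U where U: "U \<in> \<G>" "X = \<Omega> \<inter> U" using \<open>X \<in> ?E\<close> by auto
      have "measure M (\<Omega> \<inter> U) = measure M' (\<Omega> \<inter> U)"
        using lim[OF M \<G>(1)[OF U(1)]] lim[OF M' \<G>(1)[OF U(1)]] eq[OF U(1)]
        by (simp add: LIMSEQ_unique)
      then show ?thesis
        using U by (simp add: M.emeasure_eq_measure M'.emeasure_eq_measure)
    qed
    show "range (\<lambda>_. \<Omega>) \<subseteq> ?E" using \<G>(3) by auto
  qed (use M(2) M'(2) gen in auto)
qed

lemma measure_eqI_continuous:
  fixes M M' :: "'a::metric_space measure"
  assumes \<Omega>: "\<Omega> \<in> sets borel"
    and M: "prob_space M" "sets M = sets (restrict_space borel \<Omega>)"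
    and M': "prob_space M'" "sets M' = sets (restrict_space borel \<Omega>)"
    and eq: "\<And>\<phi>. continuous_on UNIV \<phi> \<Longrightarrow> (\<And>x. \<phi> x \<in> {0..1::real}) \<Longrightarrow>
      (\<integral>x. \<phi> x \<partial>M) = (\<integral>x. \<phi> x \<partial>M')"
  shows "M = M'"
proof (rule measure_eqI_bump[where \<G> = "{U. open U}" and \<Omega> = \<Omega>])
  show "borel = sigma UNIV {U :: 'a set. open U}" by (simp add: borel_def)
qed (auto simp: Int_stable_def \<Omega> M M' bump_nonneg bump_le_1 continuous_on_bump intro!: eq)

text \<open>
  A family of functions whose integrals determine every Borel probability measure on every Borel
  subset \<open>\<Omega>\<close> of the space.
\<close>

definition separates_prob_measures :: "('i \<Rightarrow> 'a::topological_space \<Rightarrow> real) \<Rightarrow> bool" where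
  "separates_prob_measures \<phi> \<longleftrightarrow> (\<forall>\<Omega> M M'. \<Omega> \<in> sets borel \<and>
     prob_space M \<and> sets M = sets (restrict_space borel \<Omega>) \<and>
     prob_space M' \<and> sets M' = sets (restrict_space borel \<Omega>) \<and>
     (\<forall>n. (\<integral>x. \<phi> n x \<partial>M) = (\<integral>x. \<phi> n x \<partial>M')) \<longrightarrow> M = M')"

text \<open>
  The bump functions of a countable basis that is closed under finite intersections.
\<close>

lemma exists_countable_separating_family:
  obtains \<phi> :: "nat \<Rightarrow> 'a::{metric_space,second_countable_topology} \<Rightarrow> real"
  where "\<And>n. continuous_on UNIV (\<phi> n)" "\<And>n x. \<phi> n x \<in> {0..1}" "separates_prob_measures \<phi>"
proof -
  obtain B :: "'a set set" where B: "countable B" "topological_basis B"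
    using ex_countable_basis by blast
  define \<G> where "\<G> = {\<Inter>A |A. finite A \<and> A \<subseteq> B}"
  have "\<G> = Inter ` {A. finite A \<and> A \<subseteq> B}" by (auto simp: \<G>_def)
  then have "countable \<G>"
    using countable_Collect_finite_subset[OF B(1)] by simp
  have \<G>_open: "open U" if "U \<in> \<G>" for U
    using that topological_basis_open[OF B(2)] by (auto simp: \<G>_def intro!: open_Inter)
  have "UNIV \<in> \<G>" unfolding \<G>_def by (rule CollectI, rule exI[of _ "{}"]) auto
  have stable: "Int_stable \<G>"
  proof (rule Int_stableI)
    fix a b assume "a \<in> \<G>" "b \<in> \<G>"
    then obtain C D where "finite C" "C \<subseteq> B" "a = \<Inter>C" "finite D" "D \<subseteq> B" "b = \<Inter>D"
      by (auto simp: \<G>_def)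
    then show "a \<inter> b \<in> \<G>"
      unfolding \<G>_def by (intro CollectI exI[of _ "C \<union> D"]) auto
  qed
  have "B \<subseteq> \<G>"
  proof
    fix U assume "U \<in> B"
    then show "U \<in> \<G>" unfolding \<G>_def by (intro CollectI exI[of _ "{U}"]) auto
  qed
  then have "topological_basis \<G>"
    using B(2) \<G>_open unfolding topological_basis_def by (meson subset_trans)
  then have borel: "borel = sigma UNIV \<G>"
    using \<open>countable \<G>\<close> by (intro borel_eq_countable_basis)
  have "\<G> \<noteq> {}" using \<open>UNIV \<in> \<G>\<close> by auto
  define \<phi> where "\<phi> n = (case prod_decode n of (i, N) \<Rightarrow> bump (from_nat_into \<G> i) N)" for n
  show ?thesis
  proof (rule that[of \<phi>])
    show "continuous_on UNIV (\<phi> n)" for n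
      by (simp add: \<phi>_def continuous_on_bump split: prod.split)
    show "\<phi> n x \<in> {0..1}" for n x
      by (simp add: \<phi>_def bump_nonneg bump_le_1 split: prod.split)
    have "M = M'" if \<Omega>: "\<Omega> \<in> sets borel"
      and M: "prob_space M" "sets M = sets (restrict_space borel \<Omega>)"
      and M': "prob_space M'" "sets M' = sets (restrict_space borel \<Omega>)"
      and eq: "\<forall>n. (\<integral>x. \<phi> n x \<partial>M) = (\<integral>x. \<phi> n x \<partial>M')"
      for \<Omega> M M'
    proof -
      have "(\<integral>x. bump U N x \<partial>M) = (\<integral>x. bump U N x \<partial>M')" if U: "U \<in> \<G>" for U N
    proof -
      obtain i where "from_nat_into \<G> i = U"
        using from_nat_into_surj[OF \<open>countable \<G>\<close> U] by blast
      then show ?thesis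
        using eq[rule_format, of "prod_encode (i, N)"] by (simp add: \<phi>_def)
    qed
      then show "M = M'"
        using measure_eqI_bump[OF \<G>_open stable \<open>UNIV \<in> \<G>\<close> borel \<Omega> M M'] by blast
    qed
    then show "separates_prob_measures \<phi>"
      unfolding separates_prob_measures_def by blast
  qed
qed

text \<open>
  Sequential compactness of the probability measures on a space \<open>\<Omega>\<close> that is the continuous image
  of a compact set \<open>K\<close> of reals under a map \<open>p\<close> with a Borel section \<open>s\<close>. The measures are transported
  to \<open>K\<close> by \<open>s\<close>, where Helly selection gives a weakly convergent subsequence, and the limit is
  pushed forward by \<open>p\<close>. A continuous function on \<open>\<Omega>\<close>, pulled back to \<open>K\<close>, extends to \<open>\<real>\<close> by Tietze.
\<close>

lemma prob_measures_seq_compact: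
  fixes \<Omega> :: "'a::metric_space set" and K :: "real set"
    and p :: "real \<Rightarrow> 'a" and s :: "'a \<Rightarrow> real" and \<mu> :: "nat \<Rightarrow> 'a measure"
  assumes K: "compact K" and p: "continuous_on K p" "p ` K \<subseteq> \<Omega>"
    and s: "s \<in> borel_measurable (restrict_space borel \<Omega>)"
      "\<And>x. x \<in> \<Omega> \<Longrightarrow> s x \<in> K" "\<And>x. x \<in> \<Omega> \<Longrightarrow> p (s x) = x"
    and \<mu>: "\<And>n. prob_space (\<mu> n)" "\<And>n. sets (\<mu> n) = sets (restrict_space borel \<Omega>)"
  obtains r M where "strict_mono (r :: nat \<Rightarrow> nat)" "prob_space M"
    "sets M = sets (restrict_space borel \<Omega>)"
    "\<And>\<phi>. continuous_on \<Omega> \<phi> \<Longrightarrow>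
       (\<lambda>n. \<integral>x. \<phi> x \<partial>\<mu> (r n)) \<longlonglongrightarrow> (\<integral>x. (\<phi> x :: real) \<partial>M)"
proof -
  have sp: "space (\<mu> n) = \<Omega>" for n using \<mu>(2) by (rule space_of_sets_restrict_borel)
  have s\<mu> [measurable]: "s \<in> borel_measurable (\<mu> n)" for n
    using s(1) \<mu>(2) measurable_cong_sets by blast
  define N where "N n = distr (\<mu> n) borel s" for n
  have N: "real_distribution (N n)" for n
    unfolding real_distribution_def real_distribution_axioms_def N_def
    using prob_space.prob_space_distr[OF \<mu>(1) s\<mu>] by simp
  obtain b where b: "\<And>x. x \<in> K \<Longrightarrow> \<bar>x\<bar> \<le> b" "b > 0"
    using compact_imp_bounded[OF K] unfolding bounded_pos by auto
  have "tight N"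
    unfolding tight_def
  proof (intro conjI allI impI)
    show "real_distribution (N n)" for n by (rule N)
    fix \<epsilon> :: real assume "0 < \<epsilon>"
    have "measure (N n) {-b-1<..b} = 1" for n
    proof -
      interpret prob_space "\<mu> n" by (rule \<mu>(1))
      have "s -` {-b-1<..b} \<inter> space (\<mu> n) = space (\<mu> n)"
        using s(2) b(1) by (fastforce simp: sp)
      then show ?thesis
        unfolding N_def by (subst measure_distr) (auto simp: prob_space)
    qed
    then show "\<exists>a c. a < c \<and> (\<forall>n. measure (N n) {a<..c} > 1 - \<epsilon>)"
      using b(2) \<open>0 < \<epsilon>\<close> by (intro exI[of _ "-b-1"] exI[of _ b]) auto
  qed
  then obtain r L where r: "strict_mono (r :: nat \<Rightarrow> nat)" and L: "real_distribution L"
    and conv: "weak_conv_m (N \<circ> id \<circ> r) L"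
    using tight_imp_convergent_subsubsequence[OF _ strict_mono_id] by blast
  interpret L: real_distribution L by fact
  have lim: "(\<lambda>n. \<integral>x. g (s x) \<partial>\<mu> (r n)) \<longlonglongrightarrow> (\<integral>x. g x \<partial>L)"
    if g: "continuous_on UNIV g" "\<And>x. norm (g x) \<le> C" for g :: "real \<Rightarrow> real" and C
  proof -
    have [measurable]: "g \<in> borel_measurable borel"
      using g(1) by (rule borel_measurable_continuous_onI)
    have "(\<lambda>n. integral\<^sup>L ((N \<circ> id \<circ> r) n) g) \<longlonglongrightarrow> integral\<^sup>L L g"
    proof (rule weak_conv_imp_integral_bdd_continuous_conv[where B = C])
      show "\<And>n. real_distribution ((N \<circ> id \<circ> r) n)" using N by simp
      show "\<And>x. isCont g x" using g(1) by (simp add: continuous_on_eq_continuous_at)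
    qed (use L conv g in \<open>auto simp: comp_def\<close>)
    then show ?thesis
      by (simp add: N_def integral_distr)
  qed
  have "K \<noteq> {}"
  proof
    assume "K = {}"
    then have "space (\<mu> 0) = {}" using s(2) by (auto simp: sp)
    then show False using prob_space.not_empty[OF \<mu>(1)] by blast
  qed
  \<comment> \<open>The weak limit is carried by the closed set K, being tested against the distance to K.\<close>
  have "(\<integral>x. min 1 (infdist x K) \<partial>L) = 0"
  proof (rule LIMSEQ_unique)
    show "(\<lambda>n. \<integral>x. min 1 (infdist (s x) K) \<partial>\<mu> (r n)) \<longlonglongrightarrow> (\<integral>x. min 1 (infdist x K) \<partial>L)"
    proof (rule lim[of "\<lambda>x. min 1 (infdist x K)" 1])
      show "continuous_on UNIV (\<lambda>x. min 1 (infdist x K))"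
        by (intro continuous_intros)
      show "norm (min 1 (infdist x K)) \<le> 1" for x
        using infdist_nonneg[of x K] by simp
    qed
    have "(\<integral>x. min 1 (infdist (s x) K) \<partial>\<mu> (r n)) = (\<integral>x. 0 \<partial>\<mu> (r n))" for n
      by (rule Bochner_Integration.integral_cong) (auto simp: sp s(2))
    then show "(\<lambda>n. \<integral>x. min 1 (infdist (s x) K) \<partial>\<mu> (r n)) \<longlonglongrightarrow> 0" by simp
  qed
  moreover have [measurable]: "(\<lambda>x. infdist x K) \<in> borel_measurable borel"
    by (intro borel_measurable_continuous_onI continuous_intros)
  moreover have "integrable L (\<lambda>x. min 1 (infdist x K))"
    by (rule L.integrable_const_bound[where B = 1]) (auto simp: infdist_nonneg)
  ultimately have "AE x in L. min 1 (infdist x K) = 0"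
    by (subst (asm) integral_nonneg_eq_0_iff_AE) (auto simp: infdist_nonneg)
  then have AEK: "AE x in L. x \<in> K"
  proof eventually_elim
    case (elim x)
    then show ?case
      using in_closed_iff_infdist_zero[OF compact_imp_closed[OF K] \<open>K \<noteq> {}\<close>, of x]
      by (auto simp: min_def split: if_splits)
  qed
  have Kb: "K \<in> sets L" using compact_imp_closed[OF K] by simp
  have "emeasure L K = 1"
    using AEK Kb by (simp add: L.emeasure_eq_1_AE)
  then have R: "prob_space (restrict_space L K)"
    using Kb by (intro prob_space_restrict_space)
  define M where "M = distr (restrict_space L K) (restrict_space borel \<Omega>) p"
  have RK: "sets (restrict_space L K) = sets (restrict_space borel K)"
    by (rule sets_restrict_space_cong) simp
  have pm: "p \<in> restrict_space L K \<rightarrow>\<^sub>M restrict_space borel \<Omega>"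
  proof (rule measurable_restrict_space2)
    show "p \<in> space (restrict_space L K) \<rightarrow> \<Omega>"
      using p(2) by (auto simp: space_restrict_space)
    show "p \<in> borel_measurable (restrict_space L K)"
      using RK p(1) by (rule borel_measurable_restrictI)
  qed
  show ?thesis
  proof (rule that[OF r])
    show "prob_space M"
      unfolding M_def by (rule prob_space.prob_space_distr[OF R pm])
    show "sets M = sets (restrict_space borel \<Omega>)" by (simp add: M_def)
    fix \<phi> :: "'a \<Rightarrow> real"
    assume \<phi>: "continuous_on \<Omega> \<phi>"
    have cont: "continuous_on K (\<phi> \<circ> p)"
      using p \<phi> by (metis continuous_on_compose continuous_on_subset)
    have "bounded ((\<phi> \<circ> p) ` K)"
      using compact_continuous_image[OF cont K] by (rule compact_imp_bounded)
    then obtain B where B: "B > 0" "\<And>x. x \<in> K \<Longrightarrow> norm ((\<phi> \<circ> p) x) \<le> B"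
      unfolding bounded_pos by auto
    obtain g where g: "continuous_on UNIV g" "\<And>x. x \<in> K \<Longrightarrow> g x = (\<phi> \<circ> p) x"
      "\<And>x. x \<in> UNIV \<Longrightarrow> norm (g x) \<le> B"
    proof (rule Tietze[OF cont])
      show "closedin (top_of_set UNIV) K"
        using compact_imp_closed[OF K] by simp
      show "0 \<le> B" using B(1) by simp
      show "norm ((\<phi> \<circ> p) x) \<le> B" if "x \<in> K" for x
        using that by (rule B(2))
    qed blast
    have "(\<integral>x. \<phi> x \<partial>M) = (\<integral>y. \<phi> (p y) \<partial>restrict_space L K)"
      unfolding M_def using pm borel_measurable_continuous_on_restrict[OF \<phi>]
      by (rule integral_distr)
    also have "\<dots> = (\<integral>y. indicator K y *\<^sub>R \<phi> (p y) \<partial>L)"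
      using Kb by (intro integral_restrict_space) auto
    also have "\<dots> = (\<integral>y. indicator K y *\<^sub>R g y \<partial>L)"
      by (rule Bochner_Integration.integral_cong) (auto simp: indicator_def g(2))
    also have "\<dots> = (\<integral>y. g y \<partial>L)"
    proof (rule integral_cong_AE)
      have [measurable]: "g \<in> borel_measurable borel"
        using g(1) by (rule borel_measurable_continuous_onI)
      show "g \<in> borel_measurable L" by simp
      show "(\<lambda>y. indicator K y *\<^sub>R g y) \<in> borel_measurable L" using Kb by simp
      show "AE y in L. indicator K y *\<^sub>R g y = g y"
        using AEK by eventually_elim simp
    qed
    finally have M: "(\<integral>x. \<phi> x \<partial>M) = (\<integral>y. g y \<partial>L)" .
    have "(\<integral>x. g (s x) \<partial>\<mu> (r n)) = (\<integral>x. \<phi> x \<partial>\<mu> (r n))" for n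
      by (rule Bochner_Integration.integral_cong) (auto simp: sp s g(2))
    then show "(\<lambda>n. \<integral>x. \<phi> x \<partial>\<mu> (r n)) \<longlonglongrightarrow> (\<integral>x. \<phi> x \<partial>M)"
      using lim[OF g(1), of B] g(3) by (simp add: M)
  qed
qed

text \<open>
  The discrete topology of the naturals comes from the metric of the real line. With it the
  sequence space \<open>int \<Rightarrow> nat\<close> is a metric space.
\<close>

instantiation nat :: metric_space
begin

definition dist_nat :: "nat \<Rightarrow> nat \<Rightarrow> real" where
  "dist_nat m n = \<bar>real m - real n\<bar>"

definition uniformity_nat :: "(nat \<times> nat) filter" where
  "uniformity_nat = (INF e\<in>{0 <..}. principal {(x, y). dist x y < e})"

instance
proof
  show "uniformity = (INF e\<in>{0 <..}. principal {(x, y :: nat). dist x y < e})"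
    by (rule uniformity_nat_def)
next
  fix U :: "nat set"
  have "\<forall>\<^sub>F (x', y) in uniformity. x' = x \<longrightarrow> y \<in> U" if "x \<in> U" for x :: nat
    unfolding uniformity_nat_def
  proof (subst eventually_INF_base)
    show "\<exists>e\<in>{0<..}. \<forall>\<^sub>F (x', y) in principal {(x, y). dist x y < e}. x' = x \<longrightarrow> y \<in> U"
    proof (intro bexI[of _ 1])
      have "y = x" if "\<bar>real x - real y\<bar> < 1" for y
        using that by linarith
      then show "\<forall>\<^sub>F (x', y) in principal {(x, y). dist x y < 1}. x' = x \<longrightarrow> y \<in> U"
        using that by (auto simp: eventually_principal dist_nat_def)
    qed simp
  qed (auto simp: subset_eq intro: bexI[of _ "min _ _"])
  then show "open U \<longleftrightarrow> (\<forall>x\<in>U. \<forall>\<^sub>F (x', y) in uniformity. x' = x \<longrightarrow> y \<in> U)"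
    using discrete_topology_class.open_discrete[of U] by blast
qed (auto simp: dist_nat_def)

end

section \<open>Coding the skew product space by a Cantor set\<close>

text \<open>
  Sequences of digits less than \<open>k\<close>.
\<close>

definition digit_space :: "nat \<Rightarrow> (nat \<Rightarrow> nat) set" where
  "digit_space k = {y. \<forall>n. y n < k}"

text \<open>
  The real number with the digits \<open>y\<close> after the point in base \<open>b\<close>. For digits less than \<open>k\<close>, base
  \<open>k + 1\<close> makes this an embedding with image a Cantor set, whereas base \<open>k\<close> yields all of \<open>[0,1]\<close>.
\<close>

definition digit_sum :: "nat \<Rightarrow> (nat \<Rightarrow> nat) \<Rightarrow> real" where
  "digit_sum b y = (\<Sum>n. real (y n) / real b ^ Suc n)"

lemma summable_geometric_weight:
  assumes "b \<ge> 2"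
  shows "summable (\<lambda>n. c / real b ^ Suc n)"
proof -
  have "summable (\<lambda>n. (c / real b) * (1 / real b) ^ n)"
    using assms by (intro summable_mult summable_geometric) simp
  then show ?thesis by (simp add: power_one_over field_simps)
qed

lemma digit_bound:
  assumes "y \<in> digit_space k"
  shows "\<bar>real (y n) / real b ^ Suc n\<bar> \<le> (real k - 1) / real b ^ Suc n"
proof -
  have "y n < k" using assms by (simp add: digit_space_def)
  then have "real (y n) \<le> real k - 1" by linarith
  then show ?thesis by (simp add: divide_right_mono)
qed

lemma digit_sum_summable:
  assumes "y \<in> digit_space k" "b \<ge> 2"
  shows "summable (\<lambda>n. real (y n) / real b ^ Suc n)"
  by (rule summable_comparison_test'[OF summable_geometric_weight[OF assms(2), of "real k - 1"],
        where N = 0])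
    (simp only: real_norm_def digit_bound[OF assms(1)])

lemma continuous_on_digit_sum:
  assumes "b \<ge> 2"
  shows "continuous_on (digit_space k) (digit_sum b)"
proof -
  have "uniform_limit (digit_space k) (\<lambda>n y. \<Sum>i<n. real (y i) / real b ^ Suc i)
      (\<lambda>y. \<Sum>i. real (y i) / real b ^ Suc i) sequentially"
  proof (rule Weierstrass_m_test)
    show "norm (real (y n) / real b ^ Suc n) \<le> (real k - 1) / real b ^ Suc n"
      if "y \<in> digit_space k" for n y
      using digit_bound[OF that] by simp
    show "summable (\<lambda>n. (real k - 1) / real b ^ Suc n)"
      using assms by (rule summable_geometric_weight)
  qed
  moreover have "continuous_on (digit_space k) (\<lambda>y. real (y i))" for i
  proof (rule continuous_on_compose2[of UNIV real])
    show "continuous_on (digit_space k) (\<lambda>y. y i)"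
      by (rule continuous_on_subset[OF continuous_on_product_coordinates]) simp
  qed auto
  then have "\<forall>\<^sub>F n in sequentially. continuous_on (digit_space k) (\<lambda>y. \<Sum>i<n. real (y i) / real b ^ Suc i)"
    using assms by (intro always_eventually allI continuous_on_sum continuous_on_divide) auto
  ultimately show ?thesis
    unfolding digit_sum_def by (intro uniform_limit_theorem) auto
qed

lemma digit_sum_head:
  assumes "y \<in> digit_space k" "b \<ge> 2"
  shows "real b * digit_sum b y = real (y 0) + digit_sum b (\<lambda>n. y (Suc n))"
proof -
  have s: "summable (\<lambda>n. real (y (Suc n)) / real b ^ Suc n)"
    using assms by (intro digit_sum_summable[of _ k]) (auto simp: digit_space_def)
  have "digit_sum b y = (\<Sum>n. real (y (Suc n)) / real b ^ Suc (Suc n)) + real (y 0) / real b"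
    using suminf_split_head[OF digit_sum_summable[OF assms]] by (simp add: digit_sum_def)
  also have "(\<Sum>n. real (y (Suc n)) / real b ^ Suc (Suc n))
      = (\<Sum>n. real (y (Suc n)) / real b ^ Suc n / real b)"
    by (rule arg_cong[where f = suminf]) (auto simp: field_simps)
  also have "\<dots> = digit_sum b (\<lambda>n. y (Suc n)) / real b"
    unfolding digit_sum_def using s by (rule suminf_divide)
  finally show ?thesis
    using assms(2) by (simp add: field_simps)
qed

text \<open>
  The strict upper bound is what makes the leading digit recoverable as an integer part.
\<close>

lemma digit_sum_bounds:
  assumes "y \<in> digit_space k" "k \<ge> 1"
  shows "0 \<le> digit_sum (Suc k) y" "digit_sum (Suc k) y < 1"
proof -
  have b: "Suc k \<ge> 2" using assms(2) by simp
  show "0 \<le> digit_sum (Suc k) y"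
    unfolding digit_sum_def using digit_sum_summable[OF assms(1) b]
    by (intro suminf_nonneg) auto
  have "(\<lambda>n. 1 / real (Suc k) * (1 / real (Suc k)) ^ n) sums
      (1 / real (Suc k) * (1 / (1 - 1 / real (Suc k))))"
    using assms(2) by (intro sums_mult geometric_sums) simp
  then have "(\<lambda>n. (real k - 1) * (1 / real (Suc k) * (1 / real (Suc k)) ^ n)) sums
      ((real k - 1) * (1 / real (Suc k) * (1 / (1 - 1 / real (Suc k)))))"
    by (rule sums_mult)
  then have g: "(\<lambda>n. (real k - 1) / real (Suc k) ^ Suc n) sums ((real k - 1) / real k)"
    using assms(2) by (simp add: field_simps power_one_over)
  have "digit_sum (Suc k) y \<le> (real k - 1) / real k"
    unfolding digit_sum_def
  proof (rule sums_le)
    show "(\<lambda>n. real (y n) / real (Suc k) ^ Suc n) sums (\<Sum>n. real (y n) / real (Suc k) ^ Suc n)"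
      using digit_sum_summable[OF assms(1) b] by (rule summable_sums)
    show "(\<lambda>n. (real k - 1) / real (Suc k) ^ Suc n) sums ((real k - 1) / real k)" by (rule g)
    show "real (y n) / real (Suc k) ^ Suc n \<le> (real k - 1) / real (Suc k) ^ Suc n" for n
      using digit_bound[OF assms(1), of n "Suc k"] by linarith
  qed
  also have "\<dots> < 1" using assms(2) by simp
  finally show "digit_sum (Suc k) y < 1" .
qed

lemma digit_sum_cancel_head:
  assumes y: "y \<in> digit_space k" and z: "z \<in> digit_space k" and k: "k \<ge> 1"
    and eq: "digit_sum (Suc k) y = digit_sum (Suc k) z"
  shows "y 0 = z 0" "digit_sum (Suc k) (\<lambda>n. y (Suc n)) = digit_sum (Suc k) (\<lambda>n. z (Suc n))"
proof -
  have b: "Suc k \<ge> 2" using k by simp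
  have S: "(\<lambda>n. y (Suc n)) \<in> digit_space k" "(\<lambda>n. z (Suc n)) \<in> digit_space k"
    using y z by (auto simp: digit_space_def)
  have *: "real (y 0) + digit_sum (Suc k) (\<lambda>n. y (Suc n)) =
      real (z 0) + digit_sum (Suc k) (\<lambda>n. z (Suc n))"
    using digit_sum_head[OF y b] digit_sum_head[OF z b] eq by simp
  then have "\<bar>real (y 0) - real (z 0)\<bar> < 1"
    using digit_sum_bounds[OF S(1) k] digit_sum_bounds[OF S(2) k] by linarith
  then show "y 0 = z 0" by linarith
  with * show "digit_sum (Suc k) (\<lambda>n. y (Suc n)) = digit_sum (Suc k) (\<lambda>n. z (Suc n))" by simp
qed

lemma inj_on_digit_sum:
  assumes "k \<ge> 1"
  shows "inj_on (digit_sum (Suc k)) (digit_space k)"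
proof (rule inj_onI)
  fix y z assume yz: "y \<in> digit_space k" "z \<in> digit_space k" "digit_sum (Suc k) y = digit_sum (Suc k) z"
  have "y n = z n" for n
    using yz
  proof (induction n arbitrary: y z)
    case 0
    then show ?case using digit_sum_cancel_head(1) assms by blast
  next
    case (Suc n)
    have "(\<lambda>n. y (Suc n)) \<in> digit_space k" "(\<lambda>n. z (Suc n)) \<in> digit_space k"
      using Suc.prems by (auto simp: digit_space_def)
    then show ?case
      using Suc.IH digit_sum_cancel_head(2)[OF Suc.prems(1,2) assms Suc.prems(3)] by blast
  qed
  then show "y = z" by (rule ext)
qed

text \<open>
  The \<open>n\<close>-th digit after the point of \<open>t\<close> in base \<open>k\<close>, counted from \<open>n = 0\<close>.
\<close>

definition nth_digit :: "nat \<Rightarrow> real \<Rightarrow> nat \<Rightarrow> nat" where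
  "nth_digit k t n = nat (\<lfloor>real k ^ Suc n * t\<rfloor> - int k * \<lfloor>real k ^ n * t\<rfloor>)"

lemma
  assumes "k \<ge> 1"
  shows nth_digit_less: "nth_digit k t n < k"
    and real_nth_digit: "real (nth_digit k t n) =
      of_int \<lfloor>real k ^ Suc n * t\<rfloor> - real k * of_int \<lfloor>real k ^ n * t\<rfloor>"
proof -
  let ?u = "real k ^ n * t"
  have 1: "real k * of_int \<lfloor>?u\<rfloor> \<le> real k * ?u"
    by (intro mult_left_mono) auto
  have 2: "real k * ?u < real k * (of_int \<lfloor>?u\<rfloor> + 1)"
    using assms by (intro mult_strict_left_mono) (auto simp: less_floor_iff)
  have e: "real k ^ Suc n * t = real k * ?u" by simp
  have "of_int (int k * \<lfloor>?u\<rfloor>) \<le> real k * ?u" using 1 by simp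
  then have "int k * \<lfloor>?u\<rfloor> \<le> \<lfloor>real k * ?u\<rfloor>" by (simp only: le_floor_iff)
  moreover have "real k * ?u < of_int (int k * \<lfloor>?u\<rfloor> + int k)"
    using 2 by (simp add: algebra_simps)
  then have "\<lfloor>real k * ?u\<rfloor> < int k * \<lfloor>?u\<rfloor> + int k" by (simp only: floor_less_iff)
  ultimately show "nth_digit k t n < k"
    "real (nth_digit k t n) = of_int \<lfloor>real k ^ Suc n * t\<rfloor> - real k * of_int \<lfloor>real k ^ n * t\<rfloor>"
    using assms unfolding nth_digit_def e by (auto simp: nat_less_iff)
qed

lemma digit_sum_nth_digit:
  assumes "k \<ge> 2" "0 \<le> t" "t < 1"
  shows "digit_sum k (nth_digit k t) = t"
proof -
  define f where "f n = of_int \<lfloor>real k ^ n * t\<rfloor> / real k ^ n" for n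
  have "(\<lambda>n. t - f n) \<longlonglongrightarrow> 0"
  proof (rule tendsto_sandwich[where f = "\<lambda>_. 0"])
    have kp: "real k ^ n > 0" for n using assms by simp
    show "\<forall>\<^sub>F n in sequentially. 0 \<le> t - f n"
    proof (intro always_eventually allI)
      fix n
      have "of_int \<lfloor>real k ^ n * t\<rfloor> \<le> real k ^ n * t" by simp
      then show "0 \<le> t - f n" using kp[of n] by (simp add: f_def field_simps)
    qed
    show "\<forall>\<^sub>F n in sequentially. t - f n \<le> (1 / real k) ^ n"
    proof (intro always_eventually allI)
      fix n
      have "real k ^ n * t \<le> of_int \<lfloor>real k ^ n * t\<rfloor> + 1" by linarith
      then have "(real k ^ n * t - of_int \<lfloor>real k ^ n * t\<rfloor>) / real k ^ n \<le> 1 / real k ^ n"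
        using kp[of n] by (intro divide_right_mono) linarith+
      moreover have "t - f n = (real k ^ n * t - of_int \<lfloor>real k ^ n * t\<rfloor>) / real k ^ n"
        using kp[of n] by (simp add: f_def diff_divide_distrib)
      ultimately show "t - f n \<le> (1 / real k) ^ n"
        by (simp add: power_one_over)
    qed
    show "(\<lambda>n. (1 / real k) ^ n) \<longlonglongrightarrow> 0"
      using assms by (intro LIMSEQ_power_zero) simp
  qed simp
  then have "(\<lambda>n. t - (t - f n)) \<longlonglongrightarrow> t - 0"
    by (intro tendsto_intros)
  then have "f \<longlonglongrightarrow> t" by simp
  then have "(\<lambda>n. f (Suc n) - f n) sums (t - f 0)"
    by (rule telescope_sums)
  moreover have "f 0 = 0"
  proof -
    have "\<lfloor>t\<rfloor> = 0" using assms by (simp add: floor_eq_iff)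
    then show ?thesis by (simp add: f_def)
  qed
  moreover have "f (Suc n) - f n = real (nth_digit k t n) / real k ^ Suc n" for n
    using assms by (simp add: real_nth_digit f_def field_simps)
  ultimately show ?thesis
    unfolding digit_sum_def by (simp add: sums_iff)
qed

lemma compact_bounded_sequences:
  "compact {y :: 'i \<Rightarrow> nat. \<forall>i. y i < k}"
proof -
  have "compactin (product_topology (\<lambda>_::'i. euclidean :: nat topology) UNIV) (PiE UNIV (\<lambda>_. {..<k}))"
    by (simp add: compactin_PiE finite_imp_compact)
  then have "compact (PiE UNIV (\<lambda>_::'i. {..<k}))"
    by (simp add: euclidean_product_topology)
  moreover have "PiE UNIV (\<lambda>_::'i. {..<k}) = {y. \<forall>i. y i < k}"
    by auto
  ultimately show ?thesis by simp
qed

lemma compact_skew_space: "compact (skew_space k)"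
  unfolding skew_space_def shift_space_def
  by (intro compact_Times compact_bounded_sequences compact_circle)

lemma closed_skew_space: "closed (skew_space k)"
  by (rule compact_imp_closed[OF compact_skew_space])

lemma skew_space_borel [simp]: "skew_space k \<in> sets borel"
  by (rule borel_closed[OF closed_skew_space])

text \<open>
  Points of \<open>\<Sigma>\<^sub>k \<times> \<real>/\<int>\<close> are coded by sequences of digits less than \<open>k\<close>: the even places list the symbols
  of the base point, the odd places the base \<open>k\<close> expansion of the fiber coordinate.
\<close>

lemma skew_measures_seq_compact:
  fixes \<mu> :: "nat \<Rightarrow> ((int \<Rightarrow> nat) \<times> circle) measure"
  assumes k: "k \<ge> 2"
    and \<mu>: "\<And>n. prob_space (\<mu> n)" "\<And>n. sets (\<mu> n) = sets (restrict_space borel (skew_space k))"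
  obtains r M where "strict_mono (r :: nat \<Rightarrow> nat)" "prob_space M"
    "sets M = sets (restrict_space borel (skew_space k))"
    "\<And>\<phi>. continuous_on (skew_space k) \<phi> \<Longrightarrow>
       (\<lambda>n. \<integral>x. \<phi> x \<partial>\<mu> (r n)) \<longlonglongrightarrow> (\<integral>x. (\<phi> x :: real) \<partial>M)"
proof -
  let ?Y = "digit_space k"
  define e where "e = digit_sum (Suc k)"
  define d where "d = inv_into ?Y e"
  define K where "K = e ` ?Y"
  have inj: "inj_on e ?Y" unfolding e_def using k by (intro inj_on_digit_sum) simp
  have cont_e: "continuous_on ?Y e" unfolding e_def using k by (intro continuous_on_digit_sum) simp
  have cY: "compact ?Y" unfolding digit_space_def by (rule compact_bounded_sequences)
  have K: "compact K" unfolding K_def using cont_e cY by (rule compact_continuous_image)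
  have de: "d (e y) = y" if "y \<in> ?Y" for y
    unfolding d_def using inj that by (rule inv_into_f_f)
  have cont_d: "continuous_on K d"
    unfolding K_def using cont_e cY de by (intro continuous_on_inv) auto
  have dY: "d r \<in> ?Y" if "r \<in> K" for r
    using that de by (auto simp: K_def)
  have cont_dn: "continuous_on K (\<lambda>r. d r n)" for n
    using cont_d by (rule continuous_on_product_then_coordinatewise)
  define p where "p r = (\<lambda>i. d r (2 * int_encode i), circle_of (digit_sum k (\<lambda>n. d r (2 * n + 1))))" for r
  have cont_p: "continuous_on K p"
    unfolding p_def
  proof (intro continuous_on_Pair)
    show "continuous_on K (\<lambda>r i. d r (2 * int_encode i))"
      by (rule continuous_on_coordinatewise_then_product) (rule cont_dn)
    have "continuous_on K (\<lambda>r. digit_sum k (\<lambda>n. d r (2 * n + 1)))"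
    proof (rule continuous_on_compose2[OF continuous_on_digit_sum[OF k, of k]])
      show "continuous_on K (\<lambda>r n. d r (2 * n + 1))"
        by (rule continuous_on_coordinatewise_then_product) (rule cont_dn)
      show "(\<lambda>r n. d r (2 * n + 1)) ` K \<subseteq> digit_space k"
      proof (rule image_subsetI)
        fix r assume "r \<in> K"
        then have "\<forall>n. d r n < k" using dY by (simp add: digit_space_def)
        then show "(\<lambda>n. d r (2 * n + 1)) \<in> digit_space k" by (simp add: digit_space_def)
      qed
    qed
    then show "continuous_on K (\<lambda>r. circle_of (digit_sum k (\<lambda>n. d r (2 * n + 1))))"
      by (rule continuous_on_compose2[OF continuous_on_circle_of[of UNIV]]) simp
  qed
  have pK: "p ` K \<subseteq> skew_space k"
  proof (rule image_subsetI)
    fix r assume "r \<in> K"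
    then have "\<forall>n. d r n < k" using dY by (simp add: digit_space_def)
    then show "p r \<in> skew_space k" by (simp add: p_def skew_space_def shift_space_def)
  qed
  define y where "y \<omega> n = (if even n then fst \<omega> (int_decode (n div 2))
      else nth_digit k (circle_coord (snd \<omega>)) (n div 2))" for \<omega> :: "(int \<Rightarrow> nat) \<times> circle" and n
  define s where "s \<omega> = e (y \<omega>)" for \<omega>
  have yY: "y \<omega> \<in> ?Y" if "\<omega> \<in> skew_space k" for \<omega>
    using that k by (auto simp: y_def digit_space_def skew_space_def shift_space_def nth_digit_less)
  show ?thesis
  proof (rule prob_measures_seq_compact[where \<mu> = \<mu> and s = s, OF K cont_p pK])
    have [measurable]: "(\<lambda>\<omega>. y \<omega> n) \<in> borel_measurable borel" for n
    proof (cases "even n")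
      case True
      have "(\<lambda>\<omega> :: (int \<Rightarrow> nat) \<times> circle. fst \<omega> (int_decode (n div 2))) \<in> borel_measurable (borel \<Otimes>\<^sub>M borel)"
        by (rule measurable_compose[OF measurable_fst measurable_product_coordinates])
      then show ?thesis
        using True by (simp add: y_def borel_prod)
    next
      case False
      have [measurable]: "circle_coord \<in> borel_measurable borel" by (rule borel_measurable_circle_coord)
      have 1: "(\<lambda>t. nth_digit k t (n div 2)) \<in> borel_measurable borel"
        unfolding nth_digit_def by measurable
      have "(\<lambda>\<omega> :: (int \<Rightarrow> nat) \<times> circle. nth_digit k (circle_coord (snd \<omega>)) (n div 2)) \<in> borel_measurable (borel \<Otimes>\<^sub>M borel)"
        by (rule measurable_compose[OF measurable_snd measurable_compose[OF borel_measurable_circle_coord 1]])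
      then show ?thesis
        using False by (simp add: y_def borel_prod)
    qed
    have "real \<in> borel_measurable borel"
      by (intro borel_measurable_continuous_onI) auto
    then have "(\<lambda>\<omega>. real (y \<omega> n)) \<in> borel_measurable borel" for n
      by (rule measurable_compose[rotated]) measurable
    then have "s \<in> borel_measurable borel"
      unfolding s_def e_def digit_sum_def
      by (intro borel_measurable_suminf borel_measurable_divide) auto
    then show "s \<in> borel_measurable (restrict_space borel (skew_space k))"
      by (rule measurable_restrict_space1)
    show "s \<omega> \<in> K" if "\<omega> \<in> skew_space k" for \<omega>
      using yY[OF that] by (simp add: s_def K_def)
    show "p (s \<omega>) = \<omega>" if "\<omega> \<in> skew_space k" for \<omega>
    proof -
      have d: "d (s \<omega>) = y \<omega>" using yY[OF that] de by (simp add: s_def)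
      have y0: "y \<omega> (2 * n) = fst \<omega> (int_decode n)" for n
        by (simp add: y_def)
      have y1: "y \<omega> (2 * n + 1) = nth_digit k (circle_coord (snd \<omega>)) n" for n
        by (simp add: y_def)
      have "(\<lambda>n. y \<omega> (2 * n + 1)) = nth_digit k (circle_coord (snd \<omega>))"
        by (rule ext) (rule y1)
      moreover have "digit_sum k (nth_digit k (circle_coord (snd \<omega>))) = circle_coord (snd \<omega>)"
        using k by (intro digit_sum_nth_digit) simp_all
      moreover have "(\<lambda>i. y \<omega> (2 * int_encode i)) = fst \<omega>"
        by (rule ext) (simp only: y0 int_encode_inverse)
      ultimately show ?thesis
        unfolding p_def d by (simp only: circle_of_coord prod.collapse)
    qed
    show "prob_space (\<mu> n)" "sets (\<mu> n) = sets (restrict_space borel (skew_space k))" for n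
      by (rule \<mu>)+
  qed (rule that)
qed

section \<open>Lifts of a base measure with nonnegative exponent\<close>

lemma locally_constant_continuous:
  fixes h :: "(int \<Rightarrow> nat) \<Rightarrow> 'b::topological_space"
  assumes "finite I" and h: "\<And>\<xi> \<eta>. (\<And>i. i \<in> I \<Longrightarrow> \<xi> i = \<eta> i) \<Longrightarrow> h \<xi> = h \<eta>"
  shows "continuous_on UNIV h"
  unfolding continuous_on_open_vimage[OF open_UNIV]
proof (intro allI impI)
  fix B :: "'b set"
  have "\<exists>T. open T \<and> \<xi> \<in> T \<and> T \<subseteq> h -` B \<inter> UNIV" if "\<xi> \<in> h -` B \<inter> UNIV" for \<xi>
  proof (intro exI conjI)
    show "open {\<eta>. \<forall>i\<in>I. \<eta> i \<in> {\<xi> i}}"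
      using product_topology_basis'[OF assms(1), of "\<lambda>i. {\<xi> i}" "\<lambda>i. i"]
      by (simp add: discrete_topology_class.open_discrete)
    show "{\<eta>. \<forall>i\<in>I. \<eta> i \<in> {\<xi> i}} \<subseteq> h -` B \<inter> UNIV"
    proof
      fix \<eta> assume "\<eta> \<in> {\<eta>. \<forall>i\<in>I. \<eta> i \<in> {\<xi> i}}"
      then have "h \<eta> = h \<xi>" by (intro h) auto
      with that show "\<eta> \<in> h -` B \<inter> UNIV" by simp
    qed
  qed auto
  then show "open (h -` B \<inter> UNIV)"
    by (subst open_subopen) blast
qed

lemma left_shift_pow: "(left_shift ^^ n) \<xi> i = \<xi> (i + int n)"
  by (induction n arbitrary: i) (auto simp: left_shift_def add_ac)

lemma left_shift_in: "\<xi> \<in> shift_space k \<Longrightarrow> left_shift \<xi> \<in> shift_space k"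
  by (simp add: shift_space_def left_shift_def)

lemma continuous_on_left_shift: "continuous_on S left_shift"
proof -
  have "continuous_on UNIV (\<lambda>\<xi>. left_shift \<xi> i)" for i
    unfolding left_shift_def by simp
  then have "continuous_on UNIV left_shift"
    by (rule continuous_on_coordinatewise_then_product)
  then show ?thesis by (rule continuous_on_subset) simp
qed

lemma continuous_on_symbolwise:
  fixes g :: "nat \<Rightarrow> circle \<Rightarrow> 'b::topological_space"
  assumes g: "\<And>i. i < k \<Longrightarrow> continuous_on UNIV (g i)"
  shows "continuous_on (skew_space k) (\<lambda>\<omega>. g (fst \<omega> 0) (snd \<omega>))"
proof -
  define U where "U i = {\<xi> :: int \<Rightarrow> nat. \<xi> 0 = i} \<times> (UNIV :: circle set)" for i
  have "open {\<xi> :: int \<Rightarrow> nat. \<xi> 0 = i}" for i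
    using product_topology_basis'[of "{0::int}" "\<lambda>_. {i}" "\<lambda>i. i"]
    by (simp add: discrete_topology_class.open_discrete)
  then have U: "open (U i)" for i
    unfolding U_def by (intro open_Times) auto
  have "continuous_on (\<Union>(U ` {..<k})) (\<lambda>\<omega>. g (fst \<omega> 0) (snd \<omega>))"
  proof (rule continuous_on_open_Union)
    fix V assume "V \<in> U ` {..<k}"
    then obtain i where i: "i < k" "V = U i" by auto
    show "open V" using U i by simp
    have "continuous_on V (\<lambda>\<omega>. g i (snd \<omega>))"
      by (rule continuous_on_compose2[OF g[OF i(1)]]) (auto intro: continuous_intros)
    then show "continuous_on V (\<lambda>\<omega>. g (fst \<omega> 0) (snd \<omega>))"
      by (rule continuous_on_eq) (auto simp: i U_def)
  qed
  then show ?thesis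
    by (rule continuous_on_subset) (auto simp: U_def skew_space_def shift_space_def)
qed

text \<open>
  The setting: fiber maps that are circle diffeomorphisms of class \<open>C\<^sup>1\<close>, indexed by \<open>k \<ge> 2\<close> symbols.
\<close>

locale circle_skew_product =
  fixes k :: nat and f :: "nat \<Rightarrow> circle \<Rightarrow> circle"
  assumes k2: "k \<ge> 2" and diffeo: "\<And>i. i < k \<Longrightarrow> circle_C1_diffeo (f i)"
begin

abbreviation \<Omega> :: "((int \<Rightarrow> nat) \<times> circle) set" where "\<Omega> \<equiv> skew_space k"

abbreviation F :: "(int \<Rightarrow> nat) \<times> circle \<Rightarrow> (int \<Rightarrow> nat) \<times> circle" where "F \<equiv> skew_product f"

text \<open>
  The observable whose integral is the fiber exponent.
\<close>

definition log_deriv :: "(int \<Rightarrow> nat) \<times> circle \<Rightarrow> real" where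
  "log_deriv \<omega> = ln \<bar>circle_deriv (f (fst \<omega> 0)) (snd \<omega>)\<bar>"

lemma fiber_exponent_eq: "fiber_exponent f M = (\<integral>\<omega>. log_deriv \<omega> \<partial>M)"
  by (simp add: fiber_exponent_def log_deriv_def case_prod_unfold)

lemma F_eq: "F \<omega> = (left_shift (fst \<omega>), f (fst \<omega> 0) (snd \<omega>))"
  by (simp add: skew_product_def case_prod_unfold)

lemma fst_F: "fst (F \<omega>) = left_shift (fst \<omega>)"
  by (simp add: F_eq)

lemma fst_F_pow: "fst ((F ^^ n) \<omega>) = (left_shift ^^ n) (fst \<omega>)"
  by (induction n) (simp_all add: fst_F)

lemma F_in: "\<omega> \<in> \<Omega> \<Longrightarrow> F \<omega> \<in> \<Omega>"
  by (auto simp: F_eq skew_space_def left_shift_in)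

lemma F_pow_in: "\<omega> \<in> \<Omega> \<Longrightarrow> (F ^^ n) \<omega> \<in> \<Omega>"
  by (induction n) (auto simp: F_in)

lemma continuous_on_F: "continuous_on \<Omega> F"
proof -
  have "continuous_on \<Omega> (\<lambda>\<omega>. f (fst \<omega> 0) (snd \<omega>))"
    using diffeo by (intro continuous_on_symbolwise circle_C1_diffeo_continuous)
  moreover have "continuous_on \<Omega> (\<lambda>\<omega>. left_shift (fst \<omega>))"
    by (rule continuous_on_compose2[OF continuous_on_left_shift[of UNIV]]) (auto intro: continuous_intros)
  ultimately have "continuous_on \<Omega> (\<lambda>\<omega>. (left_shift (fst \<omega>), f (fst \<omega> 0) (snd \<omega>)))"
    by (intro continuous_on_Pair)
  then show ?thesis by (simp add: F_eq[abs_def])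
qed

lemma continuous_on_F_pow: "continuous_on \<Omega> (F ^^ n)"
proof (induction n)
  case (Suc n)
  show ?case
    unfolding funpow.simps comp_def
    by (rule continuous_on_compose2[OF continuous_on_F Suc]) (auto simp: F_pow_in)
qed (simp add: continuous_on_id' id_def)

lemma measurable_F:
  "sets M = sets (restrict_space borel \<Omega>) \<Longrightarrow> F \<in> M \<rightarrow>\<^sub>M M"
proof -
  assume M: "sets M = sets (restrict_space borel \<Omega>)"
  have "F \<in> restrict_space borel \<Omega> \<rightarrow>\<^sub>M restrict_space borel \<Omega>"
    by (intro measurable_restrict_space2 borel_measurable_continuous_on_restrict continuous_on_F)
      (auto simp: space_restrict_space F_in)
  then show ?thesis using measurable_cong_sets[OF M M] by simp
qed

lemma measurable_fst_borel:
  "sets M = sets (restrict_space borel \<Omega>) \<Longrightarrow> fst \<in> borel_measurable M"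
  by (erule borel_measurable_restrictI) (auto intro: continuous_intros)

lemma bounded_on_\<Omega>:
  fixes \<phi> :: "(int \<Rightarrow> nat) \<times> circle \<Rightarrow> real"
  assumes "continuous_on \<Omega> \<phi>"
  obtains B where "B > 0" "\<And>\<omega>. \<omega> \<in> \<Omega> \<Longrightarrow> \<bar>\<phi> \<omega>\<bar> \<le> B"
proof -
  have "bounded (\<phi> ` \<Omega>)"
    by (intro compact_imp_bounded compact_continuous_image assms compact_skew_space)
  then show ?thesis
    using that unfolding bounded_pos by auto
qed

lemma integrable_continuous:
  fixes \<phi> :: "(int \<Rightarrow> nat) \<times> circle \<Rightarrow> real"
  assumes "continuous_on \<Omega> \<phi>" "finite_measure M" "sets M = sets (restrict_space borel \<Omega>)"
  shows "integrable M \<phi>"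
proof -
  interpret finite_measure M by fact
  obtain B where "\<And>\<omega>. \<omega> \<in> \<Omega> \<Longrightarrow> \<bar>\<phi> \<omega>\<bar> \<le> B" using bounded_on_\<Omega>[OF assms(1)] by metis
  moreover have "space M = \<Omega>" using assms(3) by (rule space_of_sets_restrict_borel)
  ultimately show ?thesis
    using assms by (intro integrable_const_bound[where B = B] borel_measurable_restrictI) auto
qed

text \<open>
  The invariant probability measures with the same projection to the base as \<open>\<mu>\<close>.
\<close>

definition lifts :: "((int \<Rightarrow> nat) \<times> circle) measure \<Rightarrow> ((int \<Rightarrow> nat) \<times> circle) measure set" where
  "lifts \<mu> = {M \<in> invariant_prob_measures \<Omega> F. distr M borel fst = distr \<mu> borel fst}"

lemma liftsD:
  assumes "M \<in> lifts \<mu>"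
  shows "prob_space M" "sets M = sets (restrict_space borel \<Omega>)" "space M = \<Omega>"
    "distr M M F = M" "distr M borel fst = distr \<mu> borel fst"
  using assms space_of_sets_restrict_borel by (auto simp: lifts_def invariant_prob_measures_def)

text \<open>
  The approximating measures \<open>N n\<close> need be invariant and project correctly only asymptotically.
\<close>

lemma limit_in_lifts:
  assumes \<mu>: "prob_space \<mu>" "sets \<mu> = sets (restrict_space borel \<Omega>)"
    and M: "prob_space M" "sets M = sets (restrict_space borel \<Omega>)"
    and lim: "\<And>\<phi>. continuous_on \<Omega> \<phi> \<Longrightarrow> (\<lambda>n. \<integral>x. \<phi> x \<partial>N n) \<longlonglongrightarrow> (\<integral>x. (\<phi> x :: real) \<partial>M)"
    and inv: "\<And>\<phi>. continuous_on \<Omega> \<phi> \<Longrightarrow>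
      (\<lambda>n. (\<integral>x. \<phi> (F x) \<partial>N n) - (\<integral>x. (\<phi> x :: real) \<partial>N n)) \<longlonglongrightarrow> 0"
    and marg: "\<And>g. continuous_on UNIV g \<Longrightarrow>
      (\<lambda>n. \<integral>x. (g (fst x) :: real) \<partial>N n) \<longlonglongrightarrow> (\<integral>x. g (fst x) \<partial>\<mu>)"
  shows "M \<in> lifts \<mu>"
proof -
  interpret M: prob_space M by fact
  interpret \<mu>: prob_space \<mu> by fact
  have FM: "F \<in> M \<rightarrow>\<^sub>M M" using M(2) by (rule measurable_F)
  have fstM: "fst \<in> borel_measurable M" "fst \<in> borel_measurable \<mu>"
    using M(2) \<mu>(2) by (auto intro: measurable_fst_borel)
  have "distr M M F = M"
  proof (rule measure_eqI_continuous[OF skew_space_borel])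
    show "prob_space (distr M M F)" using FM by (rule M.prob_space_distr)
    show "sets (distr M M F) = sets (restrict_space borel \<Omega>)" using M by simp
    fix \<phi> :: "(int \<Rightarrow> nat) \<times> circle \<Rightarrow> real" assume "continuous_on UNIV \<phi>"
    then have \<phi>: "continuous_on \<Omega> \<phi>" by (rule continuous_on_subset) simp
    have \<phi>F: "continuous_on \<Omega> (\<lambda>x. \<phi> (F x))"
      by (rule continuous_on_compose2[OF \<phi> continuous_on_F]) (auto simp: F_in)
    have "(\<lambda>n. (\<integral>x. \<phi> (F x) \<partial>N n) - (\<integral>x. \<phi> x \<partial>N n)) \<longlonglongrightarrow> (\<integral>x. \<phi> (F x) \<partial>M) - (\<integral>x. \<phi> x \<partial>M)"
      by (intro tendsto_diff lim \<phi> \<phi>F)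
    then have "(\<integral>x. \<phi> (F x) \<partial>M) - (\<integral>x. \<phi> x \<partial>M) = 0"
      using inv[OF \<phi>] by (rule LIMSEQ_unique)
    then show "(\<integral>x. \<phi> x \<partial>distr M M F) = (\<integral>x. \<phi> x \<partial>M)"
      using FM borel_measurable_restrictI[OF M(2) \<phi>] by (simp add: integral_distr)
  qed (use M in auto)
  moreover have "distr M borel fst = distr \<mu> borel fst"
  proof (rule measure_eqI_continuous[where \<Omega> = UNIV])
    show "prob_space (distr M borel fst)" "prob_space (distr \<mu> borel fst)"
      using fstM by (auto intro: M.prob_space_distr \<mu>.prob_space_distr)
    fix g :: "(int \<Rightarrow> nat) \<Rightarrow> real" assume g: "continuous_on UNIV g"
    have "continuous_on \<Omega> (\<lambda>x. g (fst x))"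
      by (rule continuous_on_compose2[OF g]) (auto intro: continuous_intros)
    then have "(\<integral>x. g (fst x) \<partial>M) = (\<integral>x. g (fst x) \<partial>\<mu>)"
      using LIMSEQ_unique[OF lim marg[OF g]] by blast
    then show "(\<integral>x. g x \<partial>distr M borel fst) = (\<integral>x. g x \<partial>distr \<mu> borel fst)"
      using fstM borel_measurable_continuous_onI[OF g] by (simp add: integral_distr)
  qed (auto simp: sets_restrict_space)
  ultimately show ?thesis
    using M FM by (simp add: lifts_def invariant_prob_measures_def)
qed

lemma lifts_integral_F:
  fixes \<phi> :: "(int \<Rightarrow> nat) \<times> circle \<Rightarrow> real"
  assumes M: "M \<in> lifts \<mu>" and \<phi>: "continuous_on \<Omega> \<phi>"
  shows "(\<integral>x. \<phi> (F x) \<partial>M) = (\<integral>x. \<phi> x \<partial>M)"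
proof -
  have "(\<integral>x. \<phi> x \<partial>distr M M F) = (\<integral>x. \<phi> (F x) \<partial>M)"
    by (intro integral_distr measurable_F borel_measurable_restrictI[OF _ \<phi>] liftsD(2)[OF M])
  then show ?thesis by (simp add: liftsD(4)[OF M])
qed

lemma lifts_integral_fst:
  fixes g :: "(int \<Rightarrow> nat) \<Rightarrow> real"
  assumes M: "M \<in> lifts \<mu>" and \<mu>: "sets \<mu> = sets (restrict_space borel \<Omega>)"
    and g: "g \<in> borel_measurable borel"
  shows "(\<integral>x. g (fst x) \<partial>M) = (\<integral>x. g (fst x) \<partial>\<mu>)"
proof -
  have "(\<integral>x. g x \<partial>distr M borel fst) = (\<integral>x. g (fst x) \<partial>M)"
    by (intro integral_distr measurable_fst_borel liftsD(2)[OF M] g)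
  moreover have "(\<integral>x. g x \<partial>distr \<mu> borel fst) = (\<integral>x. g (fst x) \<partial>\<mu>)"
    by (intro integral_distr measurable_fst_borel \<mu> g)
  ultimately show ?thesis by (simp add: liftsD(5)[OF M])
qed

lemma lifts_seq_compact:
  assumes \<mu>: "prob_space \<mu>" "sets \<mu> = sets (restrict_space borel \<Omega>)"
    and N: "\<And>n. N n \<in> lifts \<mu>"
  obtains r M where "strict_mono (r :: nat \<Rightarrow> nat)" "M \<in> lifts \<mu>"
    "\<And>\<phi>. continuous_on \<Omega> \<phi> \<Longrightarrow> (\<lambda>n. \<integral>x. \<phi> x \<partial>N (r n)) \<longlonglongrightarrow> (\<integral>x. (\<phi> x :: real) \<partial>M)"
proof -
  obtain r M where r: "strict_mono (r :: nat \<Rightarrow> nat)" and M: "prob_space M"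
    "sets M = sets (restrict_space borel \<Omega>)"
    "\<And>\<phi>. continuous_on \<Omega> \<phi> \<Longrightarrow> (\<lambda>n. \<integral>x. \<phi> x \<partial>N (r n)) \<longlonglongrightarrow> (\<integral>x. (\<phi> x :: real) \<partial>M)"
    using skew_measures_seq_compact[of k N, OF k2 liftsD(1)[OF N] liftsD(2)[OF N]] by blast
  have "M \<in> lifts \<mu>"
    using \<mu> M
  proof (rule limit_in_lifts[where N = "\<lambda>n. N (r n)"])
    show "(\<lambda>n. (\<integral>x. \<phi> (F x) \<partial>N (r n)) - (\<integral>x. (\<phi> x :: real) \<partial>N (r n))) \<longlonglongrightarrow> 0"
      if "continuous_on \<Omega> \<phi>" for \<phi>
      using lifts_integral_F[OF N that] by simp
    show "(\<lambda>n. \<integral>x. (g (fst x) :: real) \<partial>N (r n)) \<longlonglongrightarrow> (\<integral>x. g (fst x) \<partial>\<mu>)"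
      if "continuous_on UNIV g" for g
      using lifts_integral_fst[OF N \<mu>(2) borel_measurable_continuous_onI[OF that]] by simp
  qed
  with r M(3) show ?thesis using that by blast
qed

lemma continuous_on_log_deriv: "continuous_on \<Omega> log_deriv"
  unfolding log_deriv_def
proof (rule continuous_on_symbolwise[where g = "\<lambda>i x. ln \<bar>circle_deriv (f i) x\<bar>"])
  fix i assume i: "i < k"
  have "continuous_on UNIV (circle_deriv (f i))"
    using diffeo[OF i] by (simp add: circle_C1_diffeo_def circle_C1_def)
  then show "continuous_on UNIV (\<lambda>x. ln \<bar>circle_deriv (f i) x\<bar>)"
    using circle_C1_diffeo_deriv_nonzero[OF diffeo[OF i]] by (intro continuous_intros) auto
qed

text \<open>
  The fiber map of \<open>F ^^ n\<close> over the base point \<open>\<xi>\<close>.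
\<close>

fun fiber_iterate :: "(int \<Rightarrow> nat) \<Rightarrow> nat \<Rightarrow> circle \<Rightarrow> circle" where
  "fiber_iterate \<xi> 0 = id"
| "fiber_iterate \<xi> (Suc n) = f (\<xi> (int n)) \<circ> fiber_iterate \<xi> n"

lemma F_pow_eq: "(F ^^ n) (\<xi>, x) = ((left_shift ^^ n) \<xi>, fiber_iterate \<xi> n x)"
proof (induction n)
  case (Suc n)
  have "(left_shift ^^ n) \<xi> 0 = \<xi> (int n)"
    by (simp add: left_shift_pow)
  with Suc show ?case
    by (simp add: F_eq[of "(_, _)"])
qed simp

lemma fiber_iterate_cong:
  "(\<And>i. 0 \<le> i \<Longrightarrow> i < int n \<Longrightarrow> \<xi> i = \<eta> i) \<Longrightarrow> fiber_iterate \<xi> n = fiber_iterate \<eta> n"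
  by (induction n) auto

lemma bij_fiber_iterate: "\<xi> \<in> shift_space k \<Longrightarrow> bij (fiber_iterate \<xi> n)"
proof (induction n)
  case (Suc n)
  then have "bij (f (\<xi> (int n)))"
    using diffeo by (auto simp: shift_space_def circle_C1_diffeo_def)
  with Suc show ?case
    unfolding fiber_iterate.simps by (intro bij_comp) auto
qed simp

text \<open>
  By the chain rule, the logarithm of the modulus of the derivative of the \<open>n\<close>-th fiber iterate.
\<close>

definition birkhoff_log_deriv :: "nat \<Rightarrow> (int \<Rightarrow> nat) \<Rightarrow> circle \<Rightarrow> real" where
  "birkhoff_log_deriv n \<xi> x = (\<Sum>j<n. log_deriv ((F ^^ j) (\<xi>, x)))"

lemma birkhoff_log_deriv_eq:
  "birkhoff_log_deriv n \<xi> x = (\<Sum>j<n. ln \<bar>circle_deriv (f (\<xi> (int j))) (fiber_iterate \<xi> j x)\<bar>)"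
  by (simp add: birkhoff_log_deriv_def log_deriv_def F_pow_eq left_shift_pow)

lemma birkhoff_log_deriv_cong:
  "(\<And>i. 0 \<le> i \<Longrightarrow> i < int n \<Longrightarrow> \<xi> i = \<eta> i) \<Longrightarrow> birkhoff_log_deriv n \<xi> x = birkhoff_log_deriv n \<eta> x"
proof -
  assume eq: "\<And>i. 0 \<le> i \<Longrightarrow> i < int n \<Longrightarrow> \<xi> i = \<eta> i"
  have "fiber_iterate \<xi> j = fiber_iterate \<eta> j" "\<xi> (int j) = \<eta> (int j)" if "j < n" for j
    using that by (auto intro!: fiber_iterate_cong eq)
  then show ?thesis
    unfolding birkhoff_log_deriv_eq by (intro sum.cong) auto
qed

lemma fiber_iterate_deriv:
  assumes \<xi>: "\<xi> \<in> shift_space k"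
  shows "\<exists>D. has_circle_deriv (fiber_iterate \<xi> n) D x \<and> D \<noteq> 0 \<and> ln \<bar>D\<bar> = birkhoff_log_deriv n \<xi> x"
proof (induction n)
  case 0
  show ?case
    using has_circle_deriv_id[of x]
    by (intro exI[of _ 1]) (simp add: birkhoff_log_deriv_def id_def)
next
  case (Suc n)
  then obtain D where D: "has_circle_deriv (fiber_iterate \<xi> n) D x" "D \<noteq> 0"
    "ln \<bar>D\<bar> = birkhoff_log_deriv n \<xi> x" by blast
  let ?E = "circle_deriv (f (\<xi> (int n))) (fiber_iterate \<xi> n x)"
  have fd: "circle_C1_diffeo (f (\<xi> (int n)))"
    using \<xi> diffeo by (simp add: shift_space_def)
  then have E: "?E \<noteq> 0" by (rule circle_C1_diffeo_deriv_nonzero)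
  have "has_circle_deriv (f (\<xi> (int n))) ?E (fiber_iterate \<xi> n x)"
    using fd by (simp add: circle_C1_has_deriv circle_C1_diffeo_def)
  then have "has_circle_deriv (fiber_iterate \<xi> (Suc n)) (?E * D) x"
    using has_circle_deriv_compose[OF D(1)] by simp
  moreover have "ln \<bar>?E * D\<bar> = birkhoff_log_deriv (Suc n) \<xi> x"
    using D E by (simp add: birkhoff_log_deriv_eq abs_mult ln_mult)
  moreover have "?E * D \<noteq> 0" using D(2) E by simp
  ultimately show ?case by blast
qed

lemma exists_noncontracting_orbit:
  assumes \<xi>: "\<xi> \<in> shift_space k"
  shows "\<exists>x. birkhoff_log_deriv n \<xi> x \<ge> 0"
proof -
  obtain D where D: "\<And>x. has_circle_deriv (fiber_iterate \<xi> n) (D x) x" "\<And>x. D x \<noteq> 0"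
      "\<And>x. ln \<bar>D x\<bar> = birkhoff_log_deriv n \<xi> x"
    using fiber_iterate_deriv[OF \<xi>] by metis
  have "surj (fiber_iterate \<xi> n)"
    using bij_fiber_iterate[OF \<xi>] by (rule bij_is_surj)
  then obtain x where "\<bar>D x\<bar> \<ge> 1"
    using exists_noncontracting_point[OF _ D(1)] by blast
  then show ?thesis using D(3)[of x] by (intro exI[of _ x]) (metis ln_ge_zero)
qed

text \<open>
  For \<open>\<xi>\<close> in \<open>\<Sigma>\<^sub>k\<close>, a point at which the \<open>n\<close>-th fiber iterate has derivative of modulus at least 1. The choice
  is made after all symbols outside \<open>{0..<n}\<close> have been replaced by \<open>0\<close>, so that it depends on
  finitely many coordinates and is continuous in \<open>\<xi>\<close>.
\<close>

definition noncontracting_point :: "nat \<Rightarrow> (int \<Rightarrow> nat) \<Rightarrow> circle" where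
  "noncontracting_point n \<xi> = (let \<eta> = (\<lambda>i. if 0 \<le> i \<and> i < int n then \<xi> i else 0)
     in SOME x. birkhoff_log_deriv n \<eta> x \<ge> 0)"

lemma noncontracting_point:
  assumes "\<xi> \<in> shift_space k"
  shows "birkhoff_log_deriv n \<xi> (noncontracting_point n \<xi>) \<ge> 0"
proof -
  let ?\<eta> = "\<lambda>i. if 0 \<le> i \<and> i < int n then \<xi> i else 0"
  have "?\<eta> \<in> shift_space k"
    using assms k2 by (auto simp: shift_space_def)
  then have "birkhoff_log_deriv n ?\<eta> (noncontracting_point n \<xi>) \<ge> 0"
    unfolding noncontracting_point_def Let_def by (rule someI_ex[OF exists_noncontracting_orbit])
  also have "birkhoff_log_deriv n ?\<eta> (noncontracting_point n \<xi>)
      = birkhoff_log_deriv n \<xi> (noncontracting_point n \<xi>)"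
    by (rule birkhoff_log_deriv_cong) simp
  finally show ?thesis .
qed

lemma continuous_on_noncontracting_point: "continuous_on UNIV (noncontracting_point n)"
proof (rule locally_constant_continuous[where I = "{0..<int n}"])
  fix \<xi> \<eta> :: "int \<Rightarrow> nat" assume "\<And>i. i \<in> {0..<int n} \<Longrightarrow> \<xi> i = \<eta> i"
  then have "(\<lambda>i. if 0 \<le> i \<and> i < int n then \<xi> i else 0) = (\<lambda>i. if 0 \<le> i \<and> i < int n then \<eta> i else 0)"
    by auto
  then show "noncontracting_point n \<xi> = noncontracting_point n \<eta>"
    by (simp add: noncontracting_point_def)
qed simp

text \<open>
  Replaces the fiber coordinate by the noncontracting point. The image of \<open>\<mu>\<close> lives on a graph over
  the base and has the same projection.
\<close>

definition graph_point :: "nat \<Rightarrow> (int \<Rightarrow> nat) \<times> circle \<Rightarrow> (int \<Rightarrow> nat) \<times> circle" where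
  "graph_point n \<omega> = (fst \<omega>, noncontracting_point n (fst \<omega>))"

lemma continuous_on_graph_point: "continuous_on \<Omega> (graph_point n)"
  unfolding graph_point_def
proof (intro continuous_on_Pair)
  show "continuous_on \<Omega> (\<lambda>\<omega>. noncontracting_point n (fst \<omega>))"
    by (rule continuous_on_compose2[OF continuous_on_noncontracting_point]) (auto intro: continuous_intros)
qed (auto intro: continuous_intros)

lemma graph_point_in: "\<omega> \<in> \<Omega> \<Longrightarrow> graph_point n \<omega> \<in> \<Omega>"
  by (auto simp: graph_point_def skew_space_def)

text \<open>
  The average over \<open>j < n\<close> of the images under \<open>F ^^ j\<close> of the measure on the graph, realised as the
  image of the product of \<open>\<mu>\<close> with the uniform distribution on \<open>{..<n}\<close>.
\<close>

lemma orbit_average_measure: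
  assumes \<mu>: "prob_space \<mu>" "sets \<mu> = sets (restrict_space borel \<Omega>)" and n: "n > 0"
  obtains N where "prob_space N" "sets N = sets (restrict_space borel \<Omega>)"
    "\<And>\<phi>. continuous_on \<Omega> \<phi> \<Longrightarrow>
      (\<integral>x. (\<phi> x :: real) \<partial>N) = (\<Sum>j<n. \<integral>\<omega>. \<phi> ((F ^^ j) (graph_point n \<omega>)) \<partial>\<mu>) / real n"
proof -
  interpret \<mu>: prob_space \<mu> by fact
  let ?p = "pmf_of_set {..<n}"
  let ?T = "\<lambda>(j, \<omega>). (F ^^ j) (graph_point n \<omega>)"
  interpret P: pair_prob_space "measure_pmf ?p" \<mu> ..
  have sp: "space \<mu> = \<Omega>" using \<mu>(2) by (rule space_of_sets_restrict_borel)
  have contT: "continuous_on \<Omega> (\<lambda>\<omega>. (F ^^ j) (graph_point n \<omega>))" for j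
    by (rule continuous_on_compose2[OF continuous_on_F_pow continuous_on_graph_point])
      (auto simp: graph_point_in)
  have T: "?T \<in> measure_pmf ?p \<Otimes>\<^sub>M \<mu> \<rightarrow>\<^sub>M restrict_space borel \<Omega>"
  proof -
    have "?T \<in> count_space UNIV \<Otimes>\<^sub>M \<mu> \<rightarrow>\<^sub>M restrict_space borel \<Omega>"
    proof (rule measurable_pair_measure_countable1)
      fix j :: nat
      show "(\<lambda>\<omega>. ?T (j, \<omega>)) \<in> \<mu> \<rightarrow>\<^sub>M restrict_space borel \<Omega>"
        using borel_measurable_restrictI[OF \<mu>(2) contT[of j]]
        by (intro measurable_restrict_space2) (auto simp: sp graph_point_in F_pow_in)
    qed simp
    moreover have "sets (measure_pmf ?p \<Otimes>\<^sub>M \<mu>) = sets (count_space UNIV \<Otimes>\<^sub>M \<mu>)"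
      by (intro sets_pair_measure_cong) auto
    ultimately show ?thesis by (simp cong: measurable_cong_sets)
  qed
  define N where "N = distr (measure_pmf ?p \<Otimes>\<^sub>M \<mu>) (restrict_space borel \<Omega>) ?T"
  show ?thesis
  proof (rule that[of N])
    show "prob_space N" unfolding N_def by (rule P.prob_space_distr[OF T])
    show "sets N = sets (restrict_space borel \<Omega>)" by (simp add: N_def)
    fix \<phi> :: "(int \<Rightarrow> nat) \<times> circle \<Rightarrow> real" assume \<phi>: "continuous_on \<Omega> \<phi>"
    obtain B where B: "\<And>\<omega>. \<omega> \<in> \<Omega> \<Longrightarrow> \<bar>\<phi> \<omega>\<bar> \<le> B" using bounded_on_\<Omega>[OF \<phi>] by metis
    have \<phi>m: "\<phi> \<in> borel_measurable (restrict_space borel \<Omega>)"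
      using \<phi> by (rule borel_measurable_continuous_on_restrict)
    have int: "integrable (measure_pmf ?p \<Otimes>\<^sub>M \<mu>) (\<lambda>z. \<phi> (?T z))"
    proof (rule P.P.integrable_const_bound[where B = B])
      show "(\<lambda>z. \<phi> (?T z)) \<in> borel_measurable (measure_pmf ?p \<Otimes>\<^sub>M \<mu>)"
        using T \<phi>m by (rule measurable_compose)
      show "AE z in measure_pmf ?p \<Otimes>\<^sub>M \<mu>. norm (\<phi> (?T z)) \<le> B"
        by (rule AE_I2) (auto simp: space_pair_measure sp intro!: B F_pow_in graph_point_in)
    qed
    have "(\<integral>x. \<phi> x \<partial>N) = (\<integral>z. \<phi> (?T z) \<partial>(measure_pmf ?p \<Otimes>\<^sub>M \<mu>))"
      unfolding N_def using T \<phi>m by (rule integral_distr)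
    also have "\<dots> = (\<integral>j. (\<integral>\<omega>. \<phi> (?T (j, \<omega>)) \<partial>\<mu>) \<partial>measure_pmf ?p)"
      using P.integral_fst'[OF int] by simp
    also have "\<dots> = (\<Sum>j<n. \<integral>\<omega>. \<phi> ((F ^^ j) (graph_point n \<omega>)) \<partial>\<mu>) / real n"
      using n by (subst integral_pmf_of_set) (auto simp: lessThan_empty_iff)
    finally show "(\<integral>x. \<phi> x \<partial>N) = (\<Sum>j<n. \<integral>\<omega>. \<phi> ((F ^^ j) (graph_point n \<omega>)) \<partial>\<mu>) / real n" .
  qed
qed

text \<open>
  The orbit averages have nonnegative exponent, because their exponent is the mean of the
  logarithms of derivatives of modulus at least 1, divided by \<open>n\<close>. Any weak limit is a lift.
\<close>

lemma exists_nonneg_lift: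
  assumes \<mu>_inv: "\<mu> \<in> invariant_prob_measures \<Omega> F"
  obtains M where "M \<in> lifts \<mu>" "fiber_exponent f M \<ge> 0"
proof -
  have \<mu>l: "\<mu> \<in> lifts \<mu>" using \<mu>_inv by (simp add: lifts_def)
  note \<mu> = liftsD(1,2)[OF \<mu>l]
  have sp: "space \<mu> = \<Omega>" using \<mu>l by (rule liftsD(3))
  interpret \<mu>: prob_space \<mu> by (rule \<mu>)
  have contT: "continuous_on \<Omega> (\<lambda>\<omega>. (F ^^ j) (graph_point n \<omega>))" for j n
    by (rule continuous_on_compose2[OF continuous_on_F_pow continuous_on_graph_point])
      (auto simp: graph_point_in)
  have Tin: "(F ^^ j) (graph_point n \<omega>) \<in> \<Omega>" if "\<omega> \<in> \<Omega>" for j n \<omega>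
    using that by (intro F_pow_in graph_point_in)
  have contC: "continuous_on \<Omega> (\<lambda>\<omega>. \<phi> ((F ^^ j) (graph_point n \<omega>)))"
    if "continuous_on \<Omega> \<phi>" for \<phi> :: "(int \<Rightarrow> nat) \<times> circle \<Rightarrow> real" and j n
    by (rule continuous_on_compose2[OF that contT]) (auto intro: Tin)
  have intC: "integrable \<mu> (\<lambda>\<omega>. \<phi> ((F ^^ j) (graph_point n \<omega>)))"
    if "continuous_on \<Omega> \<phi>" for \<phi> :: "(int \<Rightarrow> nat) \<times> circle \<Rightarrow> real" and j n
    by (rule integrable_continuous[OF contC[OF that] _ \<mu>(2)]) unfold_locales
  have "\<exists>N. prob_space N \<and> sets N = sets (restrict_space borel \<Omega>) \<and>
    (\<forall>\<phi>. continuous_on \<Omega> \<phi> \<longrightarrow> (\<integral>x. (\<phi> x :: real) \<partial>N) =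
       (\<Sum>j<Suc n. \<integral>\<omega>. \<phi> ((F ^^ j) (graph_point (Suc n) \<omega>)) \<partial>\<mu>) / real (Suc n))" for n
    using orbit_average_measure[OF \<mu> zero_less_Suc[of n]] by metis
  then obtain N where N: "\<And>n. prob_space (N n)" "\<And>n. sets (N n) = sets (restrict_space borel \<Omega>)"
    and int: "\<And>n \<phi>. continuous_on \<Omega> \<phi> \<Longrightarrow> (\<integral>x. (\<phi> x :: real) \<partial>N n) =
       (\<Sum>j<Suc n. \<integral>\<omega>. \<phi> ((F ^^ j) (graph_point (Suc n) \<omega>)) \<partial>\<mu>) / real (Suc n)"
    by metis
  obtain r M where r: "strict_mono (r :: nat \<Rightarrow> nat)" and M: "prob_space M"
    "sets M = sets (restrict_space borel \<Omega>)"
    "\<And>\<phi>. continuous_on \<Omega> \<phi> \<Longrightarrow> (\<lambda>n. \<integral>x. \<phi> x \<partial>N (r n)) \<longlonglongrightarrow> (\<integral>x. (\<phi> x :: real) \<partial>M)"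
    using skew_measures_seq_compact[of k N, OF k2 N] by blast
  have "M \<in> lifts \<mu>"
    using \<mu> M
  proof (rule limit_in_lifts[where N = "\<lambda>n. N (r n)"])
    fix \<phi> :: "(int \<Rightarrow> nat) \<times> circle \<Rightarrow> real" assume \<phi>: "continuous_on \<Omega> \<phi>"
    have \<phi>F: "continuous_on \<Omega> (\<lambda>x. \<phi> (F x))"
      by (rule continuous_on_compose2[OF \<phi> continuous_on_F]) (auto simp: F_in)
    obtain B where B: "B > 0" "\<And>\<omega>. \<omega> \<in> \<Omega> \<Longrightarrow> \<bar>\<phi> \<omega>\<bar> \<le> B" using bounded_on_\<Omega>[OF \<phi>] by metis
    have bound: "\<bar>(\<integral>x. \<phi> (F x) \<partial>N n) - (\<integral>x. \<phi> x \<partial>N n)\<bar> \<le> 2 * B / real (Suc n)" for n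
    proof -
      define a where "a j = (\<integral>\<omega>. \<phi> ((F ^^ j) (graph_point (Suc n) \<omega>)) \<partial>\<mu>)" for j
      have a: "\<bar>a j\<bar> \<le> B" for j
      proof -
        have "\<bar>a j\<bar> \<le> (\<integral>\<omega>. \<bar>\<phi> ((F ^^ j) (graph_point (Suc n) \<omega>))\<bar> \<partial>\<mu>)"
          unfolding a_def by (rule integral_abs_bound)
        also have "\<dots> \<le> (\<integral>\<omega>. B \<partial>\<mu>)"
          using intC[OF \<phi>] by (intro integral_mono integrable_abs) (auto simp: sp intro!: B Tin)
        finally show ?thesis by (simp add: \<mu>.prob_space)
      qed
      have "(\<integral>x. \<phi> (F x) \<partial>N n) - (\<integral>x. \<phi> x \<partial>N n) = ((\<Sum>j<Suc n. a (Suc j)) - (\<Sum>j<Suc n. a j)) / real (Suc n)"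
        unfolding int[OF \<phi>] int[OF \<phi>F] a_def by (simp add: diff_divide_distrib)
      also have "(\<Sum>j<Suc n. a (Suc j)) - (\<Sum>j<Suc n. a j) = a (Suc n) - a 0"
        by (simp only: sum_subtractf[symmetric] sum_lessThan_telescope)
      finally have "\<bar>(\<integral>x. \<phi> (F x) \<partial>N n) - (\<integral>x. \<phi> x \<partial>N n)\<bar> = \<bar>a (Suc n) - a 0\<bar> / real (Suc n)"
        by simp
      also have "\<dots> \<le> 2 * B / real (Suc n)"
        using a[of "Suc n"] a[of 0] by (intro divide_right_mono) linarith+
      finally show ?thesis .
    qed
    have "(\<lambda>n. (\<integral>x. \<phi> (F x) \<partial>N n) - (\<integral>x. \<phi> x \<partial>N n)) \<longlonglongrightarrow> 0"
    proof (rule Lim_null_comparison)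
      show "\<forall>\<^sub>F n in sequentially. norm ((\<integral>x. \<phi> (F x) \<partial>N n) - (\<integral>x. \<phi> x \<partial>N n)) \<le> 2 * B / real (Suc n)"
        using bound by simp
      show "(\<lambda>n. 2 * B / real (Suc n)) \<longlonglongrightarrow> 0"
        using LIMSEQ_Suc[OF lim_const_over_n] by simp
    qed
    then show "(\<lambda>n. (\<integral>x. \<phi> (F x) \<partial>N (r n)) - (\<integral>x. \<phi> x \<partial>N (r n))) \<longlonglongrightarrow> 0"
      using r by (rule LIMSEQ_subseq_LIMSEQ[unfolded comp_def])
  next
    fix g :: "(int \<Rightarrow> nat) \<Rightarrow> real" assume g: "continuous_on UNIV g"
    have gc: "continuous_on \<Omega> (\<lambda>x. g (fst x))"
      by (rule continuous_on_compose2[OF g]) (auto intro: continuous_intros)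
    have shift: "(\<integral>\<omega>. g ((left_shift ^^ j) (fst \<omega>)) \<partial>\<mu>) = (\<integral>\<omega>. g (fst \<omega>) \<partial>\<mu>)" for j
    proof (induction j)
      case (Suc j)
      have "continuous_on \<Omega> (\<lambda>\<omega>. g (fst ((F ^^ j) \<omega>)))"
        by (rule continuous_on_compose2[OF gc continuous_on_F_pow]) (auto intro: F_pow_in)
      from lifts_integral_F[OF \<mu>l this] Suc show ?case
        by (simp add: fst_F_pow fst_F funpow_swap1)
    qed simp
    have "(\<integral>x. g (fst x) \<partial>N n) = (\<integral>x. g (fst x) \<partial>\<mu>)" for n
      unfolding int[OF gc] by (simp add: fst_F_pow graph_point_def shift field_simps)
    then show "(\<lambda>n. \<integral>x. g (fst x) \<partial>N (r n)) \<longlonglongrightarrow> (\<integral>x. g (fst x) \<partial>\<mu>)" by simp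
  qed
  moreover have "fiber_exponent f M \<ge> 0"
    unfolding fiber_exponent_eq
  proof (rule LIMSEQ_le_const[OF M(3)[OF continuous_on_log_deriv]])
    have "0 \<le> (\<integral>x. log_deriv x \<partial>N n)" for n
    proof -
      have "(\<Sum>j<Suc n. \<integral>\<omega>. log_deriv ((F ^^ j) (graph_point (Suc n) \<omega>)) \<partial>\<mu>) =
          (\<integral>\<omega>. (\<Sum>j<Suc n. log_deriv ((F ^^ j) (graph_point (Suc n) \<omega>))) \<partial>\<mu>)"
        by (rule Bochner_Integration.integral_sum[symmetric]) (rule intC[OF continuous_on_log_deriv])
      also have "\<dots> \<ge> 0"
      proof (rule integral_nonneg_AE, rule AE_I2)
        fix \<omega> assume "\<omega> \<in> space \<mu>"
        then have "fst \<omega> \<in> shift_space k" by (auto simp: sp skew_space_def)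
        from noncontracting_point[OF this, of "Suc n"]
        show "0 \<le> (\<Sum>j<Suc n. log_deriv ((F ^^ j) (graph_point (Suc n) \<omega>)))"
          by (simp add: birkhoff_log_deriv_def graph_point_def)
      qed
      finally show ?thesis
        unfolding int[OF continuous_on_log_deriv] by simp
    qed
    then show "\<exists>N'. \<forall>n\<ge>N'. 0 \<le> (\<integral>x. log_deriv x \<partial>N (r n))" by blast
  qed
  ultimately show ?thesis by (rule that)
qed

end

section \<open>Extremal lifts are ergodic\<close>

text \<open>
  An invariant measure \<open>N\<close> dominated by an ergodic measure \<open>\<nu>\<close> is a multiple of it. The signed measure
  \<open>N - a \<nu>\<close> of total mass \<open>0\<close> attains its maximum on a set, and the upper limit of the preimages of
  this set is a strictly invariant set on which the maximum is attained as well. By ergodicity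
  the maximum is \<open>0\<close>.
\<close>

lemma invariant_dominated_measure_proportional:
  assumes "prob_space \<nu>" "finite_measure N" and sN: "sets N = sets \<nu>"
    and S: "S \<in> \<nu> \<rightarrow>\<^sub>M \<nu>" and erg: "ergodic S \<nu>"
    and inv: "\<And>B. B \<in> sets \<nu> \<Longrightarrow> measure \<nu> (S -` B \<inter> space \<nu>) = measure \<nu> B"
      "\<And>B. B \<in> sets \<nu> \<Longrightarrow> measure N (S -` B \<inter> space \<nu>) = measure N B"
    and le: "\<And>B. B \<in> sets \<nu> \<Longrightarrow> measure N B \<le> measure \<nu> B"
    and B: "B \<in> sets \<nu>"
  shows "measure N B = measure N (space \<nu>) * measure \<nu> B"
proof -
  interpret \<nu>: prob_space \<nu> by fact
  interpret N: finite_measure N by fact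
  define X where "X = space \<nu>"
  have spN: "space N = X" using sN X_def by (metis sets_eq_imp_space_eq)
  define a where "a = measure N X"
  define \<tau> where "\<tau> B = measure N B - a * measure \<nu> B" for B
  define R where "R = scale_measure (ennreal a) \<nu>"
  have sR: "sets R = sets N" by (simp add: R_def sN)
  have eR: "emeasure R B = ennreal (a * measure \<nu> B)" for B
    by (simp add: R_def \<nu>.emeasure_eq_measure ennreal_mult a_def)
  have "finite_measure R"
    by (rule finite_measureI) (simp add: eR)
  obtain Y where Y: "Y \<in> sets N" "\<And>B. B \<in> sets N \<Longrightarrow> B \<subseteq> Y \<Longrightarrow> emeasure R B \<le> emeasure N B"
    "\<And>B. B \<in> sets N \<Longrightarrow> B \<inter> Y = {} \<Longrightarrow> emeasure N B \<le> emeasure R B"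
    using finite_unsigned_Hahn_decomposition[OF \<open>finite_measure N\<close> \<open>finite_measure R\<close> sR] by blast
  have pos: "\<tau> B \<ge> 0" if "B \<in> sets \<nu>" "B \<subseteq> Y" for B
    using Y(2)[of B] that by (simp add: \<tau>_def eR N.emeasure_eq_measure sN)
  have neg: "\<tau> B \<le> 0" if "B \<in> sets \<nu>" "B \<inter> Y = {}" for B
    using Y(3)[of B] that by (simp add: \<tau>_def eR N.emeasure_eq_measure sN a_def)
  have Ys: "Y \<in> sets \<nu>" using Y(1) sN by simp
  have add: "\<tau> (B \<union> C) = \<tau> B + \<tau> C" if "B \<in> sets \<nu>" "C \<in> sets \<nu>" "B \<inter> C = {}" for B C
    using that by (simp add: \<tau>_def \<nu>.finite_measure_Union N.finite_measure_Union sN algebra_simps)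
  define m where "m = \<tau> Y"
  have le_m: "\<tau> B \<le> m" if B: "B \<in> sets \<nu>" for B
  proof -
    have "\<tau> B = \<tau> (B \<inter> Y) + \<tau> (B - Y)"
      using add[of "B \<inter> Y" "B - Y"] B Ys by (auto simp: Int_Diff_Un)
    moreover have "m = \<tau> (B \<inter> Y) + \<tau> (Y - B)"
    proof -
      have "B \<inter> Y \<union> (Y - B) = Y" "B \<inter> Y \<inter> (Y - B) = {}" by blast+
      then show ?thesis using add[of "B \<inter> Y" "Y - B"] B Ys by (simp add: m_def)
    qed
    moreover have "\<tau> (B - Y) \<le> 0" "\<tau> (Y - B) \<ge> 0"
      using B Ys by (auto intro!: neg pos)
    ultimately show ?thesis by linarith
  qed
  have max_Un: "\<tau> (B \<union> C) = m" if "B \<in> sets \<nu>" "C \<in> sets \<nu>" "\<tau> B = m" "\<tau> C = m" for B C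
  proof -
    have "\<tau> (B \<union> C) = \<tau> B + \<tau> (C - B)"
      using add[of B "C - B"] that by (auto simp: Un_Diff_cancel)
    moreover have "\<tau> C = \<tau> (C \<inter> B) + \<tau> (C - B)"
      using add[of "C \<inter> B" "C - B"] that by (auto simp: Int_Diff_Un)
    ultimately show ?thesis
      using that le_m[of "B \<union> C"] le_m[of "C \<inter> B"] by auto
  qed
  define Z where "Z n = ((\<lambda>B. S -` B \<inter> X) ^^ n) Y" for n
  have Zs: "Z n \<in> sets \<nu>" for n
    by (induction n) (use S Ys in \<open>auto simp: Z_def X_def\<close>)
  have Zm: "\<tau> (Z n) = m" for n
  proof (induction n)
    case (Suc n)
    have "Z (Suc n) = S -` Z n \<inter> X" by (simp add: Z_def)
    then have "\<tau> (Z (Suc n)) = \<tau> (Z n)" using inv Zs[of n] by (simp add: \<tau>_def X_def)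
    then show ?case using Suc by simp
  qed (simp add: Z_def m_def)
  define U where "U n = (\<Union>j\<in>{n..}. Z j)" for n
  have Us: "U n \<in> sets \<nu>" for n unfolding U_def using Zs by auto
  have fin: "(\<Union>j\<in>{n..n+i}. Z j) \<in> sets \<nu> \<and> \<tau> (\<Union>j\<in>{n..n+i}. Z j) = m" for n i
  proof (induction i)
    case (Suc i)
    have "(\<Union>j\<in>{n..n+Suc i}. Z j) = (\<Union>j\<in>{n..n+i}. Z j) \<union> Z (n + Suc i)"
      by (auto simp: atLeastAtMostSuc_conv)
    moreover have "\<tau> ((\<Union>j\<in>{n..n+i}. Z j) \<union> Z (n + Suc i)) = m"
      using Suc.IH Zs[of "n + Suc i"] Zm[of "n + Suc i"] by (intro max_Un) auto
    moreover have "(\<Union>j\<in>{n..n+i}. Z j) \<union> Z (n + Suc i) \<in> sets \<nu>"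
      using Suc.IH Zs[of "n + Suc i"] by (intro sets.Un) auto
    ultimately show ?case by (simp only:)
  qed (use Zs Zm in auto)
  have lim_inc: "(\<lambda>i. \<tau> (A i)) \<longlonglongrightarrow> \<tau> (\<Union>i. A i)" if "range A \<subseteq> sets \<nu>" "incseq A" for A
    unfolding \<tau>_def using that
    by (intro tendsto_intros N.finite_Lim_measure_incseq \<nu>.finite_Lim_measure_incseq) (auto simp: sN)
  have lim_dec: "(\<lambda>i. \<tau> (A i)) \<longlonglongrightarrow> \<tau> (\<Inter>i. A i)" if "range A \<subseteq> sets \<nu>" "decseq A" for A
    unfolding \<tau>_def using that
    by (intro tendsto_intros N.finite_Lim_measure_decseq \<nu>.finite_Lim_measure_decseq) (auto simp: sN)
  have Um: "\<tau> (U n) = m" for n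
  proof -
    have "(\<lambda>i. \<tau> (\<Union>j\<in>{n..n+i}. Z j)) \<longlonglongrightarrow> \<tau> (\<Union>i. \<Union>j\<in>{n..n+i}. Z j)"
    proof (rule lim_inc)
      show "range (\<lambda>i. \<Union>j\<in>{n..n+i}. Z j) \<subseteq> sets \<nu>" using fin by blast
      show "incseq (\<lambda>i. \<Union>j\<in>{n..n+i}. Z j)" unfolding incseq_def by fastforce
    qed
    moreover have "(\<Union>i. \<Union>j\<in>{n..n+i}. Z j) = U n"
    proof
      show "U n \<subseteq> (\<Union>i. \<Union>j\<in>{n..n+i}. Z j)"
      proof
        fix x assume "x \<in> U n"
        then obtain j where "j \<ge> n" "x \<in> Z j" by (auto simp: U_def)
        then show "x \<in> (\<Union>i. \<Union>j\<in>{n..n+i}. Z j)" by (intro UN_I[of j] UN_I[of j]) auto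
      qed
    qed (auto simp: U_def)
    ultimately show ?thesis using fin by (simp add: LIMSEQ_const_iff)
  qed
  define P where "P = (\<Inter>n. U n)"
  have Ps: "P \<in> sets \<nu>" unfolding P_def using Us by auto
  have dec: "decseq U" unfolding U_def decseq_def by fastforce
  have Pm: "\<tau> P = m"
    using lim_dec[OF _ dec] Us Um by (simp add: P_def LIMSEQ_const_iff image_subset_iff)
  have "S -` P \<inter> X = P"
  proof -
    have Z': "S -` Z n \<inter> X = Z (Suc n)" for n by (simp add: Z_def)
    have "S -` U n \<inter> X = (\<Union>j\<in>{n..}. S -` Z j \<inter> X)" for n unfolding U_def by auto
    moreover have "(\<Union>j\<in>{n..}. Z (Suc j)) = U (Suc n)" for n
    proof -
      have "{Suc n..} = Suc ` {n..}" 
      proof (intro equalityI subsetI)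
        fix x assume "x \<in> {Suc n..}"
        then have "x = Suc (x - 1)" "x - 1 \<in> {n..}" by auto
        then show "x \<in> Suc ` {n..}" by blast
      qed auto
      then show ?thesis by (simp add: U_def image_image)
    qed
    ultimately have SU: "S -` U n \<inter> X = U (Suc n)" for n by (simp add: Z')
    have "S -` P \<inter> X = (\<Inter>n. S -` U n \<inter> X)" unfolding P_def by auto
    also have "\<dots> = (\<Inter>n. U (Suc n))" by (simp only: SU)
    also have "\<dots> = P"
    proof
      show "(\<Inter>n. U (Suc n)) \<subseteq> P"
        unfolding P_def using dec by (fastforce simp: decseq_Suc_iff)
    qed (auto simp: P_def)
    finally show ?thesis .
  qed
  then have "measure \<nu> P = 0 \<or> measure \<nu> P = 1"
    using erg Ps by (simp add: ergodic_def X_def)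
  then have "m = 0"
  proof
    assume "measure \<nu> P = 0"
    then show "m = 0"
      using le[OF Ps] Pm by (simp add: \<tau>_def measure_le_0_iff)
  next
    assume 1: "measure \<nu> P = 1"
    then have "measure \<nu> (X - P) = 0"
      using \<nu>.prob_compl[OF Ps] by (simp add: X_def)
    then have "measure N (X - P) = 0"
      using le[of "X - P"] Ps by (simp add: X_def measure_le_0_iff)
    then have "measure N P = a"
      using N.finite_measure_compl[of P] Ps by (simp add: spN sN a_def)
    then show "m = 0" using Pm 1 by (simp add: \<tau>_def)
  qed
  have "\<tau> X = 0" by (simp add: \<tau>_def a_def X_def \<nu>.prob_space)
  moreover have "\<tau> X = \<tau> B + \<tau> (X - B)"
    using add[of B "X - B"] B sets.sets_into_space[OF B] by (simp add: X_def Un_absorb1)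
  moreover have "\<tau> B \<le> 0" "\<tau> (X - B) \<le> 0"
    using le_m \<open>m = 0\<close> B by (auto simp: X_def)
  ultimately have "\<tau> B = 0" by linarith
  then show ?thesis by (simp add: \<tau>_def a_def X_def)
qed

lemma tendsto_fun_coordinatewise:
  fixes x :: "nat \<Rightarrow> 'i \<Rightarrow> 'b::topological_space"
  assumes "\<And>i. (\<lambda>n. x n i) \<longlonglongrightarrow> l i"
  shows "x \<longlonglongrightarrow> l"
proof -
  have "limitin (product_topology (\<lambda>_. euclidean) UNIV) x l sequentially"
    unfolding limitin_componentwise using assms by simp
  then show ?thesis by (simp add: euclidean_product_topology)
qed

context circle_skew_product
begin

text \<open>
  The lifts of maximal exponent form a compact face of the convex set of lifts. The functional \<open>V\<close>
  is strictly convex and continuous, so a maximiser on this face is an extreme point of the set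
  of all lifts. Measures are represented by the sequences of their integrals.
\<close>

lemma exists_extremal_lift:
  assumes \<mu>_inv: "\<mu> \<in> invariant_prob_measures \<Omega> F"
  obtains M where "M \<in> lifts \<mu>" "fiber_exponent f M \<ge> 0"
    "\<And>M1 M2 a. M1 \<in> lifts \<mu> \<Longrightarrow> M2 \<in> lifts \<mu> \<Longrightarrow> 0 < a \<Longrightarrow> a < 1 \<Longrightarrow>
      (\<And>\<phi>. continuous_on \<Omega> \<phi> \<Longrightarrow>
        (\<integral>x. \<phi> x \<partial>M) = a * (\<integral>x. \<phi> x \<partial>M1) + (1 - a) * (\<integral>x. (\<phi> x :: real) \<partial>M2)) \<Longrightarrow> M1 = M2"
proof -
  have \<mu>l: "\<mu> \<in> lifts \<mu>" using \<mu>_inv by (simp add: lifts_def)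
  note \<mu> = liftsD(1,2)[OF \<mu>l]
  obtain \<phi> :: "nat \<Rightarrow> (int \<Rightarrow> nat) \<times> circle \<Rightarrow> real" where
    \<phi>: "\<And>n. continuous_on UNIV (\<phi> n)" "\<And>n x. \<phi> n x \<in> {0..1}"
    "separates_prob_measures \<phi>"
    using exists_countable_separating_family by blast
  \<comment> \<open>Index 0 carries the exponent, the other indices a family that separates measures.\<close>
  define \<psi> where "\<psi> n = (case n of 0 \<Rightarrow> log_deriv | Suc i \<Rightarrow> \<phi> i)" for n
  have \<psi>: "continuous_on \<Omega> (\<psi> n)" for n
    using continuous_on_log_deriv continuous_on_subset[OF \<phi>(1)]
    by (auto simp: \<psi>_def split: nat.split)
  define T where "T M = (\<lambda>n. \<integral>x. \<psi> n x \<partial>M)" for M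
  define C where "C = T ` lifts \<mu>"
  have T0: "T M 0 = fiber_exponent f M" for M
    by (simp add: T_def \<psi>_def fiber_exponent_eq)
  have T01: "T M (Suc n) \<in> {0..1}" if M: "M \<in> lifts \<mu>" for M n
  proof -
    interpret prob_space M using M by (rule liftsD)
    have "integrable M (\<phi> n)"
      using integrable_continuous[OF \<psi>[of "Suc n"] finite_measure_axioms liftsD(2)[OF M]]
      by (simp add: \<psi>_def)
    then have "(\<integral>x. \<phi> n x \<partial>M) \<le> (\<integral>x. 1 \<partial>M)"
      using \<phi>(2) by (intro integral_mono) auto
    moreover have "(\<integral>x. \<phi> n x \<partial>M) \<ge> 0"
      using \<phi>(2) by (intro integral_nonneg_AE) auto
    ultimately show ?thesis by (simp add: T_def \<psi>_def prob_space)
  qed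
  have "compact C"
    unfolding compact_eq_seq_compact_metric seq_compact_def
  proof (intro allI impI)
    fix t :: "nat \<Rightarrow> nat \<Rightarrow> real" assume "\<forall>n. t n \<in> C"
    then have "\<forall>n. \<exists>M. M \<in> lifts \<mu> \<and> t n = T M" by (auto simp: C_def)
    then obtain N where N: "\<And>n. N n \<in> lifts \<mu>" "\<And>n. t n = T (N n)" by metis
    obtain r M where r: "strict_mono (r :: nat \<Rightarrow> nat)" "M \<in> lifts \<mu>"
      "\<And>\<phi>. continuous_on \<Omega> \<phi> \<Longrightarrow> (\<lambda>n. \<integral>x. \<phi> x \<partial>N (r n)) \<longlonglongrightarrow> (\<integral>x. (\<phi> x :: real) \<partial>M)"
      using lifts_seq_compact[of \<mu> N, OF \<mu> N(1)] by blast
    have "(t \<circ> r) \<longlonglongrightarrow> T M"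
      by (rule tendsto_fun_coordinatewise) (simp add: N(2) T_def r(3)[OF \<psi>])
    then show "\<exists>l\<in>C. \<exists>r. strict_mono r \<and> (t \<circ> r) \<longlonglongrightarrow> l"
      using r unfolding C_def by blast
  qed
  have contc: "continuous_on S (\<lambda>t :: nat \<Rightarrow> real. t n)" for S n
    by (rule continuous_on_subset[OF continuous_on_product_coordinates]) simp
  have "C \<noteq> {}" using \<mu>l by (auto simp: C_def)
  then obtain t0 where t0: "t0 \<in> C" "\<And>t. t \<in> C \<Longrightarrow> t 0 \<le> t0 0"
    using continuous_attains_sup[OF \<open>compact C\<close> _ contc] by blast
  \<comment> \<open>The face of maximal exponent.\<close>
  define C1 where "C1 = C \<inter> {t. t 0 = t0 0}"
  have "closed {t :: nat \<Rightarrow> real. t 0 = t0 0}"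
    using closed_Collect_eq[OF contc[of UNIV] continuous_on_const] by simp
  then have "compact C1" unfolding C1_def using \<open>compact C\<close> by (rule compact_Int_closed[rotated])
  have "C1 \<noteq> {}" using t0(1) by (auto simp: C1_def)
  define V where "V t = (\<Sum>n. (1/2) ^ n * (t (Suc n))\<^sup>2)" for t :: "nat \<Rightarrow> real"
  have Vbound: "norm ((1/2) ^ n * (t (Suc n))\<^sup>2) \<le> (1/2) ^ n" if "t \<in> C" for t n
  proof -
    obtain M where "M \<in> lifts \<mu>" "t = T M" using \<open>t \<in> C\<close> by (auto simp: C_def)
    then have "0 \<le> t (Suc n)" "t (Suc n) \<le> 1" using T01[of M n] by auto
    then have "(t (Suc n))\<^sup>2 \<le> 1" by (rule power_le_one)
    then show ?thesis by (simp add: abs_mult mult_left_le)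
  qed
  have geo: "summable (\<lambda>n. (1/2 :: real) ^ n)" by (rule summable_geometric) simp
  have Vsum: "summable (\<lambda>n. (1/2) ^ n * (t (Suc n))\<^sup>2)" if "t \<in> C" for t
    using geo Vbound[OF that] by (rule summable_comparison_test'[where N = 0])
  have "continuous_on C V"
  proof -
    have "uniform_limit C (\<lambda>n t. \<Sum>i<n. (1/2) ^ i * (t (Suc i))\<^sup>2) V sequentially"
      unfolding V_def using Vbound geo by (rule Weierstrass_m_test)
    then show ?thesis
      by (rule uniform_limit_theorem[rotated])
        (auto intro!: always_eventually continuous_intros contc)
  qed
  then have "continuous_on C1 V" by (rule continuous_on_subset) (simp add: C1_def)
  then obtain t1 where t1: "t1 \<in> C1" "\<And>t. t \<in> C1 \<Longrightarrow> V t \<le> V t1"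
    using continuous_attains_sup[OF \<open>compact C1\<close> \<open>C1 \<noteq> {}\<close>] by blast
  obtain M where M: "M \<in> lifts \<mu>" "t1 = T M" using t1(1) by (auto simp: C1_def C_def)
  show ?thesis
  proof (rule that[OF M(1)])
    obtain M0 where "M0 \<in> lifts \<mu>" "fiber_exponent f M0 \<ge> 0"
      using exists_nonneg_lift[OF \<mu>_inv] .
    then show "fiber_exponent f M \<ge> 0"
      using t0(2)[of "T M0"] t1(1) M by (simp add: C1_def C_def T0)
    fix M1 M2 and a :: real
    assume M1: "M1 \<in> lifts \<mu>" and M2: "M2 \<in> lifts \<mu>" and a: "0 < a" "a < 1"
      and comb: "\<And>\<phi>. continuous_on \<Omega> \<phi> \<Longrightarrow>
        (\<integral>x. \<phi> x \<partial>M) = a * (\<integral>x. \<phi> x \<partial>M1) + (1 - a) * (\<integral>x. (\<phi> x :: real) \<partial>M2)"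
    have TM: "T M n = a * T M1 n + (1 - a) * T M2 n" for n
      unfolding T_def by (rule comb[OF \<psi>])
    have inC: "T M1 \<in> C" "T M2 \<in> C" "T M \<in> C" using M1 M2 M by (auto simp: C_def)
    have "T M 0 = t0 0" using t1(1) M by (simp add: C1_def)
    moreover have "a * T M1 0 \<le> a * t0 0" "(1 - a) * T M2 0 \<le> (1 - a) * t0 0"
      using a t0(2) inC by (auto intro!: mult_left_mono)
    moreover have "a * t0 0 + (1 - a) * t0 0 = t0 0" by (simp add: algebra_simps)
    ultimately have "a * T M1 0 = a * t0 0" "(1 - a) * T M2 0 = (1 - a) * t0 0"
      using TM[of 0] by linarith+
    then have "T M1 \<in> C1" "T M2 \<in> C1" using a inC by (auto simp: C1_def)
    then have "a * V (T M1) \<le> a * V (T M)" "(1 - a) * V (T M2) \<le> (1 - a) * V (T M)"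
      using t1(2) M(2) a by (auto intro!: mult_left_mono)
    then have le: "a * V (T M1) + (1 - a) * V (T M2) - V (T M) \<le> 0"
      by (simp add: algebra_simps)
    \<comment> \<open>The defect of convexity of the square, which vanishes only if the two arguments agree.\<close>
    define d where "d n = (1/2) ^ n * (a * (1 - a) * (T M1 (Suc n) - T M2 (Suc n))\<^sup>2)" for n
    have d_eq: "a * ((1/2) ^ n * (T M1 (Suc n))\<^sup>2) + (1 - a) * ((1/2) ^ n * (T M2 (Suc n))\<^sup>2)
        - (1/2) ^ n * (T M (Suc n))\<^sup>2 = d n" for n
      unfolding TM d_def by (simp add: power2_eq_square algebra_simps)
    have "(\<lambda>n. a * ((1/2) ^ n * (T M1 (Suc n))\<^sup>2) + (1 - a) * ((1/2) ^ n * (T M2 (Suc n))\<^sup>2)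
        - (1/2) ^ n * (T M (Suc n))\<^sup>2) sums (a * V (T M1) + (1 - a) * V (T M2) - V (T M))"
      unfolding V_def
      by (intro sums_diff sums_add sums_mult summable_sums Vsum inC)
    then have d: "d sums (a * V (T M1) + (1 - a) * V (T M2) - V (T M))"
      by (simp add: d_eq)
    have d0: "d n \<ge> 0" for n using a by (simp add: d_def)
    have "suminf d = 0"
      using d le suminf_nonneg[OF sums_summable[OF d] d0] by (simp add: sums_iff)
    then have "d n = 0" for n
      using suminf_eq_zero_iff[OF sums_summable[OF d] d0] by simp
    then have "T M1 (Suc n) = T M2 (Suc n)" for n
      using a by (simp add: d_def)
    then have eq: "\<forall>n. (\<integral>x. \<phi> n x \<partial>M1) = (\<integral>x. \<phi> n x \<partial>M2)"
      by (simp add: T_def \<psi>_def)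
    show "M1 = M2"
      using \<phi>(3)[unfolded separates_prob_measures_def, rule_format, of \<Omega> M1 M2]
        skew_space_borel[of k] liftsD(1,2)[OF M1] liftsD(1,2)[OF M2] eq by blast
  qed
qed

lemma measure_fst_vimage:
  assumes "sets M = sets (restrict_space borel \<Omega>)" "B \<in> sets borel"
  shows "fst -` B \<inter> \<Omega> \<in> sets M"
  using measurable_sets[OF measurable_fst_borel[OF assms(1)] assms(2)]
    space_of_sets_restrict_borel[OF assms(1)] by simp

lemma lifts_measure_fst:
  assumes "M \<in> lifts \<mu>" "sets \<mu> = sets (restrict_space borel \<Omega>)" "B \<in> sets borel"
  shows "measure M (fst -` B \<inter> \<Omega>) = measure \<mu> (fst -` B \<inter> \<Omega>)"
proof -
  have "measure (distr M borel fst) B = measure (distr \<mu> borel fst) B"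
    using liftsD(5)[OF assms(1)] by simp
  then show ?thesis
    using measure_distr[OF measurable_fst_borel[OF liftsD(2)[OF assms(1)]], of B]
      measure_distr[OF measurable_fst_borel[OF assms(2)], of B] assms(3)
    by (simp add: liftsD(3)[OF assms(1)] space_of_sets_restrict_borel[OF assms(2)])
qed

lemma invariant_measure_vimage:
  assumes "M \<in> lifts \<mu>" "B \<in> sets M"
  shows "measure M (F -` B \<inter> \<Omega>) = measure M B"
proof -
  have "measure (distr M M F) B = measure M (F -` B \<inter> \<Omega>)"
    using measure_distr[OF measurable_F[OF liftsD(2)[OF assms(1)]], of B] assms(2)
    by (simp add: liftsD(3)[OF assms(1)])
  then show ?thesis by (simp add: liftsD(4)[OF assms(1)])
qed

text \<open>
  If the base measure is ergodic, then every invariant set is independent of the base.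
\<close>

lemma ergodic_base_independent:
  assumes \<mu>_inv: "\<mu> \<in> invariant_prob_measures \<Omega> F" and erg: "ergodic F \<mu>"
    and M: "M \<in> lifts \<mu>" and A: "A \<in> sets M" "F -` A \<inter> \<Omega> = A" and B: "B \<in> sets borel"
  shows "measure M (A \<inter> (fst -` B \<inter> \<Omega>)) = measure M A * measure M (fst -` B \<inter> \<Omega>)"
proof -
  have \<mu>l: "\<mu> \<in> lifts \<mu>" using \<mu>_inv by (simp add: lifts_def)
  note D = liftsD[OF M] and D\<mu> = liftsD[OF \<mu>l]
  interpret M: prob_space M by (rule D)
  have AO: "A \<subseteq> \<Omega>" using A(2) by blast
  have fstM: "fst \<in> borel_measurable M" using D(2) by (rule measurable_fst_borel)
  define \<nu> where "\<nu> = distr M borel fst"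
  define N where "N = distr (density M (indicator A)) borel fst"
  have fstN: "fst \<in> borel_measurable (density M (indicator A))" using fstM by simp
  have m\<nu>: "measure \<nu> B = measure M (fst -` B \<inter> \<Omega>)" if "B \<in> sets borel" for B
    unfolding \<nu>_def using that fstM D(3) by (simp add: measure_distr)
  have mN: "measure N B = measure M (A \<inter> (fst -` B \<inter> \<Omega>))" if "B \<in> sets borel" for B
  proof -
    have s: "fst -` B \<inter> \<Omega> \<in> sets M" using that D(2) by (intro measure_fst_vimage)
    have "measure N B = measure (density M (indicator A)) (fst -` B \<inter> \<Omega>)"
      unfolding N_def using that fstN D(3) by (simp add: measure_distr)
    also have "\<dots> = measure M (A \<inter> (fst -` B \<inter> \<Omega>))"
      using emeasure_restricted[OF A(1) s] by (simp add: measure_def)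
    finally show ?thesis .
  qed
  have shift: "left_shift \<in> borel \<rightarrow>\<^sub>M borel"
    by (intro borel_measurable_continuous_onI continuous_on_left_shift)
  have pull: "F -` (fst -` B \<inter> \<Omega>) \<inter> \<Omega> = fst -` (left_shift -` B) \<inter> \<Omega>" for B
  proof (rule set_eqI)
    show "\<omega> \<in> F -` (fst -` B \<inter> \<Omega>) \<inter> \<Omega> \<longleftrightarrow> \<omega> \<in> fst -` (left_shift -` B) \<inter> \<Omega>" for \<omega>
      using F_in[of \<omega>] fst_F[of \<omega>] by auto
  qed
  have vB: "left_shift -` B \<in> sets borel" if "B \<in> sets borel" for B
    using measurable_sets[OF shift that] by simp
  have "measure N B = measure N (space \<nu>) * measure \<nu> B"
  proof (rule invariant_dominated_measure_proportional[where S = left_shift])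
    show "prob_space \<nu>" unfolding \<nu>_def using fstM by (rule M.prob_space_distr)
    show "finite_measure N"
    proof -
      have "emeasure (density M (indicator A)) \<Omega> = emeasure M (A \<inter> \<Omega>)"
        using emeasure_restricted[OF A(1), of \<Omega>] sets.top[of M] D(3) by simp
      then have "finite_measure (density M (indicator A))"
        by (intro finite_measureI) (simp add: D(3))
      then show ?thesis
        unfolding N_def using fstN by (rule finite_measure.finite_measure_distr)
    qed
    show "ergodic left_shift \<nu>"
      unfolding ergodic_def
    proof (intro ballI impI)
      fix C assume "C \<in> sets \<nu>" and C: "left_shift -` C \<inter> space \<nu> = C"
      then have Cb: "C \<in> sets borel" by (simp add: \<nu>_def)
      have "left_shift -` C = C" using C by (simp add: \<nu>_def)
      then have "F -` (fst -` C \<inter> \<Omega>) \<inter> space \<mu> = fst -` C \<inter> \<Omega>"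
        using pull[of C] by (simp add: D\<mu>(3))
      then have "measure \<mu> (fst -` C \<inter> \<Omega>) = 0 \<or> measure \<mu> (fst -` C \<inter> \<Omega>) = 1"
        using erg measure_fst_vimage[OF D\<mu>(2) Cb] by (simp add: ergodic_def)
      then show "measure \<nu> C = 0 \<or> measure \<nu> C = 1"
        using lifts_measure_fst[OF M D\<mu>(2) Cb] m\<nu>[OF Cb] by simp
    qed
    fix C assume "C \<in> sets \<nu>"
    then have C: "C \<in> sets borel" by (simp add: \<nu>_def)
    note sC = measure_fst_vimage[OF D(2) C]
    show "measure \<nu> (left_shift -` C \<inter> space \<nu>) = measure \<nu> C"
      using invariant_measure_vimage[OF M sC, unfolded pull] C vB[OF C] by (simp add: m\<nu> pull \<nu>_def[THEN arg_cong[where f = space]])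
    have "A \<inter> (fst -` (left_shift -` C) \<inter> \<Omega>) = F -` (A \<inter> (fst -` C \<inter> \<Omega>)) \<inter> \<Omega>"
      using A(2) pull[of C] by blast
    then show "measure N (left_shift -` C \<inter> space \<nu>) = measure N C"
      using invariant_measure_vimage[OF M, of "A \<inter> (fst -` C \<inter> \<Omega>)"] A(1) sC C vB[OF C]
      by (simp add: mN \<nu>_def[THEN arg_cong[where f = space]])
    show "measure N C \<le> measure \<nu> C"
      unfolding mN[OF C] m\<nu>[OF C] using sC by (intro M.finite_measure_mono) auto
  qed (use B shift in \<open>auto simp: \<nu>_def N_def\<close>)
  moreover have "measure N (space \<nu>) = measure M A"
    using mN[of UNIV] AO by (simp add: \<nu>_def Int_absorb2)
  ultimately show ?thesis using mN[OF B] m\<nu>[OF B] by simp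
qed

text \<open>
  Conditioning a lift on an invariant set gives a lift again, provided that the base is ergodic.
\<close>

lemma uniform_measure_lift:
  assumes \<mu>_inv: "\<mu> \<in> invariant_prob_measures \<Omega> F" and erg: "ergodic F \<mu>"
    and M: "M \<in> lifts \<mu>" and A: "A \<in> sets M" "F -` A \<inter> \<Omega> = A" "measure M A \<noteq> 0"
  shows "uniform_measure M A \<in> lifts \<mu>"
proof -
  have \<mu>l: "\<mu> \<in> lifts \<mu>" using \<mu>_inv by (simp add: lifts_def)
  note D = liftsD[OF M] and D\<mu> = liftsD[OF \<mu>l]
  interpret M: prob_space M by (rule D)
  interpret \<mu>: prob_space \<mu> by (rule D\<mu>)
  let ?U = "uniform_measure M A"
  have e: "emeasure M A \<noteq> 0" "emeasure M A \<noteq> \<infinity>"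
    using A(3) by (auto simp: M.emeasure_eq_measure)
  interpret U: prob_space ?U using e by (rule prob_space_uniform_measure)
  have sU: "sets ?U = sets M" by simp
  have F: "F \<in> ?U \<rightarrow>\<^sub>M ?U" using D(2) by (intro measurable_F) simp
  have fstU: "fst \<in> borel_measurable ?U" using D(2) by (intro measurable_fst_borel) simp
  have mU: "measure ?U B = measure M (A \<inter> B) / measure M A" if "B \<in> sets M" for B
    using e that by simp
  have "distr ?U ?U F = ?U"
  proof (rule measure_eqI)
    fix B assume "B \<in> sets (distr ?U ?U F)"
    then have B: "B \<in> sets M" by simp
    have FB: "F -` B \<inter> \<Omega> \<in> sets M" using measurable_sets[OF measurable_F[OF D(2)] B] D(3) by simp
    have "A \<inter> (F -` B \<inter> \<Omega>) = F -` (A \<inter> B) \<inter> \<Omega>" using A(2) by auto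
    then have "measure M (A \<inter> (F -` B \<inter> \<Omega>)) = measure M (A \<inter> B)"
      using invariant_measure_vimage[OF M, of "A \<inter> B"] A B by simp
    then have "measure ?U (F -` B \<inter> \<Omega>) = measure ?U B"
      using mU[OF B] mU[OF FB] by simp
    then show "emeasure (distr ?U ?U F) B = emeasure ?U B"
      using F B D(3) by (simp add: emeasure_distr U.emeasure_eq_measure del: emeasure_uniform_measure measure_uniform_measure)
  qed simp
  moreover have "distr ?U borel fst = distr \<mu> borel fst"
  proof (rule measure_eqI)
    fix B assume "B \<in> sets (distr ?U borel fst)"
    then have B: "B \<in> sets borel" by simp
    note sB = measure_fst_vimage[OF D(2) B]
    have "measure ?U (fst -` B \<inter> \<Omega>) = measure \<mu> (fst -` B \<inter> \<Omega>)"
      using mU[OF sB] ergodic_base_independent[OF \<mu>_inv erg M A(1,2) B] A(3)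
        lifts_measure_fst[OF M D\<mu>(2) B] by simp
    then show "emeasure (distr ?U borel fst) B = emeasure (distr \<mu> borel fst) B"
      using fstU measurable_fst_borel[OF D\<mu>(2)] B D(3) D\<mu>(3)
      by (simp add: emeasure_distr U.emeasure_eq_measure \<mu>.emeasure_eq_measure
          del: emeasure_uniform_measure measure_uniform_measure)
  qed simp
  ultimately show ?thesis
    using F U.prob_space_axioms D(2) by (simp add: lifts_def invariant_prob_measures_def)
qed

lemma integral_uniform_measure:
  fixes \<phi> :: "(int \<Rightarrow> nat) \<times> circle \<Rightarrow> real"
  assumes M: "prob_space M" and A: "A \<in> sets M" "measure M A \<noteq> 0" and \<phi>: "\<phi> \<in> borel_measurable M"
  shows "measure M A * (\<integral>x. \<phi> x \<partial>uniform_measure M A) = (\<integral>x. indicator A x * \<phi> x \<partial>M)"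
proof -
  interpret M: prob_space M by fact
  have "uniform_measure M A = density M (\<lambda>x. ennreal (indicator A x / measure M A))"
    unfolding uniform_measure_def
  proof (rule density_cong)
    have "indicator A x / emeasure M A = ennreal (indicator A x / measure M A)" for x
      using A(2) divide_ennreal[of 1 "measure M A"]
      by (simp add: M.emeasure_eq_measure indicator_def zero_less_measure_iff)
    then show "AE x in M. indicator A x / emeasure M A = ennreal (indicator A x / measure M A)" by simp
  qed (use A in auto)
  then have "(\<integral>x. \<phi> x \<partial>uniform_measure M A) = (\<integral>x. (indicator A x / measure M A) *\<^sub>R \<phi> x \<partial>M)"
    using A \<phi> by (simp only:) (subst integral_density; simp)
  also have "\<dots> = (\<integral>x. indicator A x * \<phi> x / measure M A \<partial>M)" by simp
  also have "\<dots> = (\<integral>x. indicator A x * \<phi> x \<partial>M) / measure M A" by simp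
  finally show ?thesis using A(2) by simp
qed

text \<open>
  A nontrivial invariant set would split the extremal lift into two distinct lifts.
\<close>

lemma exists_nonneg_lift_ergodic:
  assumes \<mu>_inv: "\<mu> \<in> invariant_prob_measures \<Omega> F"
  obtains M where "M \<in> lifts \<mu>" "fiber_exponent f M \<ge> 0" "ergodic F \<mu> \<Longrightarrow> ergodic F M"
proof -
  obtain M where M: "M \<in> lifts \<mu>" "fiber_exponent f M \<ge> 0"
    and ext: "\<And>M1 M2 a. M1 \<in> lifts \<mu> \<Longrightarrow> M2 \<in> lifts \<mu> \<Longrightarrow> 0 < a \<Longrightarrow> a < 1 \<Longrightarrow>
      (\<And>\<phi>. continuous_on \<Omega> \<phi> \<Longrightarrow>
        (\<integral>x. \<phi> x \<partial>M) = a * (\<integral>x. \<phi> x \<partial>M1) + (1 - a) * (\<integral>x. (\<phi> x :: real) \<partial>M2)) \<Longrightarrow> M1 = M2"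
    using exists_extremal_lift[OF \<mu>_inv] by blast
  note D = liftsD[OF M(1)]
  interpret M: prob_space M by (rule D)
  have "ergodic F M" if erg: "ergodic F \<mu>"
    unfolding ergodic_def
  proof (intro ballI impI, rule ccontr)
    fix A assume A: "A \<in> sets M" "F -` A \<inter> space M = A"
      and n: "\<not> (measure M A = 0 \<or> measure M A = 1)"
    define A' where "A' = \<Omega> - A"
    have A2: "F -` A \<inter> \<Omega> = A" using A(2) D(3) by simp
    have As: "A \<subseteq> \<Omega>" using A2 by blast
    have A': "A' \<in> sets M"
      using D(3) sets.compl_sets[OF A(1)] by (simp add: A'_def)
    have A'2: "F -` A' \<inter> \<Omega> = A'"
    proof (rule set_eqI)
      show "\<omega> \<in> F -` A' \<inter> \<Omega> \<longleftrightarrow> \<omega> \<in> A'" for \<omega>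
        using F_in[of \<omega>] A2 by (auto simp: A'_def)
    qed
    have mA': "measure M A' = 1 - measure M A"
      using M.prob_compl[OF A(1)] D(3) by (simp add: A'_def)
    have "0 < measure M A" "measure M A < 1"
      using n M.prob_le_1[of A] by (auto simp: zero_less_measure_iff less_le)
    moreover have "(\<integral>x. \<phi> x \<partial>M) = measure M A * (\<integral>x. \<phi> x \<partial>uniform_measure M A) +
        (1 - measure M A) * (\<integral>x. \<phi> x \<partial>uniform_measure M A')"
      if \<phi>: "continuous_on \<Omega> \<phi>" for \<phi> :: "(int \<Rightarrow> nat) \<times> circle \<Rightarrow> real"
    proof -
      have int: "integrable M \<phi>" by (rule integrable_continuous[OF \<phi> M.finite_measure_axioms D(2)])
      have m: "\<phi> \<in> borel_measurable M" using int by simp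
      have "(\<integral>x. \<phi> x \<partial>M) = (\<integral>x. indicator A x * \<phi> x + indicator A' x * \<phi> x \<partial>M)"
        by (rule Bochner_Integration.integral_cong) (auto simp: A'_def D(3) indicator_def)
      also have "\<dots> = (\<integral>x. indicator A x * \<phi> x \<partial>M) + (\<integral>x. indicator A' x * \<phi> x \<partial>M)"
        using integrable_mult_indicator[OF A(1) int] integrable_mult_indicator[OF A' int]
        by (intro Bochner_Integration.integral_add) simp_all
      also have "\<dots> = measure M A * (\<integral>x. \<phi> x \<partial>uniform_measure M A) +
        measure M A' * (\<integral>x. \<phi> x \<partial>uniform_measure M A')"
        using n mA' integral_uniform_measure[OF D(1) A(1) _ m] integral_uniform_measure[OF D(1) A' _ m]
        by simp
      finally show ?thesis by (simp add: mA')
    qed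
    moreover have "uniform_measure M A \<in> lifts \<mu>"
      using n by (intro uniform_measure_lift[OF \<mu>_inv erg M(1) A(1) A2]) simp
    moreover have "uniform_measure M A' \<in> lifts \<mu>"
      using n mA' by (intro uniform_measure_lift[OF \<mu>_inv erg M(1) A' A'2]) simp
    ultimately have eq: "uniform_measure M A = uniform_measure M A'"
      using ext by blast
    have "measure (uniform_measure M A) A = 1"
      using n A by (subst measure_uniform_measure) (auto simp: M.emeasure_eq_measure)
    moreover have disj: "A' \<inter> A = {}" by (auto simp: A'_def)
    moreover have "measure (uniform_measure M A') A = 0"
      using n A A' mA' by (subst measure_uniform_measure) (auto simp: M.emeasure_eq_measure disj)
    ultimately show False using eq by simp
  qed
  with M show ?thesis by (rule that)
qed

end

section \<open>Entropy of finite-valued functions\<close>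

text \<open>
  The Shannon entropy of the partition of the space into the level sets of \<open>X\<close>, in nats.
\<close>

definition fn_entropy :: "'a measure \<Rightarrow> ('a \<Rightarrow> 'b) \<Rightarrow> real" where
  "fn_entropy M X = - (\<Sum>v\<in>X ` space M.
     measure M (X -` {v} \<inter> space M) * ln (measure M (X -` {v} \<inter> space M)))"

text \<open>
  Refinement of partitions is expressed by saying that equal values of \<open>X\<close> force equal values of \<open>Y\<close>.
\<close>

lemma factors_through:
  assumes det: "\<And>\<omega> \<omega>'. \<omega> \<in> S \<Longrightarrow> \<omega>' \<in> S \<Longrightarrow> X \<omega> = X \<omega>' \<Longrightarrow> Y \<omega> = Y \<omega>'"
  obtains g where "\<And>\<omega>. \<omega> \<in> S \<Longrightarrow> Y \<omega> = (g \<circ> X) \<omega>"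
proof -
  define g where "g v = Y (SOME \<omega>. \<omega> \<in> S \<and> X \<omega> = v)" for v
  have "Y \<omega> = (g \<circ> X) \<omega>" if "\<omega> \<in> S" for \<omega>
  proof -
    have "(SOME \<omega>'. \<omega>' \<in> S \<and> X \<omega>' = X \<omega>) \<in> S \<and> X (SOME \<omega>'. \<omega>' \<in> S \<and> X \<omega>' = X \<omega>) = X \<omega>"
      by (rule someI[of _ \<omega>]) (use that in simp)
    then show ?thesis
      unfolding g_def comp_def using that by (metis det)
  qed
  then show ?thesis by (rule that)
qed

lemma simple_function_determined:
  assumes X: "simple_function M X"
    and det: "\<And>\<omega> \<omega>'. \<omega> \<in> space M \<Longrightarrow> \<omega>' \<in> space M \<Longrightarrow> X \<omega> = X \<omega>' \<Longrightarrow> Y \<omega> = Y \<omega>'"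
  shows "simple_function M Y"
proof -
  obtain g where g: "\<And>\<omega>. \<omega> \<in> space M \<Longrightarrow> Y \<omega> = (g \<circ> X) \<omega>"
    using factors_through[of "space M" X Y] det by blast
  then show ?thesis
    using simple_function_compose[OF X, of g] simple_function_cong[of M Y "g \<circ> X"] by blast
qed

lemma fn_entropy_cong:
  assumes "\<And>\<omega>. \<omega> \<in> space M \<Longrightarrow> X \<omega> = Y \<omega>"
  shows "fn_entropy M X = fn_entropy M Y"
proof -
  have "X ` space M = Y ` space M" using assms by (intro image_cong) auto
  moreover have "X -` {v} \<inter> space M = Y -` {v} \<inter> space M" for v using assms by auto
  ultimately show ?thesis by (simp add: fn_entropy_def)
qed

context prob_space
begin

lemma fn_entropy_nonneg: "fn_entropy M X \<ge> 0"
proof -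
  have "measure M A * ln (measure M A) \<le> 0" for A
  proof (cases "measure M A = 0")
    case False
    then have "0 < measure M A" by (simp add: zero_less_measure_iff)
    then show ?thesis by (simp add: mult_nonneg_nonpos)
  qed simp
  then show ?thesis by (simp add: fn_entropy_def sum_nonpos)
qed

lemma information_space_exp: "information_space M (exp 1)"
  by unfold_locales simp

lemma fn_entropy_eq:
  assumes "simple_function M X"
  shows "fn_entropy M X = entropy (exp 1) (count_space (X ` space M)) X"
proof -
  interpret information_space M "exp 1" by (rule information_space_exp)
  have "ln x = log (exp 1) x" for x :: real by (simp add: log_def)
  then show ?thesis
    unfolding fn_entropy_def
    by (subst entropy_simple_distributed[OF simple_distributedI[OF assms measure_nonneg refl]]) simp
qed

lemma fn_entropy_pair_le:
  assumes X: "simple_function M X" and Y: "simple_function M Y"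
  shows "fn_entropy M (\<lambda>\<omega>. (X \<omega>, Y \<omega>)) \<le> fn_entropy M X + fn_entropy M Y"
proof -
  interpret information_space M "exp 1" by (rule information_space_exp)
  show ?thesis
    using entropy_chain_rule[OF X Y] conditional_entropy_less_eq_entropy[OF Y X]
    by (simp add: fn_entropy_eq X Y simple_function_Pair)
qed

lemma fn_entropy_mono:
  assumes X: "simple_function M X"
    and det: "\<And>\<omega> \<omega>'. \<omega> \<in> space M \<Longrightarrow> \<omega>' \<in> space M \<Longrightarrow> X \<omega> = X \<omega>' \<Longrightarrow> Y \<omega> = Y \<omega>'"
  shows "fn_entropy M Y \<le> fn_entropy M X"
proof -
  interpret information_space M "exp 1" by (rule information_space_exp)
  obtain g where g: "\<And>\<omega>. \<omega> \<in> space M \<Longrightarrow> Y \<omega> = (g \<circ> X) \<omega>"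
    using factors_through[of "space M" X Y] det by blast
  have "fn_entropy M Y = fn_entropy M (g \<circ> X)"
    using g by (rule fn_entropy_cong)
  also have "\<dots> \<le> fn_entropy M X"
    using entropy_data_processing[OF X, of g]
    by (simp add: fn_entropy_eq X simple_function_compose)
  finally show ?thesis .
qed

lemma fn_entropy_eqI:
  assumes X: "simple_function M X"
    and det: "\<And>\<omega> \<omega>'. \<omega> \<in> space M \<Longrightarrow> \<omega>' \<in> space M \<Longrightarrow> X \<omega> = X \<omega>' \<longleftrightarrow> Y \<omega> = Y \<omega>'"
  shows "fn_entropy M Y = fn_entropy M X"
proof (rule antisym)
  show "fn_entropy M Y \<le> fn_entropy M X" using X by (rule fn_entropy_mono) (simp add: det)
  have "simple_function M Y" using X by (rule simple_function_determined) (simp add: det)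
  then show "fn_entropy M X \<le> fn_entropy M Y" by (rule fn_entropy_mono) (simp add: det)
qed

lemma fn_entropy_le_card:
  assumes X: "simple_function M X" and c: "card (X ` space M) \<le> L"
  shows "fn_entropy M X \<le> ln (real L)"
proof -
  interpret information_space M "exp 1" by (rule information_space_exp)
  have "fn_entropy M X \<le> ln (real (card (X ` space M)))"
    using entropy_le_card[OF simple_distributedI[OF X measure_nonneg refl]]
    by (simp add: fn_entropy_eq X log_def)
  also have "\<dots> \<le> ln (real L)"
  proof -
    have "card (X ` space M) > 0"
      using simple_functionD(1)[OF X] not_empty by (simp add: card_gt_0_iff)
    then show ?thesis using c by simp
  qed
  finally show ?thesis .
qed

text \<open>
  The bound is proved by enumerating, for every value of \<open>X\<close>, the at most \<open>L\<close> possible values of \<open>Y\<close>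
  by numbers less than \<open>L\<close>.
\<close>

lemma fn_entropy_pair_le_card:
  assumes X: "simple_function M X" and Y: "simple_function M Y"
    and L: "\<And>v. v \<in> X ` space M \<Longrightarrow> card (Y ` (X -` {v} \<inter> space M)) \<le> L"
  shows "fn_entropy M (\<lambda>\<omega>. (X \<omega>, Y \<omega>)) \<le> fn_entropy M X + ln (real L)"
proof -
  let ?R = "\<lambda>v. Y ` (X -` {v} \<inter> space M)"
  have fin: "finite (?R v)" for v
    using simple_functionD(1)[OF Y] by (rule finite_subset[rotated]) auto
  have "\<exists>e. bij_betw e (?R v) {0..<card (?R v)}" for v
    using fin by (rule ex_bij_betw_finite_nat)
  then obtain e where e: "\<And>v. bij_betw (e v) (?R v) {0..<card (?R v)}" by metis
  define Z where "Z \<omega> = e (X \<omega>) (Y \<omega>)" for \<omega>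
  have XY: "simple_function M (\<lambda>\<omega>. (X \<omega>, Y \<omega>))" using X Y by (rule simple_function_Pair)
  have Z: "simple_function M Z"
    using XY by (rule simple_function_determined) (simp add: Z_def)
  have XZ: "simple_function M (\<lambda>\<omega>. (X \<omega>, Z \<omega>))" using X Z by (rule simple_function_Pair)
  have "fn_entropy M (\<lambda>\<omega>. (X \<omega>, Y \<omega>)) \<le> fn_entropy M (\<lambda>\<omega>. (X \<omega>, Z \<omega>))"
    using XZ
  proof (rule fn_entropy_mono)
    fix \<omega> \<omega>' assume \<omega>: "\<omega> \<in> space M" "\<omega>' \<in> space M" and "(X \<omega>, Z \<omega>) = (X \<omega>', Z \<omega>')"
    then have "X \<omega>' = X \<omega>" "e (X \<omega>) (Y \<omega>) = e (X \<omega>) (Y \<omega>')" by (auto simp: Z_def)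
    moreover from this \<omega> have "Y \<omega> \<in> ?R (X \<omega>)" "Y \<omega>' \<in> ?R (X \<omega>)" by auto
    ultimately show "(X \<omega>, Y \<omega>) = (X \<omega>', Y \<omega>')"
      using bij_betw_imp_inj_on[OF e[of "X \<omega>"]] by (metis inj_onD)
  qed
  also have "\<dots> \<le> fn_entropy M X + fn_entropy M Z" using X Z by (rule fn_entropy_pair_le)
  also have "fn_entropy M Z \<le> ln (real L)"
  proof (rule fn_entropy_le_card[OF Z])
    have "Z ` space M \<subseteq> {0..<L}"
    proof (rule image_subsetI)
      fix \<omega> assume \<omega>: "\<omega> \<in> space M"
      then have "Y \<omega> \<in> ?R (X \<omega>)" by auto
      then have "Z \<omega> \<in> {0..<card (?R (X \<omega>))}"
        unfolding Z_def using e[of "X \<omega>"] by (rule bij_betwE[rule_format, rotated])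
      then show "Z \<omega> \<in> {0..<L}" using L[of "X \<omega>"] \<omega> by auto
    qed
    then show "card (Z ` space M) \<le> L"
      using card_mono[of "{0..<L}" "Z ` space M"] by simp
  qed
  finally show ?thesis by simp
qed

lemma
  fixes E :: "'i \<Rightarrow> 'a \<Rightarrow> bool"
  assumes "finite I" "\<And>i. i \<in> I \<Longrightarrow> simple_function M (E i)"
  shows simple_function_family: "simple_function M (\<lambda>\<omega> i. i \<in> I \<and> E i \<omega>)"
    and fn_entropy_family_le: "fn_entropy M (\<lambda>\<omega> i. i \<in> I \<and> E i \<omega>) \<le> (\<Sum>i\<in>I. fn_entropy M (E i))"
proof -
  have "simple_function M (\<lambda>\<omega> i. i \<in> I \<and> E i \<omega>) \<and>
      fn_entropy M (\<lambda>\<omega> i. i \<in> I \<and> E i \<omega>) \<le> (\<Sum>i\<in>I. fn_entropy M (E i))"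
    using assms
  proof (induction I rule: finite_induct)
    case empty
    have "card ((\<lambda>\<omega> i. i \<in> {} \<and> E i \<omega>) ` space M) \<le> 1"
      using card_mono[of "{\<lambda>i. False}" "(\<lambda>\<omega> i. i \<in> {} \<and> E i \<omega>) ` space M"] by auto
    moreover have "simple_function M (\<lambda>\<omega> i. i \<in> {} \<and> E i \<omega>)" by simp
    ultimately show ?case using fn_entropy_le_card[of "\<lambda>\<omega> i. i \<in> {} \<and> E i \<omega>" 1] by simp
  next
    case (insert j I)
    let ?G = "\<lambda>\<omega> i. i \<in> I \<and> E i \<omega>" and ?G' = "\<lambda>\<omega> i. i \<in> insert j I \<and> E i \<omega>"
    have Ej: "simple_function M (E j)" using insert.prems by simp
    have G: "simple_function M ?G" "fn_entropy M ?G \<le> (\<Sum>i\<in>I. fn_entropy M (E i))"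
      using insert.IH insert.prems by auto
    have P: "simple_function M (\<lambda>\<omega>. (?G \<omega>, E j \<omega>))" using G(1) Ej by (rule simple_function_Pair)
    have det: "?G' \<omega> = ?G' \<omega>'" if "(?G \<omega>, E j \<omega>) = (?G \<omega>', E j \<omega>')" for \<omega> \<omega>'
    proof (rule ext)
      fix i
      have "(i \<in> I \<and> E i \<omega>) = (i \<in> I \<and> E i \<omega>')" "E j \<omega> = E j \<omega>'"
        using that by (auto dest: fun_cong[of _ _ i])
      then show "?G' \<omega> i = ?G' \<omega>' i" by auto
    qed
    have "fn_entropy M ?G' \<le> fn_entropy M (\<lambda>\<omega>. (?G \<omega>, E j \<omega>))"
      using P by (rule fn_entropy_mono) (rule det)
    also have "\<dots> \<le> fn_entropy M ?G + fn_entropy M (E j)" using G(1) Ej by (rule fn_entropy_pair_le)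
    also have "\<dots> \<le> (\<Sum>i\<in>insert j I. fn_entropy M (E i))" using G(2) insert.hyps by simp
    finally have "fn_entropy M ?G' \<le> (\<Sum>i\<in>insert j I. fn_entropy M (E i))" .
    moreover have "simple_function M ?G'"
      using P by (rule simple_function_determined) (rule det)
    ultimately show ?case by blast
  qed
  then show "simple_function M (\<lambda>\<omega> i. i \<in> I \<and> E i \<omega>)"
    "fn_entropy M (\<lambda>\<omega> i. i \<in> I \<and> E i \<omega>) \<le> (\<Sum>i\<in>I. fn_entropy M (E i))" by auto
qed

end

text \<open>
  The values of \<open>X\<close> along the first \<open>n\<close> points of the orbit; its level sets are the atoms of the
  iterated join.
\<close>

definition itinerary :: "('a \<Rightarrow> 'a) \<Rightarrow> ('a \<Rightarrow> 'b) \<Rightarrow> nat \<Rightarrow> 'a \<Rightarrow> 'b list" where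
  "itinerary T X n \<omega> = map (\<lambda>j. X ((T ^^ j) \<omega>)) [0..<n]"

lemma itinerary_eq_iff:
  "itinerary T X n \<omega> = itinerary T X n \<omega>' \<longleftrightarrow> (\<forall>j<n. X ((T ^^ j) \<omega>) = X ((T ^^ j) \<omega>'))"
  by (auto simp: itinerary_def)

lemma (in prob_space) fn_entropy_measure_preserving:
  assumes T: "T \<in> M \<rightarrow>\<^sub>M M" "distr M M T = M" and X: "simple_function M X"
  shows "simple_function M (\<lambda>\<omega>. X (T \<omega>))" "fn_entropy M (\<lambda>\<omega>. X (T \<omega>)) = fn_entropy M X"
proof -
  let ?Y = "\<lambda>\<omega>. X (T \<omega>)"
  have sp: "T \<omega> \<in> space M" if "\<omega> \<in> space M" for \<omega> using T(1) that by (rule measurable_space)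
  have im: "?Y ` space M \<subseteq> X ` space M" using sp by auto
  have vim: "?Y -` {v} \<inter> space M = T -` (X -` {v} \<inter> space M) \<inter> space M" for v using sp by auto
  have Xs: "X -` {v} \<inter> space M \<in> sets M" for v using X by (rule simple_functionD)
  show "simple_function M ?Y"
    unfolding simple_function_def
  proof (intro conjI ballI)
    show "finite (?Y ` space M)" using im simple_functionD(1)[OF X] by (rule finite_subset)
    show "?Y -` {v} \<inter> space M \<in> sets M" for v
      unfolding vim using T(1) Xs by (rule measurable_sets)
  qed
  have m: "measure M (?Y -` {v} \<inter> space M) = measure M (X -` {v} \<inter> space M)" for v
    unfolding vim using measure_distr[OF T(1) Xs] T(2) by simp
  have "(\<Sum>v\<in>?Y ` space M. measure M (X -` {v} \<inter> space M) * ln (measure M (X -` {v} \<inter> space M)))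
      = (\<Sum>v\<in>X ` space M. measure M (X -` {v} \<inter> space M) * ln (measure M (X -` {v} \<inter> space M)))"
  proof (rule sum.mono_neutral_left[OF simple_functionD(1)[OF X] im], intro ballI)
    fix v assume "v \<in> X ` space M - ?Y ` space M"
    then have "?Y -` {v} \<inter> space M = {}" by blast
    then have "measure M (X -` {v} \<inter> space M) = 0" using m[of v] by simp
    then show "measure M (X -` {v} \<inter> space M) * ln (measure M (X -` {v} \<inter> space M)) = 0" by simp
  qed
  then show "fn_entropy M ?Y = fn_entropy M X"
    by (simp add: fn_entropy_def m)
qed

text \<open>
  Fekete's lemma.
\<close>

lemma subadditive_converges:
  fixes a :: "nat \<Rightarrow> real"
  assumes nonneg: "\<And>n. a n \<ge> 0" and sub: "\<And>m n. a (m + n) \<le> a m + a n"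
  shows "convergent (\<lambda>n. a n / real n)"
proof -
  define l where "l = Inf ((\<lambda>n. a n / real n) ` {1..})"
  have bdd: "bdd_below ((\<lambda>n. a n / real n) ` {1..})"
    using nonneg by (intro bdd_belowI[of _ 0]) auto
  have l_le: "l \<le> a n / real n" if "n \<ge> 1" for n
    unfolding l_def using bdd that by (intro cInf_lower) auto
  have mult: "a (q * m + r) \<le> real q * a m + a r" for q m r
  proof (induction q)
    case (Suc q)
    have "a (Suc q * m + r) \<le> a m + a (q * m + r)"
      using sub[of m "q * m + r"] by (simp add: add_ac)
    with Suc show ?case by (simp add: algebra_simps)
  qed simp
  have "(\<lambda>n. a n / real n) \<longlonglongrightarrow> l"
  proof (rule LIMSEQ_I)
    fix e :: real assume e: "e > 0"
    have "\<exists>x\<in>(\<lambda>n. a n / real n) ` {1..}. x < l + e / 2"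
      using e unfolding l_def by (intro cInf_lessD) auto
    then obtain m where m: "m \<ge> 1" "a m / real m < l + e / 2" by auto
    define B where "B = (\<Sum>r<m. a r)"
    have B: "a r \<le> B" if "r < m" for r
      unfolding B_def using that nonneg by (intro member_le_sum) auto
    obtain N :: nat where N: "2 * B / e < real N" using reals_Archimedean2 by blast
    have "\<bar>a n / real n - l\<bar> < e" if n: "n \<ge> max N 1" for n
    proof -
      have n0: "real n > 0" using n by simp
      let ?q = "n div m" and ?r = "n mod m"
      have "a n \<le> real ?q * a m + a ?r" using mult[of ?q m ?r] by simp
      also have "a ?r \<le> B" using m(1) by (intro B) simp
      also have "real ?q * a m \<le> (real n / real m) * a m"
        using nonneg by (intro mult_right_mono) (auto simp: of_nat_div_le_of_nat)
      finally have "a n \<le> real n * (a m / real m) + B" by simp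
      then have "a n / real n \<le> (real n * (a m / real m) + B) / real n"
        using n0 by (intro divide_right_mono) auto
      also have "\<dots> = a m / real m + B / real n" using n0 by (simp add: add_divide_distrib)
      also have "B / real n < e / 2"
      proof -
        have "2 * B / e < real n" using N n by linarith
        then show ?thesis using e n0 by (simp add: field_simps)
      qed
      finally have "a n / real n < l + e" using m(2) by linarith
      moreover have "l \<le> a n / real n" using n by (intro l_le) simp
      ultimately show ?thesis using e by linarith
    qed
    then show "\<exists>N. \<forall>n\<ge>N. norm (a n / real n - l) < e" by (auto intro!: exI[of _ "max N 1"])
  qed
  then show ?thesis by (rule convergentI)
qed

lemma measure_preserving_funpow:
  assumes T: "T \<in> M \<rightarrow>\<^sub>M M" "distr M M T = M"
  shows "T ^^ n \<in> M \<rightarrow>\<^sub>M M" "distr M M (T ^^ n) = M"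
proof -
  have "T ^^ n \<in> M \<rightarrow>\<^sub>M M \<and> distr M M (T ^^ n) = M"
  proof (induction n)
    case 0
    then show ?case by (simp add: id_def distr_id2)
  next
    case (Suc n)
    then have "distr M M (T \<circ> (T ^^ n)) = distr (distr M M (T ^^ n)) M T"
      using T by (intro distr_distr[symmetric]) auto
    also have "\<dots> = M" using Suc T(2) by simp
    finally have "distr M M (T \<circ> (T ^^ n)) = M" .
    moreover have "T \<circ> (T ^^ n) \<in> M \<rightarrow>\<^sub>M M"
      using Suc T(1) by (auto intro: measurable_comp)
    ultimately show ?case by (simp only: funpow.simps)
  qed
  then show "T ^^ n \<in> M \<rightarrow>\<^sub>M M" "distr M M (T ^^ n) = M" by auto
qed

text \<open>
  A probability space with a measure preserving map, not assumed invertible.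
\<close>

locale measure_preserving = prob_space M for M :: "'a measure" +
  fixes T :: "'a \<Rightarrow> 'a"
  assumes T_meas: "T \<in> M \<rightarrow>\<^sub>M M" and T_inv: "distr M M T = M"
begin

lemmas T_pow_meas = measure_preserving_funpow(1)[OF T_meas T_inv]
lemmas T_pow_inv = measure_preserving_funpow(2)[OF T_meas T_inv]

lemma T_pow_space: "\<omega> \<in> space M \<Longrightarrow> (T ^^ n) \<omega> \<in> space M"
  using T_pow_meas by (rule measurable_space)

lemma
  assumes X: "simple_function M X"
  shows simple_itinerary: "simple_function M (itinerary T X n)"
    and fn_entropy_itinerary_le: "fn_entropy M (itinerary T X n) \<le> real n * fn_entropy M X"
proof -
  have "simple_function M (itinerary T X n) \<and> fn_entropy M (itinerary T X n) \<le> real n * fn_entropy M X"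
  proof (induction n)
    case 0
    have "simple_function M (itinerary T X 0)" by (simp add: itinerary_def[abs_def])
    moreover have "card (itinerary T X 0 ` space M) \<le> 1"
      using card_mono[of "{[]}" "itinerary T X 0 ` space M"] by (auto simp: itinerary_def)
    ultimately show ?case using fn_entropy_le_card[of "itinerary T X 0" 1] by simp
  next
    case (Suc n)
    let ?Y = "\<lambda>\<omega>. X ((T ^^ n) \<omega>)"
    note Y = fn_entropy_measure_preserving[OF T_pow_meas T_pow_inv X, of n]
    have P: "simple_function M (\<lambda>\<omega>. (itinerary T X n \<omega>, ?Y \<omega>))"
      using Suc Y(1) by (intro simple_function_Pair) auto
    have det: "itinerary T X (Suc n) \<omega> = itinerary T X (Suc n) \<omega>'"
      if "(itinerary T X n \<omega>, ?Y \<omega>) = (itinerary T X n \<omega>', ?Y \<omega>')" for \<omega> \<omega>'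
      using that by (auto simp: itinerary_eq_iff less_Suc_eq)
    have "fn_entropy M (itinerary T X (Suc n)) \<le> fn_entropy M (\<lambda>\<omega>. (itinerary T X n \<omega>, ?Y \<omega>))"
      using P by (rule fn_entropy_mono) (rule det)
    also have "\<dots> \<le> fn_entropy M (itinerary T X n) + fn_entropy M ?Y"
      using Suc Y(1) by (intro fn_entropy_pair_le) auto
    also have "\<dots> \<le> real (Suc n) * fn_entropy M X"
      using Suc Y(2) by (simp add: algebra_simps)
    finally have "fn_entropy M (itinerary T X (Suc n)) \<le> real (Suc n) * fn_entropy M X" .
    moreover have "simple_function M (itinerary T X (Suc n))"
      using P by (rule simple_function_determined) (rule det)
    ultimately show ?case by blast
  qed
  then show "simple_function M (itinerary T X n)"
    "fn_entropy M (itinerary T X n) \<le> real n * fn_entropy M X" by auto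
qed

lemma convergent_fn_entropy_itinerary:
  assumes X: "simple_function M X"
  shows "convergent (\<lambda>n. fn_entropy M (itinerary T X n) / real n)"
proof (rule subadditive_converges)
  fix m n
  let ?Y = "\<lambda>\<omega>. itinerary T X n ((T ^^ m) \<omega>)"
  note Y = fn_entropy_measure_preserving[OF T_pow_meas T_pow_inv simple_itinerary[OF X, of n], of m]
  have P: "simple_function M (\<lambda>\<omega>. (itinerary T X m \<omega>, ?Y \<omega>))"
    using simple_itinerary[OF X] Y(1) by (intro simple_function_Pair) auto
  have det: "itinerary T X (m + n) \<omega> = itinerary T X (m + n) \<omega>'"
    if e: "(itinerary T X m \<omega>, ?Y \<omega>) = (itinerary T X m \<omega>', ?Y \<omega>')" for \<omega> \<omega>'
    unfolding itinerary_eq_iff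
  proof (intro allI impI)
    fix j assume j: "j < m + n"
    show "X ((T ^^ j) \<omega>) = X ((T ^^ j) \<omega>')"
    proof (cases "j < m")
      case True
      then show ?thesis using e by (simp add: itinerary_eq_iff)
    next
      case False
      then have "(T ^^ j) \<omega> = (T ^^ (j - m)) ((T ^^ m) \<omega>)" for \<omega>
        by (metis add.commute comp_apply funpow_add le_add_diff_inverse not_less)
      moreover have "j - m < n" using j False by simp
      ultimately show ?thesis using e by (simp add: itinerary_eq_iff)
    qed
  qed
  have "fn_entropy M (itinerary T X (m + n)) \<le> fn_entropy M (\<lambda>\<omega>. (itinerary T X m \<omega>, ?Y \<omega>))"
    using P by (rule fn_entropy_mono) (rule det)
  also have "\<dots> \<le> fn_entropy M (itinerary T X m) + fn_entropy M ?Y"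
    using simple_itinerary[OF X] Y(1) by (intro fn_entropy_pair_le) auto
  finally show "fn_entropy M (itinerary T X (m + n)) \<le>
      fn_entropy M (itinerary T X m) + fn_entropy M (itinerary T X n)"
    using Y(2) by simp
qed (rule fn_entropy_nonneg)

text \<open>
  The element of the partition \<open>P\<close> that contains the point.
\<close>

definition atom :: "'a set set \<Rightarrow> 'a \<Rightarrow> 'a set" where
  "atom P \<omega> = \<Union>{A \<in> P. \<omega> \<in> A}"

lemma
  assumes P: "finite_measurable_partition M P"
  shows atom_eq: "A \<in> P \<Longrightarrow> \<omega> \<in> A \<Longrightarrow> atom P \<omega> = A"
    and atom_in: "\<omega> \<in> space M \<Longrightarrow> atom P \<omega> \<in> P \<and> \<omega> \<in> atom P \<omega>"
    and simple_atom: "simple_function M (atom P)"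
    and atom_eq_iff: "\<omega> \<in> space M \<Longrightarrow> \<omega>' \<in> space M \<Longrightarrow>
      atom P \<omega> = atom P \<omega>' \<longleftrightarrow> (\<forall>A\<in>P. \<omega> \<in> A \<longleftrightarrow> \<omega>' \<in> A)"
proof -
  have fin: "finite P" and sub: "P \<subseteq> sets M" and part: "\<Union>P = space M"
    and disj: "\<And>A B. A \<in> P \<Longrightarrow> B \<in> P \<Longrightarrow> A \<noteq> B \<Longrightarrow> A \<inter> B = {}"
    using P by (auto simp: finite_measurable_partition_def partition_on_def disjoint_def)
  show eq: "atom P \<omega> = A" if "A \<in> P" "\<omega> \<in> A" for A \<omega>
  proof -
    have "{B \<in> P. \<omega> \<in> B} = {A}" using that disj by blast
    then show ?thesis by (simp add: atom_def)
  qed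
  show in': "atom P \<omega> \<in> P \<and> \<omega> \<in> atom P \<omega>" if "\<omega> \<in> space M" for \<omega>
  proof -
    have "\<omega> \<in> \<Union>P" using that by (simp only: part)
    then obtain A where A: "A \<in> P" "\<omega> \<in> A" by (rule UnionE)
    show ?thesis unfolding eq[OF A] using A by (rule conjI)
  qed
  show "simple_function M (atom P)"
    unfolding simple_function_def
  proof (intro conjI ballI)
    show "finite (atom P ` space M)" using in' by (intro finite_subset[OF _ fin]) auto
    fix A assume "A \<in> atom P ` space M"
    then have A: "A \<in> P" using in' by auto
    have "atom P -` {A} \<inter> space M = A"
      using A in' eq part by auto
    then show "atom P -` {A} \<inter> space M \<in> sets M" using A sub by auto
  qed
  show "atom P \<omega> = atom P \<omega>' \<longleftrightarrow> (\<forall>A\<in>P. \<omega> \<in> A \<longleftrightarrow> \<omega>' \<in> A)"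
    if "\<omega> \<in> space M" "\<omega>' \<in> space M" for \<omega> \<omega>'
  proof
    assume e: "atom P \<omega> = atom P \<omega>'"
    show "\<forall>A\<in>P. \<omega> \<in> A \<longleftrightarrow> \<omega>' \<in> A"
    proof
      fix A assume "A \<in> P"
      then show "\<omega> \<in> A \<longleftrightarrow> \<omega>' \<in> A"
        using eq[of A \<omega>] eq[of A \<omega>'] in'[OF that(1)] in'[OF that(2)] e by auto
    qed
  next
    assume "\<forall>A\<in>P. \<omega> \<in> A \<longleftrightarrow> \<omega>' \<in> A"
    then have "\<omega>' \<in> atom P \<omega>" using in'[OF that(1)] by blast
    then show "atom P \<omega> = atom P \<omega>'" using eq[of "atom P \<omega>" \<omega>'] in'[OF that(1)] by simp
  qed
qed

lemma partition_entropy_iterated_join: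
  assumes P: "finite_measurable_partition M P"
  shows "partition_entropy M (iterated_join T M P n) = fn_entropy M (itinerary T (atom P) n)"
proof -
  let ?Y = "itinerary T (atom P) n" and ?c = "\<lambda>v. itinerary T (atom P) n -` {v} \<inter> space M"
  have mem: "(T ^^ i) \<omega> \<in> A \<longleftrightarrow> atom P ((T ^^ i) \<omega>) = A" if "A \<in> P" "\<omega> \<in> space M" for A \<omega> i
    using that atom_eq[OF P, of A "(T ^^ i) \<omega>"] atom_in[OF P T_pow_space[OF that(2)], of i] by auto
  have "iterated_join T M P n = ?c ` (?Y ` space M)"
  proof (intro equalityI subsetI)
    fix B assume "B \<in> iterated_join T M P n"
    then obtain A where A: "\<forall>i<n. A i \<in> P" "B = space M \<inter> (\<Inter>i<n. (T ^^ i) -` A i)" "B \<noteq> {}"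
      by (auto simp: iterated_join_def)
    then obtain \<omega> where \<omega>: "\<omega> \<in> B" by blast
    have \<omega>s: "\<omega> \<in> space M" using \<omega> A(2) by auto
    have "B = ?c (?Y \<omega>)"
    proof (rule set_eqI)
      fix \<omega>'
      have "\<omega>' \<in> B \<longleftrightarrow> \<omega>' \<in> space M \<and> (\<forall>i<n. (T ^^ i) \<omega>' \<in> A i)" using A(2) by auto
      also have "\<dots> \<longleftrightarrow> \<omega>' \<in> space M \<and> (\<forall>i<n. atom P ((T ^^ i) \<omega>') = atom P ((T ^^ i) \<omega>))"
        using mem A \<omega> \<omega>s by (auto simp: mem)
      also have "\<dots> \<longleftrightarrow> \<omega>' \<in> ?c (?Y \<omega>)" by (auto simp: itinerary_eq_iff)
      finally show "\<omega>' \<in> B \<longleftrightarrow> \<omega>' \<in> ?c (?Y \<omega>)" .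
    qed
    then show "B \<in> ?c ` (?Y ` space M)" using \<omega>s by blast
  next
    fix B assume "B \<in> ?c ` (?Y ` space M)"
    then obtain \<omega> where \<omega>: "\<omega> \<in> space M" "B = ?c (?Y \<omega>)" by auto
    have "B = space M \<inter> (\<Inter>i<n. (T ^^ i) -` atom P ((T ^^ i) \<omega>))"
    proof (rule set_eqI)
      fix \<omega>'
      have "\<omega>' \<in> B \<longleftrightarrow> \<omega>' \<in> space M \<and> (\<forall>i<n. atom P ((T ^^ i) \<omega>') = atom P ((T ^^ i) \<omega>))"
        using \<omega> by (auto simp: itinerary_eq_iff)
      also have "\<dots> \<longleftrightarrow> \<omega>' \<in> space M \<and> (\<forall>i<n. (T ^^ i) \<omega>' \<in> atom P ((T ^^ i) \<omega>))"
        using mem atom_in[OF P T_pow_space[OF \<omega>(1)]] by auto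
      finally show "\<omega>' \<in> B \<longleftrightarrow> \<omega>' \<in> space M \<inter> (\<Inter>i<n. (T ^^ i) -` atom P ((T ^^ i) \<omega>))" by auto
    qed
    moreover have at: "\<forall>i<n. atom P ((T ^^ i) \<omega>) \<in> P" using atom_in[OF P T_pow_space[OF \<omega>(1)]] by simp
    ultimately have "B \<in> {space M \<inter> (\<Inter>i<n. (T ^^ i) -` A i) |A. \<forall>i<n. A i \<in> P}"
      by (intro CollectI exI[of _ "\<lambda>i. atom P ((T ^^ i) \<omega>)"] conjI)
    moreover have "\<omega> \<in> B" using \<omega> by simp
    ultimately show "B \<in> iterated_join T M P n" unfolding iterated_join_def by (intro DiffI) auto
  qed
  moreover have "inj_on ?c (?Y ` space M)"
  proof (rule inj_onI)
    fix v w assume "v \<in> ?Y ` space M" "?c v = ?c w"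
    then obtain \<omega> where "\<omega> \<in> space M" "?Y \<omega> = v" by auto
    then have "\<omega> \<in> ?c w" using \<open>?c v = ?c w\<close> by blast
    then show "v = w" using \<open>?Y \<omega> = v\<close> by simp
  qed
  ultimately show ?thesis
    unfolding partition_entropy_def fn_entropy_def by (simp add: sum.reindex)
qed

lemma entropy_wrt_partition_limit:
  assumes P: "finite_measurable_partition M P"
  shows "(\<lambda>n. fn_entropy M (itinerary T (atom P) n) / real n) \<longlonglongrightarrow> entropy_wrt_partition T M P"
  using convergent_fn_entropy_itinerary[OF simple_atom[OF P]]
  unfolding entropy_wrt_partition_def partition_entropy_iterated_join[OF P]
  by (simp add: convergent_LIMSEQ_iff)

end

text \<open>
  Events of small probability have small entropy; this rests on \<open>- p ln p \<le> 2 sqrt p\<close>.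
\<close>

lemma binary_entropy_small:
  assumes "e > 0"
  obtains d :: real where "d > 0"
    "\<And>M E. prob_space M \<Longrightarrow> simple_function M E \<Longrightarrow> measure M {\<omega> \<in> space M. E \<omega>} < d \<Longrightarrow>
      fn_entropy M (E :: 'a \<Rightarrow> bool) \<le> e"
proof -
  define b where "b p = - (p * ln p) - (1 - p) * ln (1 - p)" for p :: real
  define d0 where "d0 = min 1 ((e / 3)\<^sup>2)"
  have d0: "d0 > 0" using assms by (simp add: d0_def)
  have b_le: "b p \<le> e" if p: "0 < p" "p < d0" for p
  proof -
    have p1: "p < 1" and pe: "p < (e / 3)\<^sup>2" using p by (auto simp: d0_def)
    have sq: "sqrt p > 0" "sqrt p * sqrt p = p" using p by auto
    have "ln (1 / sqrt p) \<le> 1 / sqrt p - 1"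
      using sq by (intro ln_le_minus_one) simp
    also have "ln (1 / sqrt p) = - (ln p / 2)"
      using p by (simp add: ln_div ln_sqrt)
    finally have "- ln p \<le> 2 / sqrt p" by simp
    then have "p * - ln p \<le> p * (2 / sqrt p)" using p by (intro mult_left_mono) auto
    also have "\<dots> = 2 * sqrt p" using sq by (simp add: field_simps)
    finally have 1: "- (p * ln p) \<le> 2 * sqrt p" by simp
    have "ln (1 / (1 - p)) \<le> 1 / (1 - p) - 1"
      using p1 by (intro ln_le_minus_one) simp
    then have "- ln (1 - p) \<le> p / (1 - p)" using p1 by (simp add: ln_div field_simps)
    then have "(1 - p) * - ln (1 - p) \<le> (1 - p) * (p / (1 - p))"
      using p1 by (intro mult_left_mono) auto
    also have "\<dots> = p" using p1 by simp
    finally have 2: "- ((1 - p) * ln (1 - p)) \<le> p" by simp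
    have "p \<le> sqrt p"
      using p p1 by (intro real_le_rsqrt) (simp add: power2_eq_square mult_left_le)
    moreover have "sqrt p < e / 3"
      using pe assms by (intro real_less_lsqrt) auto
    ultimately show ?thesis using 1 2 by (simp add: b_def)
  qed
  show ?thesis
  proof (rule that[OF d0])
    fix M :: "'a measure" and E
    assume M: "prob_space M" and E: "simple_function M E"
      and small: "measure M {\<omega> \<in> space M. E \<omega>} < d0"
    interpret prob_space M by fact
    let ?f = "\<lambda>v. measure M (E -` {v} \<inter> space M) * ln (measure M (E -` {v} \<inter> space M))"
    define p where "p = measure M (E -` {True} \<inter> space M)"
    have ET: "E -` {True} \<inter> space M = {\<omega> \<in> space M. E \<omega>}" by auto
    have "E -` {False} \<inter> space M = space M - (E -` {True} \<inter> space M)" by auto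
    then have F: "measure M (E -` {False} \<inter> space M) = 1 - p"
      using prob_compl[of "E -` {True} \<inter> space M"] simple_functionD(2)[OF E] by (simp add: p_def)
    have "(\<Sum>v\<in>E ` space M. ?f v) = (\<Sum>v\<in>UNIV. ?f v)"
    proof (rule sum.mono_neutral_left)
      show "\<forall>v\<in>UNIV - E ` space M. ?f v = 0"
      proof
        fix v assume "v \<in> UNIV - E ` space M"
        then have "E -` {v} \<inter> space M = {}" by auto
        then show "?f v = 0" by simp
      qed
    qed auto
    then have "fn_entropy M E = b p"
      using F by (simp add: fn_entropy_def UNIV_bool b_def p_def)
    moreover have "b p \<le> e"
    proof (cases "p = 0")
      case True
      then show ?thesis using assms by (simp add: b_def)
    next
      case False
      then have "0 < p" by (simp add: p_def zero_less_measure_iff)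
      moreover have "p < d0" using small by (simp add: p_def ET)
      ultimately show ?thesis by (rule b_le)
    qed
    ultimately show "fn_entropy M E \<le> e" by simp
  qed
qed

section \<open>Entropy of a lift is determined by the base measure\<close>

text \<open>
  A connected set without dyadic points of level \<open>m\<close> lies in a single dyadic arc.
\<close>

lemma level_constant_on_connected:
  assumes S: "connected S" and nonint: "\<And>x. x \<in> S \<Longrightarrow> 2 ^ m * circle_coord x \<notin> \<int>"
    and x: "x \<in> S" and y: "y \<in> S"
  shows "\<lfloor>2 ^ m * circle_coord x\<rfloor> = \<lfloor>2 ^ m * circle_coord y\<rfloor>"
proof -
  define arc where "arc i = circle_of ` {t. of_int i < 2 ^ m * t \<and> 2 ^ m * t < of_int i + 1}" for i :: int
  have "open {t :: real. of_int i < 2 ^ m * t \<and> 2 ^ m * t < of_int i + 1}" for i :: int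
    by (intro open_Collect_conj open_Collect_less continuous_intros)
  then have arc_open: "open (arc i)" for i
    unfolding arc_def by (rule open_circle_of_image)
  have arc_floor: "\<lfloor>2 ^ m * circle_coord z\<rfloor> = i" if "0 \<le> i" "i < 2 ^ m" "z \<in> arc i" for i z
  proof -
    obtain t where t: "z = circle_of t" "of_int i < 2 ^ m * t" "2 ^ m * t < of_int i + 1"
      using \<open>z \<in> arc i\<close> by (auto simp: arc_def)
    have "0 < 2 ^ m * t" using t(2) \<open>0 \<le> i\<close> by (smt (verit) of_int_0_le_iff)
    then have "0 \<le> t" by (simp add: zero_less_mult_iff)
    have "of_int i + 1 \<le> (2 ^ m :: real)"
    proof -
      have "i + 1 \<le> 2 ^ m" using that by simp
      then have "of_int (i + 1) \<le> (of_int (2 ^ m) :: real)" by (simp only: of_int_le_iff)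
      then show ?thesis by simp
    qed
    then have "2 ^ m * t < 2 ^ m * 1" using t(3) by linarith
    then have "t < 1" by (rule mult_left_less_imp_less) simp
    with \<open>0 \<le> t\<close> have "circle_coord z = t" by (simp add: t(1) circle_coord_of)
    then show ?thesis using t by (simp add: floor_eq_iff)
  qed
  have in_arc: "z \<in> arc \<lfloor>2 ^ m * circle_coord z\<rfloor>" if "z \<in> S" for z
  proof -
    have "of_int \<lfloor>2 ^ m * circle_coord z\<rfloor> \<noteq> 2 ^ m * circle_coord z"
      using nonint[OF that] by (metis Ints_of_int)
    then have "of_int \<lfloor>2 ^ m * circle_coord z\<rfloor> < 2 ^ m * circle_coord z" by linarith
    then show ?thesis
      unfolding arc_def by (intro image_eqI[of _ _ "circle_coord z"]) auto
  qed
  have range: "0 \<le> \<lfloor>2 ^ m * circle_coord z\<rfloor>" "\<lfloor>2 ^ m * circle_coord z\<rfloor> < 2 ^ m" for z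
  proof -
    have "2 ^ m * circle_coord z < 2 ^ m * 1" by (intro mult_strict_left_mono) auto
    then show "\<lfloor>2 ^ m * circle_coord z\<rfloor> < 2 ^ m" by (simp add: floor_less_iff)
  qed simp
  define i where "i = \<lfloor>2 ^ m * circle_coord x\<rfloor>"
  define V where "V = (\<Union>j\<in>{0..<2 ^ m} - {i}. arc j)"
  have i: "0 \<le> i" "i < 2 ^ m" using range[of x] by (auto simp: i_def)
  show ?thesis
  proof (rule ccontr)
    assume ne: "\<lfloor>2 ^ m * circle_coord x\<rfloor> \<noteq> \<lfloor>2 ^ m * circle_coord y\<rfloor>"
    have "arc i \<inter> S = {} \<or> V \<inter> S = {}"
    proof (rule connectedD[OF S arc_open])
      show "open V" unfolding V_def using arc_open by auto
      have "z \<notin> V" if "z \<in> arc i" for z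
        using arc_floor[OF i that] arc_floor[of _ z] by (auto simp: V_def)
      then show "arc i \<inter> V \<inter> S = {}" by blast
      show "S \<subseteq> arc i \<union> V"
      proof
        fix z assume "z \<in> S"
        then show "z \<in> arc i \<union> V"
          using in_arc[of z] range[of z] by (cases "\<lfloor>2 ^ m * circle_coord z\<rfloor> = i") (auto simp: V_def)
      qed
    qed
    moreover have "x \<in> arc i" using in_arc[OF x] by (simp add: i_def)
    moreover have "y \<in> V"
      using in_arc[OF y] range[of y] ne by (auto simp: V_def i_def)
    ultimately show False using x y by blast
  qed
qed

text \<open>
  The symbols of the base point at the places in \<open>I\<close>, set to \<open>0\<close> elsewhere.
\<close>

definition window :: "int set \<Rightarrow> (int \<Rightarrow> nat) \<times> circle \<Rightarrow> int \<Rightarrow> nat" where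
  "window I \<omega> = (\<lambda>i. if i \<in> I then fst \<omega> i else 0)"

text \<open>
  The index of the dyadic arc of length \<open>2\<^sup>-\<^sup>m\<close> that contains the fiber coordinate.
\<close>

definition level :: "nat \<Rightarrow> (int \<Rightarrow> nat) \<times> circle \<Rightarrow> int" where
  "level m \<omega> = \<lfloor>2 ^ m * circle_coord (snd \<omega>)\<rfloor>"

text \<open>
  The element containing \<open>\<omega>\<close> of the partition into products of a central cylinder with a dyadic arc.
  These partitions refine one another, and the elements containing a given point shrink to it.
\<close>

definition cyl_box :: "nat \<Rightarrow> (int \<Rightarrow> nat) \<times> circle \<Rightarrow> (int \<Rightarrow> nat) \<times> int" where
  "cyl_box m \<omega> = (window {- int m..int m} \<omega>, level m \<omega>)"

lemma window_eq_iff: "window I \<omega> = window I \<omega>' \<longleftrightarrow> (\<forall>i\<in>I. fst \<omega> i = fst \<omega>' i)"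
  unfolding window_def fun_eq_iff by auto

lemma level_refine:
  assumes "level (Suc m) \<omega> = level (Suc m) \<omega>'"
  shows "level m \<omega> = level m \<omega>'"
proof -
  have "level m \<omega> = level (Suc m) \<omega> div 2" for \<omega>
    using floor_divide_real_eq_div[of 2 "2 ^ Suc m * circle_coord (snd \<omega>)"] by (simp add: level_def)
  then show ?thesis using assms by simp
qed

lemma box_refine:
  assumes "m \<le> m'" "cyl_box m' \<omega> = cyl_box m' \<omega>'"
  shows "cyl_box m \<omega> = cyl_box m \<omega>'"
  using assms(1)
proof (rule inc_induct)
  fix l assume "cyl_box (Suc l) \<omega> = cyl_box (Suc l) \<omega>'"
  then show "cyl_box l \<omega> = cyl_box l \<omega>'"
    by (auto simp: cyl_box_def window_eq_iff dest: level_refine)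
qed (rule assms(2))

lemma box_shrinks:
  assumes U: "open U" "\<omega> \<in> U"
  shows "\<exists>m. \<forall>\<omega>'. cyl_box m \<omega>' = cyl_box m \<omega> \<longrightarrow> \<omega>' \<in> U"
proof (rule ccontr)
  assume "\<not> ?thesis"
  then obtain w where w: "\<And>m. cyl_box m (w m) = cyl_box m \<omega>" "\<And>m. w m \<notin> U" by metis
  have "(\<lambda>m. fst (w m)) \<longlonglongrightarrow> fst \<omega>"
  proof (rule tendsto_fun_coordinatewise)
    fix i
    have "\<forall>\<^sub>F m in sequentially. fst (w m) i = fst \<omega> i"
      using eventually_ge_at_top[of "nat \<bar>i\<bar>"]
    proof eventually_elim
      case (elim m)
      then have "i \<in> {- int m..int m}" by auto
      then show ?case using w(1)[of m] by (simp add: cyl_box_def window_eq_iff)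
    qed
    then show "(\<lambda>m. fst (w m) i) \<longlonglongrightarrow> fst \<omega> i" by (rule tendsto_eventually)
  qed
  moreover have "(\<lambda>m. snd (w m)) \<longlonglongrightarrow> snd \<omega>"
  proof (rule metric_tendsto_imp_tendsto[where f = "\<lambda>m. (1/2 :: real) ^ m" and a = 0])
    show "(\<lambda>m. (1/2 :: real) ^ m) \<longlonglongrightarrow> 0" by (rule LIMSEQ_power_zero) simp
    have "dist (snd (w m)) (snd \<omega>) \<le> (1/2) ^ m" for m
    proof -
      let ?s = "circle_coord (snd (w m))" and ?t = "circle_coord (snd \<omega>)"
      have "level m (w m) = level m \<omega>" using w(1)[of m] by (simp add: cyl_box_def)
      then have "\<bar>2 ^ m * ?s - 2 ^ m * ?t\<bar> \<le> 1" unfolding level_def by linarith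
      then have "2 ^ m * \<bar>?s - ?t\<bar> \<le> 1"
        by (simp add: abs_mult flip: right_diff_distrib)
      then have "\<bar>?s - ?t\<bar> \<le> (1/2) ^ m" by (simp add: field_simps power_one_over)
      then show ?thesis
        using dist_circle_of_le_abs[of ?s ?t] by simp
    qed
    then show "\<forall>\<^sub>F m in sequentially. dist (snd (w m)) (snd \<omega>) \<le> dist ((1/2 :: real) ^ m) 0" by simp
  qed
  ultimately have "(\<lambda>m. (fst (w m), snd (w m))) \<longlonglongrightarrow> (fst \<omega>, snd \<omega>)" by (rule tendsto_Pair)
  then have "w \<longlonglongrightarrow> \<omega>" by simp
  then have "\<forall>\<^sub>F m in sequentially. w m \<in> U" using U by (rule topological_tendstoD)
  then show False using w(2) by simp
qed

text \<open>
  The pseudometric on measurable sets given by the measure of the symmetric difference.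
\<close>

definition sym_diff_measure :: "'a measure \<Rightarrow> 'a set \<Rightarrow> 'a set \<Rightarrow> real" where
  "sym_diff_measure M A B = measure M ((A - B) \<union> (B - A))"

lemma (in finite_measure) sym_diff_measure_triangle:
  assumes "A \<in> sets M" "B \<in> sets M" "C \<in> sets M"
  shows "sym_diff_measure M A C \<le> sym_diff_measure M A B + sym_diff_measure M B C"
proof -
  have "measure M ((A - C) \<union> (C - A)) \<le> measure M (((A - B) \<union> (B - A)) \<union> ((B - C) \<union> (C - B)))"
    using assms by (intro finite_measure_mono) auto
  also have "\<dots> \<le> measure M ((A - B) \<union> (B - A)) + measure M ((B - C) \<union> (C - B))"
    using assms by (intro measure_Un_le) auto
  finally show ?thesis by (simp add: sym_diff_measure_def)
qed

lemma (in finite_measure) sym_diff_measure_Un: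
  assumes "A \<in> sets M" "B \<in> sets M" "A' \<in> sets M" "B' \<in> sets M"
  shows "sym_diff_measure M (A \<union> B) (A' \<union> B') \<le> sym_diff_measure M A A' + sym_diff_measure M B B'"
proof -
  have "measure M ((A \<union> B - (A' \<union> B')) \<union> (A' \<union> B' - (A \<union> B)))
      \<le> measure M (((A - A') \<union> (A' - A)) \<union> ((B - B') \<union> (B' - B)))"
    using assms by (intro finite_measure_mono) auto
  also have "\<dots> \<le> measure M ((A - A') \<union> (A' - A)) + measure M ((B - B') \<union> (B' - B))"
    using assms by (intro measure_Un_le) auto
  finally show ?thesis by (simp add: sym_diff_measure_def)
qed

lemma (in finite_measure) sym_diff_measure_incseq:
  assumes A: "range A \<subseteq> sets M" "incseq A" and e: "e > 0"
  shows "\<exists>n. sym_diff_measure M (A n) (\<Union>i. A i) < e"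
proof -
  have As: "A n \<in> sets M" for n using A by auto
  then have U: "(\<Union>i. A i) \<in> sets M" by auto
  have "(\<lambda>n. measure M (A n)) \<longlonglongrightarrow> measure M (\<Union>i. A i)"
    using A by (rule finite_Lim_measure_incseq)
  then have "\<forall>\<^sub>F n in sequentially. dist (measure M (A n)) (measure M (\<Union>i. A i)) < e"
    using e by (rule tendstoD)
  then obtain n where n: "dist (measure M (A n)) (measure M (\<Union>i. A i)) < e"
    using eventually_happens trivial_limit_sequentially by blast
  have "(A n - (\<Union>i. A i)) \<union> ((\<Union>i. A i) - A n) = (\<Union>i. A i) - A n" by auto
  moreover have "measure M ((\<Union>i. A i) - A n) = measure M (\<Union>i. A i) - measure M (A n)"
    using As U by (intro finite_measure_Diff) auto
  ultimately show ?thesis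
    using n by (intro exI[of _ n]) (auto simp: sym_diff_measure_def dist_real_def)
qed

context circle_skew_product
begin

lemma simple_window:
  assumes M: "sets M = sets (restrict_space borel \<Omega>)" and "finite I"
  shows "simple_function M (window I)"
proof -
  have sp: "space M = \<Omega>" using M by (rule space_of_sets_restrict_borel)
  have fstM: "fst \<in> borel_measurable M" using M by (rule measurable_fst_borel)
  have "{\<omega> \<in> space M. fst \<omega> i = a} \<in> sets M" for i a
  proof -
    have "(\<lambda>\<omega>. fst \<omega> i) \<in> borel_measurable M"
      by (rule measurable_compose[OF fstM measurable_product_coordinates])
    then have "(\<lambda>\<omega>. fst \<omega> i) -` {a} \<inter> space M \<in> sets M"
      by (rule measurable_sets) simp
    moreover have "(\<lambda>\<omega>. fst \<omega> i) -` {a} \<inter> space M = {\<omega> \<in> space M. fst \<omega> i = a}" by auto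
    ultimately show ?thesis by simp
  qed
  then have cyl: "{\<omega> \<in> space M. \<forall>i\<in>I. fst \<omega> i = v i} \<in> sets M" for v
    using \<open>finite I\<close> by (intro sets.sets_Collect_finite_All) auto
  show ?thesis
    unfolding simple_function_def
  proof (intro conjI ballI)
    have "window I ` space M \<subseteq> {g. \<forall>i. (i \<in> I \<longrightarrow> g i \<in> {..<k}) \<and> (i \<notin> I \<longrightarrow> g i = 0)}"
      by (auto simp: sp window_def skew_space_def shift_space_def)
    moreover have "finite {g. \<forall>i. (i \<in> I \<longrightarrow> g i \<in> {..<k}) \<and> (i \<notin> I \<longrightarrow> g i = 0)}"
      using \<open>finite I\<close> by (intro finite_set_of_finite_funs) auto
    ultimately show "finite (window I ` space M)" by (rule finite_subset)
    fix v assume "v \<in> window I ` space M"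
    then obtain \<eta> where \<eta>: "v = window I \<eta>" by blast
    then have "v i = fst \<eta> i" if "i \<in> I" for i using that by (simp add: window_def)
    then have "window I -` {v} \<inter> space M = {\<omega> \<in> space M. \<forall>i\<in>I. fst \<omega> i = v i}"
      unfolding \<eta> by (intro set_eqI) (simp add: window_eq_iff conj_commute)
    then show "window I -` {v} \<inter> space M \<in> sets M" using cyl by simp
  qed
qed

lemma level_bounds: "0 \<le> level m \<omega>" "level m \<omega> < 2 ^ m"
proof -
  have "2 ^ m * circle_coord (snd \<omega>) < 2 ^ m * 1" by (intro mult_strict_left_mono) auto
  then show "level m \<omega> < 2 ^ m" by (simp add: level_def floor_less_iff)
qed (simp add: level_def)

lemma simple_level:
  assumes M: "sets M = sets (restrict_space borel \<Omega>)"
  shows "simple_function M (level m)"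
  unfolding simple_function_def
proof (intro conjI ballI)
  have "level m ` space M \<subseteq> {0..<2 ^ m}" using level_bounds by auto
  then show "finite (level m ` space M)" by (rule finite_subset) simp
  have "snd \<in> borel_measurable M"
    using M by (rule borel_measurable_restrictI) (auto intro: continuous_intros)
  then have [measurable]: "(\<lambda>\<omega>. circle_coord (snd \<omega>)) \<in> borel_measurable M"
    using borel_measurable_circle_coord by (rule measurable_compose)
  have "{\<omega> \<in> space M. \<lfloor>2 ^ m * circle_coord (snd \<omega>)\<rfloor> = v} \<in> sets M" for v
    by measurable
  moreover have "level m -` {v} \<inter> space M = {\<omega> \<in> space M. \<lfloor>2 ^ m * circle_coord (snd \<omega>)\<rfloor> = v}" for v
    by (auto simp: level_def)
  ultimately show "level m -` {v} \<inter> space M \<in> sets M" for v by simp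
qed

lemma simple_box: "sets M = sets (restrict_space borel \<Omega>) \<Longrightarrow> simple_function M (cyl_box m)"
  unfolding cyl_box_def by (intro simple_function_Pair simple_window simple_level) auto

lemma box_vimage_sets:
  assumes "sets M = sets (restrict_space borel \<Omega>)"
  shows "cyl_box m -` S \<inter> \<Omega> \<in> sets M"
  using simple_functionD(2)[OF simple_box[OF assms]] space_of_sets_restrict_borel[OF assms] by metis

lemma box_vimage_refine:
  assumes "m \<le> m'"
  shows "\<exists>S'. cyl_box m -` S \<inter> \<Omega> = cyl_box m' -` S' \<inter> \<Omega>"
proof
  show "cyl_box m -` S \<inter> \<Omega> = cyl_box m' -` (cyl_box m' ` (cyl_box m -` S \<inter> \<Omega>)) \<inter> \<Omega>"
  proof (intro equalityI subsetI)
    fix \<omega> assume "\<omega> \<in> cyl_box m' -` (cyl_box m' ` (cyl_box m -` S \<inter> \<Omega>)) \<inter> \<Omega>"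
    then obtain \<eta> where "cyl_box m' \<omega> = cyl_box m' \<eta>" "cyl_box m \<eta> \<in> S" "\<omega> \<in> \<Omega>" by blast
    moreover from this have "cyl_box m \<omega> = cyl_box m \<eta>" using box_refine[OF assms] by blast
    ultimately show "\<omega> \<in> cyl_box m -` S \<inter> \<Omega>" by simp
  qed simp
qed

text \<open>
  Approximable in measure by unions of boxes of some level.
\<close>

definition box_approximable :: "((int \<Rightarrow> nat) \<times> circle) measure \<Rightarrow> ((int \<Rightarrow> nat) \<times> circle) set \<Rightarrow> bool" where
  "box_approximable M A \<longleftrightarrow> (\<forall>e>0. \<exists>m S. sym_diff_measure M (cyl_box m -` S \<inter> \<Omega>) A < e)"

lemma box_approximable_limit:
  assumes "finite_measure M" and M: "sets M = sets (restrict_space borel \<Omega>)" and A: "A \<in> sets M"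
    and B: "\<And>e. e > 0 \<Longrightarrow> \<exists>B\<in>sets M. box_approximable M B \<and> sym_diff_measure M B A < e"
  shows "box_approximable M A"
  unfolding box_approximable_def
proof (intro allI impI)
  interpret finite_measure M by fact
  fix e :: real assume "e > 0"
  then obtain B where B: "B \<in> sets M" "box_approximable M B" "sym_diff_measure M B A < e / 2"
    using B[of "e / 2"] by auto
  then obtain m S where S: "sym_diff_measure M (cyl_box m -` S \<inter> \<Omega>) B < e / 2"
    using \<open>e > 0\<close> unfolding box_approximable_def by (meson half_gt_zero)
  have "sym_diff_measure M (cyl_box m -` S \<inter> \<Omega>) A < e"
    using sym_diff_measure_triangle[OF box_vimage_sets[OF M, of m S] B(1) A] S B(3) by linarith
  then show "\<exists>m S. sym_diff_measure M (cyl_box m -` S \<inter> \<Omega>) A < e" by blast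
qed

lemma box_approximable_Un:
  assumes "finite_measure M" and M: "sets M = sets (restrict_space borel \<Omega>)"
    and A: "A \<in> sets M" "box_approximable M A" and B: "B \<in> sets M" "box_approximable M B"
  shows "box_approximable M (A \<union> B)"
  unfolding box_approximable_def
proof (intro allI impI)
  interpret finite_measure M by fact
  fix e :: real assume "e > 0"
  then obtain m S m' S' where S: "sym_diff_measure M (cyl_box m -` S \<inter> \<Omega>) A < e / 2"
    "sym_diff_measure M (cyl_box m' -` S' \<inter> \<Omega>) B < e / 2"
    using A(2) B(2) unfolding box_approximable_def by (meson half_gt_zero)
  define l where "l = max m m'"
  obtain R R' where R: "cyl_box m -` S \<inter> \<Omega> = cyl_box l -` R \<inter> \<Omega>" "cyl_box m' -` S' \<inter> \<Omega> = cyl_box l -` R' \<inter> \<Omega>"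
    using box_vimage_refine[of m l S] box_vimage_refine[of m' l S'] by (auto simp: l_def)
  have "cyl_box l -` (R \<union> R') \<inter> \<Omega> = (cyl_box l -` R \<inter> \<Omega>) \<union> (cyl_box l -` R' \<inter> \<Omega>)" by auto
  then have "sym_diff_measure M (cyl_box l -` (R \<union> R') \<inter> \<Omega>) (A \<union> B) < e"
    using sym_diff_measure_Un[OF box_vimage_sets[OF M, of l R] box_vimage_sets[OF M, of l R'] A(1) B(1)]
      S R by simp
  then show "\<exists>m S. sym_diff_measure M (cyl_box m -` S \<inter> \<Omega>) (A \<union> B) < e" by blast
qed

lemma box_approximable_sets:
  assumes "finite_measure M" and M: "sets M = sets (restrict_space borel \<Omega>)" and A: "A \<in> sets M"
  shows "box_approximable M A"
proof -
  interpret finite_measure M by fact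
  have box_self: "box_approximable M (cyl_box m -` S \<inter> \<Omega>)" for m S
    unfolding box_approximable_def
    by (auto simp: sym_diff_measure_def intro!: exI[of _ m] exI[of _ S])
  let ?G = "(\<inter>) \<Omega> ` {U. open U}"
  have sM: "sets M = sigma_sets \<Omega> ?G"
  proof -
    have b: "sets borel = sigma_sets UNIV {U :: ((int \<Rightarrow> nat) \<times> circle) set. open U}"
      by (simp add: borel_def)
    have "sets M = (\<inter>) \<Omega> ` sigma_sets UNIV {U. open U}"
      by (simp add: M sets_restrict_space b)
    also have "\<dots> = sigma_sets \<Omega> ?G"
      using skew_space_borel[of k] b by (intro sigma_sets_Int) auto
    finally show ?thesis .
  qed
  have "A \<in> sigma_sets \<Omega> ?G" using A sM by simp
  then have "A \<in> sets M \<and> box_approximable M A"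
  proof (induction rule: sigma_sets.induct)
    case (Basic A)
    then obtain U where U: "open U" "A = \<Omega> \<inter> U" by auto
    define S where "S m = {v. \<forall>\<omega>. cyl_box m \<omega> = v \<longrightarrow> \<omega> \<in> U}" for m
    let ?A = "\<lambda>m. cyl_box m -` S m \<inter> \<Omega>"
    have "A = (\<Union>m. ?A m)"
    proof
      show "A \<subseteq> (\<Union>m. ?A m)"
      proof
        fix \<omega> assume "\<omega> \<in> A"
        then have \<omega>: "\<omega> \<in> U" "\<omega> \<in> \<Omega>" using U(2) by auto
        obtain m where "\<forall>\<omega>'. cyl_box m \<omega>' = cyl_box m \<omega> \<longrightarrow> \<omega>' \<in> U" using box_shrinks[OF U(1) \<omega>(1)] by blast
        then show "\<omega> \<in> (\<Union>m. ?A m)" using \<omega>(2) by (auto simp: S_def)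
      qed
      show "(\<Union>m. ?A m) \<subseteq> A" using U(2) by (auto simp: S_def)
    qed
    moreover have "incseq ?A"
    proof (rule incseq_SucI, rule subsetI)
      fix m \<omega> assume \<omega>: "\<omega> \<in> ?A m"
      have "\<omega>' \<in> U" if "cyl_box (Suc m) \<omega>' = cyl_box (Suc m) \<omega>" for \<omega>'
        using \<omega> box_refine[OF le_SucI[OF order_refl] that] by (simp add: S_def del: split_paired_All)
      then show "\<omega> \<in> ?A (Suc m)" using \<omega> by (auto simp: S_def)
    qed
    moreover have rg: "range ?A \<subseteq> sets M" using box_vimage_sets[OF M] by auto
    ultimately have app: "\<exists>m. sym_diff_measure M (?A m) A < e" if "e > 0" for e
      using sym_diff_measure_incseq[of ?A e] that by simp
    have As: "A \<in> sets M" using sets.countable_UN[OF rg] \<open>A = (\<Union>m. ?A m)\<close> by simp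
    have "box_approximable M A"
      unfolding box_approximable_def using app by blast
    with As show ?case by blast
  next
    case Empty
    have "cyl_box 0 -` {} \<inter> \<Omega> = {}" by simp
    then show ?case using box_self[of 0 "{}"] by simp
  next
    case (Compl A)
    have "box_approximable M (\<Omega> - A)"
      unfolding box_approximable_def
    proof (intro allI impI)
      fix e :: real assume "e > 0"
      then obtain m S where S: "sym_diff_measure M (cyl_box m -` S \<inter> \<Omega>) A < e"
        using Compl unfolding box_approximable_def by blast
      have "A \<subseteq> \<Omega>" using Compl sets.sets_into_space space_of_sets_restrict_borel[OF M] by auto
      then have "(cyl_box m -` (- S) \<inter> \<Omega> - (\<Omega> - A)) \<union> (\<Omega> - A - cyl_box m -` (- S) \<inter> \<Omega>)
          = (cyl_box m -` S \<inter> \<Omega> - A) \<union> (A - cyl_box m -` S \<inter> \<Omega>)" by auto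
      then have "sym_diff_measure M (cyl_box m -` (- S) \<inter> \<Omega>) (\<Omega> - A) < e"
        using S by (simp add: sym_diff_measure_def)
      then show "\<exists>m S. sym_diff_measure M (cyl_box m -` S \<inter> \<Omega>) (\<Omega> - A) < e" by blast
    qed
    moreover have "\<Omega> - A \<in> sets M"
      using Compl sets.compl_sets[of A M] space_of_sets_restrict_borel[OF M] by simp
    ultimately show ?case by blast
  next
    case (Union a)
    define b where "b n = (\<Union>i<n. a i)" for n :: nat
    have b: "b n \<in> sets M \<and> box_approximable M (b n)" for n
    proof (induction n)
      case 0
      have "cyl_box 0 -` {} \<inter> \<Omega> = {}" by simp
      then show ?case using box_self[of 0 "{}"] by (simp add: b_def)
    next
      case (Suc n)
      have "b (Suc n) = b n \<union> a n" by (auto simp: b_def lessThan_Suc)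
      then show ?case
        using Suc Union.IH[of n] box_approximable_Un[OF \<open>finite_measure M\<close> M] by auto
    qed
    have "incseq b" unfolding b_def incseq_def by fastforce
    moreover have "(\<Union>n. b n) = (\<Union>i. a i)"
      unfolding b_def by (auto intro: lessI)
    moreover have "range b \<subseteq> sets M" using b by auto
    ultimately have "\<exists>n. sym_diff_measure M (b n) (\<Union>i. a i) < e" if "e > 0" for e
      using sym_diff_measure_incseq[of b e] that by simp
    moreover have Us: "(\<Union>i. a i) \<in> sets M" using Union.IH by auto
    ultimately have "box_approximable M (\<Union>i. a i)"
      using b by (intro box_approximable_limit[OF \<open>finite_measure M\<close> M]) blast+
    with Us show ?case by blast
  qed
  then show ?thesis by blast
qed

lemma partition_box_approximation:
  assumes "finite_measure M" and M: "sets M = sets (restrict_space borel \<Omega>)"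
    and P: "finite P" "P \<subseteq> sets M" and e: "e > 0"
  shows "\<exists>m S. \<forall>A\<in>P. sym_diff_measure M (cyl_box m -` S A \<inter> \<Omega>) A < e"
proof -
  have "\<forall>A\<in>P. \<exists>m S. sym_diff_measure M (cyl_box m -` S \<inter> \<Omega>) A < e"
    using box_approximable_sets[OF assms(1) M] P(2) e unfolding box_approximable_def by blast
  then obtain m S where mS: "\<And>A. A \<in> P \<Longrightarrow> sym_diff_measure M (cyl_box (m A) -` S A \<inter> \<Omega>) A < e"
    by metis
  define l where "l = Max (insert 0 (m ` P))"
  have "m A \<le> l" if "A \<in> P" for A unfolding l_def using P(1) that by simp
  then have "\<forall>A\<in>P. \<exists>S'. cyl_box (m A) -` S A \<inter> \<Omega> = cyl_box l -` S' \<inter> \<Omega>"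
    using box_vimage_refine by blast
  then obtain S' where "\<And>A. A \<in> P \<Longrightarrow> cyl_box (m A) -` S A \<inter> \<Omega> = cyl_box l -` S' A \<inter> \<Omega>" by metis
  then show ?thesis using mS by (intro exI[of _ l] exI[of _ S']) auto
qed

lemma continuous_on_fiber_iterate:
  assumes "\<xi> \<in> shift_space k"
  shows "continuous_on UNIV (fiber_iterate \<xi> n)"
  using fiber_iterate_deriv[OF assms] has_circle_deriv_isCont
  by (metis continuous_at_imp_continuous_on)

text \<open>
  Zero entropy along the fibers: over a fixed base point, the \<open>n\<close> iterates of the fiber maps cut the
  circle at the at most \<open>n * 2 ^ m\<close> preimages of dyadic points. Between two consecutive cuts the
  itinerary is constant by connectedness. Hence the number of itineraries grows only linearly in \<open>n\<close>.
\<close>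

lemma card_level_itineraries:
  assumes \<xi>: "\<xi> \<in> shift_space k"
  shows "card ((\<lambda>x. map (\<lambda>j. \<lfloor>2 ^ m * circle_coord (fiber_iterate \<xi> j x)\<rfloor>) [0..<n]) ` UNIV)
    \<le> 2 * (n * 2 ^ m) + 1"
proof -
  define E where "E = {x. 2 ^ m * circle_coord x \<in> \<int>}"
  have E_sub: "E \<subseteq> (\<lambda>i. circle_of (of_int i / 2 ^ m)) ` {0..<2 ^ m}"
  proof
    fix x assume "x \<in> E"
    then obtain i where i: "2 ^ m * circle_coord x = of_int i" by (auto simp: E_def elim: Ints_cases)
    then have "circle_coord x = of_int i / 2 ^ m" by (simp add: field_simps)
    then have "x = circle_of (of_int i / 2 ^ m)" by (metis circle_of_coord)
    moreover have "0 \<le> i"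
    proof -
      have "0 \<le> (of_int i :: real)" unfolding i[symmetric] by simp
      then show ?thesis by simp
    qed
    moreover have "i < 2 ^ m"
    proof -
      have "2 ^ m * circle_coord x < 2 ^ m * 1" by (intro mult_strict_left_mono) auto
      then have "of_int i < (of_int (2 ^ m) :: real)" unfolding i by simp
      then show ?thesis by (simp only: of_int_less_iff)
    qed
    ultimately show "x \<in> (\<lambda>i. circle_of (of_int i / 2 ^ m)) ` {0..<2 ^ m}" by auto
  qed
  then have finE: "finite E" by (rule finite_subset) simp
  have cardE: "card E \<le> 2 ^ m"
  proof -
    have "card E \<le> card ((\<lambda>i. circle_of (of_int i / 2 ^ m)) ` {0..<2 ^ m :: int})"
      using E_sub by (intro card_mono) auto
    also have "\<dots> \<le> card {0..<2 ^ m :: int}" by (rule card_image_le) simp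
    also have "\<dots> = 2 ^ m" by (simp add: nat_power_eq)
    finally show ?thesis .
  qed
  define D where "D = (\<Union>j<n. fiber_iterate \<xi> j -` E)"
  have inj: "inj (fiber_iterate \<xi> j)" for j using bij_fiber_iterate[OF \<xi>] by (rule bij_is_inj)
  have finD: "finite D" unfolding D_def using finE inj by (intro finite_UN_I finite_vimageI) auto
  have cardD: "card D \<le> n * 2 ^ m"
  proof -
    have "card D \<le> (\<Sum>j<n. card (fiber_iterate \<xi> j -` E))" unfolding D_def by (rule card_UN_le) simp
    also have "\<dots> \<le> (\<Sum>j<n. 2 ^ m)"
    proof (rule sum_mono)
      fix j
      have "card (fiber_iterate \<xi> j -` E) = card E"
        using bij_fiber_iterate[OF \<xi>, of j] by (intro card_vimage_inj) (auto simp: bij_is_inj bij_is_surj)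
      then show "card (fiber_iterate \<xi> j -` E) \<le> 2 ^ m" using cardE by simp
    qed
    finally show ?thesis by simp
  qed
  \<comment> \<open>The position of x relative to the cuts: the value is odd at a cut and even in a gap.\<close>
  define c where "c x = card {d \<in> D. circle_coord d < circle_coord x}
      + card {d \<in> D. circle_coord d \<le> circle_coord x}" for x
  have c_le: "c x \<le> 2 * (n * 2 ^ m)" for x
  proof -
    have "card {d \<in> D. circle_coord d < circle_coord x} \<le> card D"
      "card {d \<in> D. circle_coord d \<le> circle_coord x} \<le> card D"
      using finD by (auto intro!: card_mono)
    then show ?thesis using cardD by (simp add: c_def)
  qed
  let ?R = "\<lambda>x. map (\<lambda>j. \<lfloor>2 ^ m * circle_coord (fiber_iterate \<xi> j x)\<rfloor>) [0..<n]"
  have same: "?R x = ?R y" if c: "c x = c y" and le: "circle_coord x \<le> circle_coord y" for x y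
  proof (cases "circle_coord x = circle_coord y")
    case True
    then have "x = y" by (metis circle_of_coord)
    then show ?thesis by simp
  next
    case False
    let ?s = "circle_coord x" and ?t = "circle_coord y"
    have st: "?s < ?t" using False le by simp
    have fin: "finite {d \<in> D. Q d}" for Q using finD by simp
    have "card {d \<in> D. circle_coord d < ?s} \<le> card {d \<in> D. circle_coord d \<le> ?s}"
      "card {d \<in> D. circle_coord d \<le> ?s} \<le> card {d \<in> D. circle_coord d < ?t}"
      "card {d \<in> D. circle_coord d < ?t} \<le> card {d \<in> D. circle_coord d \<le> ?t}"
      using st by (intro card_mono fin; auto)+
    then have "card {d \<in> D. circle_coord d < ?s} = card {d \<in> D. circle_coord d \<le> ?t}"
      using c by (simp add: c_def)
    then have eq: "{d \<in> D. circle_coord d < ?s} = {d \<in> D. circle_coord d \<le> ?t}"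
      using st by (intro card_subset_eq fin) auto
    define I where "I = circle_of ` {?s..?t}"
    have conn: "connected I"
      unfolding I_def by (intro connected_continuous_image continuous_on_circle_of) simp
    have coord_I: "?s \<le> circle_coord z \<and> circle_coord z \<le> ?t" if zI: "z \<in> I" for z
    proof -
      obtain u where u: "z = circle_of u" "?s \<le> u" "u \<le> ?t" using zI by (auto simp: I_def)
      moreover have "circle_coord z = u"
        unfolding u(1) using u circle_coord_nonneg[of x] circle_coord_less_1[of y]
        by (intro circle_coord_of) linarith+
      ultimately show ?thesis by simp
    qed
    have notD: "z \<notin> D" if "z \<in> I" for z
    proof
      assume "z \<in> D"
      then have "z \<in> {d \<in> D. circle_coord d \<le> ?t}" using coord_I[OF that] by simp
      then have "z \<in> {d \<in> D. circle_coord d < ?s}" unfolding eq .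
      then show False using coord_I[OF that] by simp
    qed
    have "circle_of ?s \<in> I" "circle_of ?t \<in> I"
      unfolding I_def using st by (intro imageI; simp)+
    then have xy: "x \<in> I" "y \<in> I" by simp_all
    show ?thesis
    proof (rule map_cong[OF refl])
      fix j assume "j \<in> set [0..<n]"
      then have j: "j < n" by simp
      show "\<lfloor>2 ^ m * circle_coord (fiber_iterate \<xi> j x)\<rfloor> = \<lfloor>2 ^ m * circle_coord (fiber_iterate \<xi> j y)\<rfloor>"
      proof (rule level_constant_on_connected)
        show "connected (fiber_iterate \<xi> j ` I)"
          using conn continuous_on_subset[OF continuous_on_fiber_iterate[OF \<xi>]]
          by (intro connected_continuous_image) auto
        show "2 ^ m * circle_coord z \<notin> \<int>" if "z \<in> fiber_iterate \<xi> j ` I" for z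
          using that notD j by (auto simp: D_def E_def)
      qed (use xy in auto)
    qed
  qed
  have det: "?R x = ?R y" if "c x = c y" for x y
    using same[of x y] same[of y x] that by (cases "circle_coord x \<le> circle_coord y") auto
  obtain g where g: "\<And>x. x \<in> UNIV \<Longrightarrow> ?R x = (g \<circ> c) x"
    using factors_through[of UNIV c ?R] det by blast
  have "?R ` UNIV = g ` (c ` UNIV)" using g by (simp add: image_comp cong: image_cong)
  moreover have sub: "c ` UNIV \<subseteq> {..2 * (n * 2 ^ m)}" using c_le by auto
  moreover have "finite (c ` UNIV)" using sub by (rule finite_subset) simp
  moreover have "card (c ` UNIV) \<le> 2 * (n * 2 ^ m) + 1" using card_mono[OF _ sub] by simp
  ultimately show ?thesis
    using card_image_le[of "c ` UNIV" g] by simp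
qed

text \<open>
  The current symbol; its itineraries are the words of the base dynamics.
\<close>

definition symbol :: "(int \<Rightarrow> nat) \<times> circle \<Rightarrow> nat" where
  "symbol \<omega> = fst \<omega> 0"

lemma fst_F_pow_apply: "fst ((F ^^ j) \<omega>) i = fst \<omega> (i + int j)"
  by (simp add: fst_F_pow left_shift_pow)

lemma itinerary_symbol: "itinerary F symbol n \<omega> = map (\<lambda>j. fst \<omega> (int j)) [0..<n]"
  by (simp add: itinerary_def symbol_def fst_F_pow_apply)

lemma itinerary_level:
  "itinerary F (level m) n \<omega> =
    map (\<lambda>j. \<lfloor>2 ^ m * circle_coord (fiber_iterate (fst \<omega>) j (snd \<omega>))\<rfloor>) [0..<n]"
  using F_pow_eq[of _ "fst \<omega>" "snd \<omega>"] by (simp add: itinerary_def level_def)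

lemma lifts_measure_preserving:
  assumes "M \<in> lifts \<mu>"
  shows "measure_preserving M F"
proof -
  interpret prob_space M using assms by (rule liftsD)
  show ?thesis
    using measurable_F[OF liftsD(2)[OF assms]] liftsD(4)[OF assms] by unfold_locales
qed

lemma simple_symbol:
  assumes "sets M = sets (restrict_space borel \<Omega>)"
  shows "simple_function M symbol"
proof (rule simple_function_determined)
  show "simple_function M (window {0})" using assms by (rule simple_window) simp
qed (simp add: window_eq_iff symbol_def)

lemma fn_entropy_window_Un:
  assumes M: "prob_space M" "sets M = sets (restrict_space borel \<Omega>)" and "finite I" "finite J"
  shows "fn_entropy M (window (I \<union> J)) \<le> fn_entropy M (window I) + real (card J) * ln (real k)"
  using \<open>finite J\<close>
proof (induction J rule: finite_induct)
  case (insert i J)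
  interpret prob_space M by fact
  have sp: "space M = \<Omega>" using M(2) by (rule space_of_sets_restrict_borel)
  let ?s = "\<lambda>\<omega> :: (int \<Rightarrow> nat) \<times> circle. fst \<omega> i"
  have W: "simple_function M (window (I \<union> J))"
    using M(2) \<open>finite I\<close> insert.hyps by (intro simple_window) auto
  have s: "simple_function M ?s"
    using simple_window[OF M(2), of "{i}"] by (rule simple_function_determined) (auto simp: window_eq_iff)
  have "fn_entropy M (window (I \<union> insert i J)) \<le> fn_entropy M (\<lambda>\<omega>. (window (I \<union> J) \<omega>, ?s \<omega>))"
    using simple_function_Pair[OF W s] by (rule fn_entropy_mono) (auto simp: window_eq_iff)
  also have "\<dots> \<le> fn_entropy M (window (I \<union> J)) + fn_entropy M ?s"
    using W s by (rule fn_entropy_pair_le)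
  also have "fn_entropy M ?s \<le> ln (real k)"
  proof (rule fn_entropy_le_card[OF s])
    have "?s ` space M \<subseteq> {..<k}" by (auto simp: sp skew_space_def shift_space_def)
    then show "card (?s ` space M) \<le> k" using card_mono[of "{..<k}"] by fastforce
  qed
  finally show ?case using insert by (simp add: algebra_simps)
qed simp

text \<open>
  Itineraries with respect to boxes are determined by a slightly longer word of the base and by one
  of linearly many fiber itineraries, so they carry no more entropy than the base up to \<open>O(ln n)\<close>.
\<close>

lemma fn_entropy_cyl_box_itinerary_le:
  assumes Ml: "M \<in> lifts \<mu>"
  shows "fn_entropy M (itinerary F (cyl_box m) n) \<le> fn_entropy M (itinerary F symbol n)
    + real (2 * m) * ln (real k) + ln (real (2 * (n * 2 ^ m) + 1))"
proof -
  interpret measure_preserving M F using Ml by (rule lifts_measure_preserving)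
  have M: "sets M = sets (restrict_space borel \<Omega>)" and sp: "space M = \<Omega>"
    using liftsD[OF Ml] by auto
  define J where "J = {- int m..<int n + int m}"
  let ?Y = "itinerary F (level m) n"
  have W: "simple_function M (window J)" using M by (rule simple_window) (simp add: J_def)
  have Y: "simple_function M ?Y" by (rule simple_itinerary[OF simple_level[OF M]])
  have "fn_entropy M (itinerary F (cyl_box m) n) \<le> fn_entropy M (\<lambda>\<omega>. (window J \<omega>, ?Y \<omega>))"
    using simple_function_Pair[OF W Y]
  proof (rule fn_entropy_mono)
    fix \<omega> \<omega>' assume "(window J \<omega>, ?Y \<omega>) = (window J \<omega>', ?Y \<omega>')"
    then have w: "\<And>i. i \<in> J \<Longrightarrow> fst \<omega> i = fst \<omega>' i"
      and l: "\<And>j. j < n \<Longrightarrow> level m ((F ^^ j) \<omega>) = level m ((F ^^ j) \<omega>')"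
      by (auto simp: window_eq_iff itinerary_eq_iff)
    show "itinerary F (cyl_box m) n \<omega> = itinerary F (cyl_box m) n \<omega>'"
      unfolding itinerary_eq_iff
    proof (intro allI impI)
      fix j assume j: "j < n"
      have "i + int j \<in> J" if "i \<in> {- int m..int m}" for i
        using that j by (auto simp: J_def)
      then show "cyl_box m ((F ^^ j) \<omega>) = cyl_box m ((F ^^ j) \<omega>')"
        using l[OF j] w by (simp add: cyl_box_def window_eq_iff fst_F_pow_apply)
    qed
  qed
  also have "\<dots> \<le> fn_entropy M (window J) + ln (real (2 * (n * 2 ^ m) + 1))"
    using W Y
  proof (rule fn_entropy_pair_le_card)
    fix v assume "v \<in> window J ` space M"
    then obtain \<eta> where \<eta>: "\<eta> \<in> \<Omega>" "v = window J \<eta>" by (auto simp: sp)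
    define \<xi> where "\<xi> = fst \<eta>"
    have \<xi>: "\<xi> \<in> shift_space k" using \<eta>(1) by (auto simp: \<xi>_def skew_space_def)
    let ?R = "\<lambda>x. map (\<lambda>j. \<lfloor>2 ^ m * circle_coord (fiber_iterate \<xi> j x)\<rfloor>) [0..<n]"
    have "?R x = ?Y (\<xi>, x)" for x by (simp add: itinerary_level)
    then have "?R ` UNIV \<subseteq> ?Y ` space M"
      using \<xi> by (auto simp: sp skew_space_def intro!: image_eqI[of _ ?Y "(\<xi>, _)"])
    then have fin: "finite (?R ` UNIV)"
      using simple_functionD(1)[OF Y] by (rule finite_subset)
    have "?Y ` (window J -` {v} \<inter> space M) \<subseteq> ?R ` UNIV"
    proof (rule image_subsetI)
      fix \<omega> assume "\<omega> \<in> window J -` {v} \<inter> space M"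
      then have "\<And>i. i \<in> J \<Longrightarrow> fst \<omega> i = \<xi> i" by (simp add: \<eta> window_eq_iff \<xi>_def)
      then have "fiber_iterate (fst \<omega>) j = fiber_iterate \<xi> j" if "j < n" for j
        using that by (intro fiber_iterate_cong) (auto simp: J_def)
      then have "?Y \<omega> = ?R (snd \<omega>)" by (simp add: itinerary_level)
      then show "?Y \<omega> \<in> ?R ` UNIV" by blast
    qed
    then have "card (?Y ` (window J -` {v} \<inter> space M)) \<le> card (?R ` UNIV)"
      using fin by (rule card_mono[rotated])
    also have "\<dots> \<le> 2 * (n * 2 ^ m) + 1" using \<xi> by (rule card_level_itineraries)
    finally show "card (?Y ` (window J -` {v} \<inter> space M)) \<le> 2 * (n * 2 ^ m) + 1" .
  qed
  also have "fn_entropy M (window J) \<le> fn_entropy M (window {0..<int n}) + real (2 * m) * ln (real k)"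
  proof -
    have J: "{0..<int n} \<union> (J - {0..<int n}) = J" by (auto simp: J_def)
    have "card (J - {0..<int n}) = card J - card {0..<int n}"
      by (intro card_Diff_subset) (auto simp: J_def)
    then have "card (J - {0..<int n}) = 2 * m" by (simp add: J_def)
    then show ?thesis
      using fn_entropy_window_Un[OF prob_space_axioms M, of "{0..<int n}" "J - {0..<int n}"]
      unfolding J by (simp add: J_def)
  qed
  also have "fn_entropy M (window {0..<int n}) = fn_entropy M (itinerary F symbol n)"
  proof (rule fn_entropy_eqI[OF simple_itinerary[OF simple_symbol[OF M]]])
    fix \<omega> \<omega>' :: "(int \<Rightarrow> nat) \<times> circle"
    have "(\<forall>j<n. fst \<omega> (int j) = fst \<omega>' (int j)) \<longleftrightarrow> (\<forall>i\<in>{0..<int n}. fst \<omega> i = fst \<omega>' i)"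
      by (metis atLeastLessThan_iff of_nat_0_le_iff of_nat_less_iff zero_le_imp_eq_int)
    then show "itinerary F symbol n \<omega> = itinerary F symbol n \<omega>' \<longleftrightarrow>
        window {0..<int n} \<omega> = window {0..<int n} \<omega>'"
      by (simp add: itinerary_symbol window_eq_iff Ball_def)
  qed
  finally show ?thesis by simp
qed

lemma log_linear_over_n_tendsto:
  "(\<lambda>n. (c + ln (real (2 * (n * 2 ^ m) + 1))) / real n) \<longlonglongrightarrow> 0"
proof (rule tendsto_sandwich)
  show "(\<lambda>n. - \<bar>c\<bar> / real n) \<longlonglongrightarrow> 0" by (rule lim_const_over_n)
  have "(\<lambda>n. (\<bar>c\<bar> + ln (2 ^ (m + 2))) / real n + ln (real n) / real n) \<longlonglongrightarrow> 0 + 0"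
    by (intro tendsto_add lim_ln_over_n lim_const_over_n)
  then show "(\<lambda>n. (\<bar>c\<bar> + ln (2 ^ (m + 2))) / real n + ln (real n) / real n) \<longlonglongrightarrow> 0" by simp
  show "\<forall>\<^sub>F n in sequentially. - \<bar>c\<bar> / real n \<le> (c + ln (real (2 * (n * 2 ^ m) + 1))) / real n"
  proof (intro always_eventually allI divide_right_mono)
    fix n
    have "0 \<le> ln (real (2 * (n * 2 ^ m) + 1))" by (intro ln_ge_zero) simp
    then show "- \<bar>c\<bar> \<le> c + ln (real (2 * (n * 2 ^ m) + 1))" by linarith
  qed simp
  show "\<forall>\<^sub>F n in sequentially. (c + ln (real (2 * (n * 2 ^ m) + 1))) / real n
      \<le> (\<bar>c\<bar> + ln (2 ^ (m + 2))) / real n + ln (real n) / real n"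
    using eventually_gt_at_top[of 0]
  proof eventually_elim
    case (elim n)
    have "1 \<le> real n * 2 ^ m" using elim by (simp add: mult_ge1_I)
    then have "real (2 * (n * 2 ^ m) + 1) \<le> 2 ^ (m + 2) * real n" by simp
    then have "ln (real (2 * (n * 2 ^ m) + 1)) \<le> ln (2 ^ (m + 2) * real n)" by simp
    also have "\<dots> = ln (2 ^ (m + 2)) + ln (real n)" using elim by (intro ln_mult_pos) auto
    finally have "c + ln (real (2 * (n * 2 ^ m) + 1)) \<le> \<bar>c\<bar> + ln (2 ^ (m + 2)) + ln (real n)" by linarith
    then show ?case using elim by (simp add: divide_right_mono flip: add_divide_distrib)
  qed
qed

text \<open>
  Every partition is, up to small errors, coarser than a box partition. Recording the errors, one
  bit for each element of the partition, recovers the partition exactly and costs at most \<open>e\<close>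
  per time step.
\<close>

lemma entropy_wrt_partition_le:
  assumes Ml: "M \<in> lifts \<mu>" and P: "finite_measurable_partition M P"
    and h: "(\<lambda>n. fn_entropy M (itinerary F symbol n) / real n) \<longlonglongrightarrow> h"
  shows "entropy_wrt_partition F M P \<le> h"
proof (rule field_le_epsilon)
  fix e :: real assume "e > 0"
  interpret measure_preserving M F using Ml by (rule lifts_measure_preserving)
  have M: "sets M = sets (restrict_space borel \<Omega>)" and sp: "space M = \<Omega>"
    using liftsD[OF Ml] by auto
  have fin: "finite P" and sub: "P \<subseteq> sets M"
    using P by (auto simp: finite_measurable_partition_def)
  define e' where "e' = e / (real (card P) + 1)"
  have "e' > 0" using \<open>e > 0\<close> by (simp add: e'_def)
  obtain d where d: "d > 0" "\<And>M E. prob_space M \<Longrightarrow> simple_function M E \<Longrightarrow>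
      measure M {\<omega> \<in> space M. E \<omega>} < d \<Longrightarrow>
      fn_entropy M (E :: (int \<Rightarrow> nat) \<times> circle \<Rightarrow> bool) \<le> e'"
    using binary_entropy_small[OF \<open>e' > 0\<close>] by metis
  obtain m S where S: "\<And>A. A \<in> P \<Longrightarrow> sym_diff_measure M (cyl_box m -` S A \<inter> \<Omega>) A < d"
    using partition_box_approximation[OF finite_measure_axioms M fin sub d(1)] by blast
  \<comment> \<open>The error bit: whether the box approximation misplaces the point relative to A.\<close>
  define E where "E A \<omega> \<longleftrightarrow> (cyl_box m \<omega> \<in> S A) \<noteq> (\<omega> \<in> A)" for A \<omega>
  have E: "simple_function M (E A)" "fn_entropy M (E A) \<le> e'" if A: "A \<in> P" for A
  proof -
    have AO: "A \<subseteq> \<Omega>" using A sub sets.sets_into_space sp by blast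
    have As: "A \<in> sets M" using A sub by blast
    have "{\<omega> \<in> space M. E A \<omega>} = (cyl_box m -` S A \<inter> \<Omega> - A) \<union> (A - cyl_box m -` S A \<inter> \<Omega>)"
      using AO by (auto simp: E_def sp)
    then have Es: "{\<omega> \<in> space M. E A \<omega>} \<in> sets M"
      and Em: "measure M {\<omega> \<in> space M. E A \<omega>} < d"
      using S[OF A] box_vimage_sets[OF M, of m "S A"] As by (auto simp: sym_diff_measure_def)
    show s: "simple_function M (E A)"
      unfolding simple_function_def
    proof (intro conjI ballI)
      show "finite (E A ` space M)" by (rule finite_subset[OF subset_UNIV]) simp
      fix b
      have "E A -` {b} \<inter> space M = (if b then {\<omega> \<in> space M. E A \<omega>} else space M - {\<omega> \<in> space M. E A \<omega>})"
        by auto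
      then show "E A -` {b} \<inter> space M \<in> sets M" using Es by auto
    qed
    show "fn_entropy M (E A) \<le> e'" using prob_space_axioms s Em by (rule d(2))
  qed
  define G where "G \<omega> A \<longleftrightarrow> A \<in> P \<and> E A \<omega>" for \<omega> A
  have G: "simple_function M G" "fn_entropy M G \<le> (\<Sum>A\<in>P. fn_entropy M (E A))"
    using simple_function_family[OF fin, of E] fn_entropy_family_le[OF fin, of E] E(1)
    by (auto simp: G_def[abs_def])
  have "(\<Sum>A\<in>P. fn_entropy M (E A)) \<le> (\<Sum>A\<in>P. e')" using E(2) by (rule sum_mono)
  also have "\<dots> \<le> e" using \<open>e > 0\<close> by (simp add: e'_def field_simps)
  finally have Ge: "fn_entropy M G \<le> e" using G(2) by linarith
  let ?Q = "cyl_box m"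
  have Q: "simple_function M ?Q" using M by (rule simple_box)
  have bound: "fn_entropy M (itinerary F (atom P) n) / real n \<le>
      fn_entropy M (itinerary F symbol n) / real n
      + (real (2 * m) * ln (real k) + ln (real (2 * (n * 2 ^ m) + 1))) / real n + e" if n: "n \<ge> 1" for n
  proof -
    have "fn_entropy M (itinerary F (atom P) n) \<le>
        fn_entropy M (\<lambda>\<omega>. (itinerary F ?Q n \<omega>, itinerary F G n \<omega>))"
      using simple_function_Pair[OF simple_itinerary[OF Q] simple_itinerary[OF G(1)]]
    proof (rule fn_entropy_mono)
      fix \<omega> \<omega>' assume \<omega>: "\<omega> \<in> space M" "\<omega>' \<in> space M"
        and "(itinerary F ?Q n \<omega>, itinerary F G n \<omega>) = (itinerary F ?Q n \<omega>', itinerary F G n \<omega>')"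
      then have eq: "?Q ((F ^^ j) \<omega>) = ?Q ((F ^^ j) \<omega>')" "G ((F ^^ j) \<omega>) = G ((F ^^ j) \<omega>')"
        if "j < n" for j using that by (auto simp: itinerary_eq_iff)
      show "itinerary F (atom P) n \<omega> = itinerary F (atom P) n \<omega>'"
        unfolding itinerary_eq_iff
      proof (intro allI impI)
        fix j assume j: "j < n"
        show "atom P ((F ^^ j) \<omega>) = atom P ((F ^^ j) \<omega>')"
          unfolding atom_eq_iff[OF P T_pow_space[OF \<omega>(1)] T_pow_space[OF \<omega>(2)]]
        proof
          fix A assume A: "A \<in> P"
          then have "E A ((F ^^ j) \<omega>) = E A ((F ^^ j) \<omega>')"
            using fun_cong[OF eq(2)[OF j], of A] by (simp add: G_def)
          then show "(F ^^ j) \<omega> \<in> A \<longleftrightarrow> (F ^^ j) \<omega>' \<in> A"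
            using eq(1)[OF j] by (auto simp: E_def)
        qed
      qed
    qed
    also have "\<dots> \<le> fn_entropy M (itinerary F ?Q n) + fn_entropy M (itinerary F G n)"
      by (intro fn_entropy_pair_le simple_itinerary Q G(1))
    also have "\<dots> \<le> (fn_entropy M (itinerary F symbol n) + real (2 * m) * ln (real k)
        + ln (real (2 * (n * 2 ^ m) + 1))) + real n * e"
      using fn_entropy_cyl_box_itinerary_le[OF Ml, of m n] fn_entropy_itinerary_le[OF G(1), of n]
        mult_left_mono[OF Ge, of "real n"] by simp
    finally have "fn_entropy M (itinerary F (atom P) n) / real n \<le>
        (fn_entropy M (itinerary F symbol n) + real (2 * m) * ln (real k)
        + ln (real (2 * (n * 2 ^ m) + 1)) + real n * e) / real n"
      by (rule divide_right_mono) simp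
    also have "\<dots> = fn_entropy M (itinerary F symbol n) / real n
      + (real (2 * m) * ln (real k) + ln (real (2 * (n * 2 ^ m) + 1))) / real n + e"
      using n by (simp add: add_divide_distrib)
    finally show ?thesis .
  qed
  have "(\<lambda>n. fn_entropy M (itinerary F symbol n) / real n
      + (real (2 * m) * ln (real k) + ln (real (2 * (n * 2 ^ m) + 1))) / real n + e) \<longlonglongrightarrow> h + 0 + e"
    by (intro tendsto_add h log_linear_over_n_tendsto tendsto_const)
  then have "entropy_wrt_partition F M P \<le> h + 0 + e"
    using entropy_wrt_partition_limit[OF P] bound
    by (intro LIMSEQ_le[of _ "entropy_wrt_partition F M P"]) auto
  then show "entropy_wrt_partition F M P \<le> h + e" by simp
qed

lemma metric_entropy_lift:
  assumes Ml: "M \<in> lifts \<mu>"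
  shows "metric_entropy F M = ereal (lim (\<lambda>n. fn_entropy M (itinerary F symbol n) / real n))"
proof -
  interpret measure_preserving M F using Ml by (rule lifts_measure_preserving)
  have M: "sets M = sets (restrict_space borel \<Omega>)" using liftsD[OF Ml] by auto
  define h where "h = lim (\<lambda>n. fn_entropy M (itinerary F symbol n) / real n)"
  have s: "simple_function M symbol" using M by (rule simple_symbol)
  have h: "(\<lambda>n. fn_entropy M (itinerary F symbol n) / real n) \<longlonglongrightarrow> h"
    using convergent_fn_entropy_itinerary[OF s] by (simp add: h_def convergent_LIMSEQ_iff)
  define C where "C = (\<lambda>v. symbol -` {v} \<inter> space M) ` (symbol ` space M)"
  have C: "finite_measurable_partition M C"
    unfolding finite_measurable_partition_def partition_on_def disjoint_def
    using simple_functionD[OF s] by (auto simp: C_def)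
  have "fn_entropy M (itinerary F (atom C) n) = fn_entropy M (itinerary F symbol n)" for n
  proof (rule fn_entropy_eqI[OF simple_itinerary[OF s]])
    fix \<omega> \<omega>' assume \<omega>: "\<omega> \<in> space M" "\<omega>' \<in> space M"
    have "symbol \<eta> = symbol \<eta>' \<longleftrightarrow> atom C \<eta> = atom C \<eta>'" if "\<eta> \<in> space M" "\<eta>' \<in> space M" for \<eta> \<eta>'
      unfolding atom_eq_iff[OF C that] using that by (auto simp: C_def)
    then show "itinerary F symbol n \<omega> = itinerary F symbol n \<omega>' \<longleftrightarrow>
        itinerary F (atom C) n \<omega> = itinerary F (atom C) n \<omega>'"
      using T_pow_space[OF \<omega>(1)] T_pow_space[OF \<omega>(2)] by (simp add: itinerary_eq_iff)
  qed
  then have "entropy_wrt_partition F M C = h"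
    using entropy_wrt_partition_limit[OF C] h by (simp add: LIMSEQ_unique)
  then have "ereal h \<le> metric_entropy F M"
    unfolding metric_entropy_def using C by (intro SUP_upper2[of C]) auto
  moreover have "metric_entropy F M \<le> ereal h"
    unfolding metric_entropy_def
    using entropy_wrt_partition_le[OF Ml _ h] by (intro SUP_least) auto
  ultimately show ?thesis by (simp add: h_def antisym)
qed

lemma fn_entropy_symbol_lift:
  assumes Ml: "M \<in> lifts \<mu>" and \<mu>: "sets \<mu> = sets (restrict_space borel \<Omega>)"
  shows "fn_entropy M (itinerary F symbol n) = fn_entropy \<mu> (itinerary F symbol n)"
proof -
  have sp: "space M = \<Omega>" "space \<mu> = \<Omega>"
    using liftsD[OF Ml] space_of_sets_restrict_borel[OF \<mu>] by auto
  have "measure M (itinerary F symbol n -` {v} \<inter> \<Omega>) = measure \<mu> (itinerary F symbol n -` {v} \<inter> \<Omega>)" for v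
  proof -
    define g where "g \<xi> = map (\<lambda>j. \<xi> (int j)) [0..<n]" for \<xi> :: "int \<Rightarrow> nat"
    define u where "u \<xi> = (if g \<xi> = v then 1 else 0 :: real)" for \<xi>
    have "continuous_on UNIV u"
    proof (rule locally_constant_continuous[where I = "{0..<int n}"])
      fix \<xi> \<eta> :: "int \<Rightarrow> nat" assume "\<And>i. i \<in> {0..<int n} \<Longrightarrow> \<xi> i = \<eta> i"
      then have "g \<xi> = g \<eta>" by (simp add: g_def)
      then show "u \<xi> = u \<eta>" by (simp add: u_def)
    qed simp
    then have "open {\<xi>. 1 / 2 < u \<xi>}" by (intro open_Collect_less) auto
    moreover have "{\<xi>. 1 / 2 < u \<xi>} = g -` {v}" by (auto simp: u_def)
    ultimately have "g -` {v} \<in> sets borel" by simp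
    moreover have "itinerary F symbol n -` {v} \<inter> \<Omega> = fst -` (g -` {v}) \<inter> \<Omega>"
      by (auto simp: itinerary_symbol g_def)
    ultimately show ?thesis using lifts_measure_fst[OF Ml \<mu>] by simp
  qed
  then show ?thesis by (simp add: fn_entropy_def sp)
qed

lemma metric_entropy_lift_eq:
  assumes "\<mu> \<in> invariant_prob_measures \<Omega> F" and "M \<in> lifts \<mu>"
  shows "metric_entropy F M = metric_entropy F \<mu>"
proof -
  have \<mu>: "\<mu> \<in> lifts \<mu>" using assms(1) by (simp add: lifts_def)
  show ?thesis
    unfolding metric_entropy_lift[OF assms(2)] metric_entropy_lift[OF \<mu>]
    by (simp add: fn_entropy_symbol_lift[OF assms(2) liftsD(2)[OF \<mu>]])
qed

end

theorem fact4:
  fixes k :: nat and f :: "nat \<Rightarrow> circle \<Rightarrow> circle"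
  assumes "k \<ge> 2"
    and "\<forall>i<k. circle_C1_diffeo (f i)"
    and "transitive_on (skew_space k) (skew_product f)"
  shows "\<forall>\<mu> \<in> invariant_prob_measures (skew_space k) (skew_product f).
           fiber_exponent f \<mu> < 0 \<longrightarrow>
           (\<exists>\<mu>' \<in> invariant_prob_measures (skew_space k) (skew_product f).
              fiber_exponent f \<mu>' \<ge> 0 \<and>
              metric_entropy (skew_product f) \<mu>' = metric_entropy (skew_product f) \<mu> \<and>
              (ergodic (skew_product f) \<mu> \<longrightarrow> ergodic (skew_product f) \<mu>'))"
proof (intro ballI impI)
  interpret circle_skew_product k f
    using assms by unfold_locales auto
  fix \<mu> assume \<mu>: "\<mu> \<in> invariant_prob_measures (skew_space k) (skew_product f)"
  obtain M where M: "M \<in> lifts \<mu>" "fiber_exponent f M \<ge> 0"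
    "ergodic (skew_product f) \<mu> \<Longrightarrow> ergodic (skew_product f) M"
    using exists_nonneg_lift_ergodic[OF \<mu>] by blast
  moreover have "M \<in> invariant_prob_measures (skew_space k) (skew_product f)"
    using M(1) by (simp add: lifts_def)
  ultimately show "\<exists>\<mu>' \<in> invariant_prob_measures (skew_space k) (skew_product f).
      fiber_exponent f \<mu>' \<ge> 0 \<and>
      metric_entropy (skew_product f) \<mu>' = metric_entropy (skew_product f) \<mu> \<and>
      (ergodic (skew_product f) \<mu> \<longrightarrow> ergodic (skew_product f) \<mu>')"
    using metric_entropy_lift_eq[OF \<mu> M(1)] by blast
qed

end
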